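(* Let $(R,\mathfrak{m}, k)$ be a commutative noetherian local ring, $I$ a proper ideal in $R$, and $A$ a dg-algebra over $R$. If $H_0(A)=R/I$ and $A$ is minimal, meaning $\partial(A_i)\subseteq \mathfrak{m} A_{i-1}$ for all $i$, then $$\operatorname{level}^R A \geq \operatorname{f-rank}_{R/I} (I/I^2)+1.$$ Specifically, when $I$ is generated by a finite sequence $\underline{x}=x_1,\ldots,x_n$, then $$\operatorname{level}^R K(\underline{x};R) \geq \operatorname{f-rank}_{R/I} (I/I^2)+1.$$
   Context: The free rank $\operatorname{f-rank}_{S}(M)$ of a module $M$ over a ring $S$ is the largest rank of a free direct summand of $M$. $K(\underline{x};R)$ is the Koszul complex on $\underline{x}$ over $R$. A dg-algebra over $R$ is a complex of $R$-modules $(A,\partial)$ with $A_i=0$ for $i<0$, together with an associative unital $R$-bilinear product $A_i\times A_j\to A_{i+j}$ satisfying the Leibniz rule $\partial(ab)=\partial(a)b+(-1)^{|a|}a\,\partial(b)$ and graded commutativity: $ab=(-1)^{|a||b|}ba$, and $a^2=0$ when $|a|$ is odd. The equality $H_0(A)=R/I$ is as $R$-algebras. $\operatorname{level}^R A$ is the level of the underlying $R$-complex of $A$. Level: let $\mathsf{D}(R)$ be the derived category of $R$-modules with suspension $\Sigma$. Define recursively classes of objects of $\mathsf{D}(R)$: $\mathsf{T}^0$ consists of the complexes quasi-isomorphic to $0$; $\mathsf{T}^1$ consists of the complexes built from $R$ using (de)suspensions, finite direct sums and retracts (i.e. isomorphic in $\mathsf{D}(R)$ to direct summands of finite direct sums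 of complexes $\Sigma^j R$, $j\in\mathbb{Z}$); for $n\ge 2$, $\mathsf{T}^n$ consists of the complexes $M$ for which there are a complex $L$ and an exact triangle $K\to L\oplus M\to N\to \Sigma K$ in $\mathsf{D}(R)$ with $K\in\mathsf{T}^1$ and $N\in \mathsf{T}^{n-1}$. Then $\operatorname{level}^R M=\inf\{n\ge 0 : M\in \mathsf{T}^n\}$, which is $\infty$ if no such $n$ exists. *)

theory Defs
  imports "HOL-Algebra.Module" "HOL-Algebra.QuotRing" "HOL-Algebra.Ideal_Product"
    "HOL-Algebra.Ring_Divisibility" "HOL-Library.Extended_Nat"
begin

section \<open>Modules\<close>

text \<open>
  Modules are \<open>module\<close> records of HOL-Algebra. The ring fields \<open>mult\<close> and \<open>one\<close> of such a record
  carry no meaning for a plain module and are left \<open>undefined\<close>.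
\<close>

definition lin_map ::
  "('r, 'x) ring_scheme \<Rightarrow> ('r, 'a) module \<Rightarrow> ('r, 'b) module \<Rightarrow> ('a \<Rightarrow> 'b) \<Rightarrow> bool" where
  "lin_map R M N f \<longleftrightarrow>
     f \<in> carrier M \<rightarrow> carrier N \<and>
     (\<forall>x \<in> carrier M. \<forall>y \<in> carrier M. f (x \<oplus>\<^bsub>M\<^esub> y) = f x \<oplus>\<^bsub>N\<^esub> f y) \<and>
     (\<forall>r \<in> carrier R. \<forall>x \<in> carrier M. f (r \<odot>\<^bsub>M\<^esub> x) = r \<odot>\<^bsub>N\<^esub> f x)"

definition quot_module :: "('r, 'a) module \<Rightarrow> 'a set \<Rightarrow> ('r, 'a set) module" where
  "quot_module M N =
     \<lparr>carrier = a_rcosets\<^bsub>M\<^esub> N, monoid.mult = undefined, one = undefined, ring.zero = N, add = set_add M,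
      smult = (\<lambda>r C. \<Union>x\<in>C. N +>\<^bsub>M\<^esub> (r \<odot>\<^bsub>M\<^esub> x))\<rparr>"

definition dsum_module :: "('r, 'a) module \<Rightarrow> ('r, 'b) module \<Rightarrow> ('r, 'a \<times> 'b) module" where
  "dsum_module M N =
     \<lparr>carrier = carrier M \<times> carrier N, monoid.mult = undefined, one = undefined,
      ring.zero = (\<zero>\<^bsub>M\<^esub>, \<zero>\<^bsub>N\<^esub>),
      add = (\<lambda>(x, y) (x', y'). (x \<oplus>\<^bsub>M\<^esub> x', y \<oplus>\<^bsub>N\<^esub> y')),
      smult = (\<lambda>r (x, y). (r \<odot>\<^bsub>M\<^esub> x, r \<odot>\<^bsub>N\<^esub> y))\<rparr>"

text \<open>The free module on a finite set \<open>B\<close>; elements are coefficient functions, zero outside \<open>B\<close>.\<close>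

definition free_module :: "('r, 'x) ring_scheme \<Rightarrow> 'b set \<Rightarrow> ('r, 'b \<Rightarrow> 'r) module" where
  "free_module R B =
     \<lparr>carrier = {c. (\<forall>b \<in> B. c b \<in> carrier R) \<and> (\<forall>b. b \<notin> B \<longrightarrow> c b = \<zero>\<^bsub>R\<^esub>)},
      monoid.mult = undefined, one = undefined, ring.zero = (\<lambda>_. \<zero>\<^bsub>R\<^esub>),
      add = (\<lambda>c d b. c b \<oplus>\<^bsub>R\<^esub> d b),
      smult = (\<lambda>r c b. r \<otimes>\<^bsub>R\<^esub> c b)\<rparr>"

inductive_set ideal_smult :: "('r, 'x) ring_scheme \<Rightarrow> 'r set \<Rightarrow> ('r, 'a) module \<Rightarrow> 'a set"
  for R J M where
    prod: "\<lbrakk> r \<in> J; x \<in> carrier M \<rbrakk> \<Longrightarrow> r \<odot>\<^bsub>M\<^esub> x \<in> ideal_smult R J M"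
  | sum: "\<lbrakk> x \<in> ideal_smult R J M; y \<in> ideal_smult R J M \<rbrakk> \<Longrightarrow> x \<oplus>\<^bsub>M\<^esub> y \<in> ideal_smult R J M"

definition alt_sign :: "('r, 'a, 'z) module_scheme \<Rightarrow> int \<Rightarrow> 'a \<Rightarrow> 'a" where
  "alt_sign M i x = (if even i then x else \<ominus>\<^bsub>M\<^esub> x)"

definition free_of_rank :: "('s, 'x) ring_scheme \<Rightarrow> ('s, 'a) module \<Rightarrow> 'a set \<Rightarrow> nat \<Rightarrow> bool" where
  "free_of_rank S M F n \<longleftrightarrow>
     (\<exists>e \<in> {..<n} \<rightarrow> F. \<forall>x \<in> F. \<exists>!c. c \<in> {..<n} \<rightarrow>\<^sub>E carrier S \<and>
        x = (\<Oplus>\<^bsub>M\<^esub>i\<in>{..<n}. c i \<odot>\<^bsub>M\<^esub> e i))"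

definition direct_summand :: "('s, 'x) ring_scheme \<Rightarrow> ('s, 'a) module \<Rightarrow> 'a set \<Rightarrow> bool" where
  "direct_summand S M F \<longleftrightarrow> submodule F S M \<and>
     (\<exists>N. submodule N S M \<and> F \<inter> N = {\<zero>\<^bsub>M\<^esub>} \<and> F <+>\<^bsub>M\<^esub> N = carrier M)"

text \<open>The largest rank of a free direct summand (\<open>\<infinity>\<close> if these ranks are unbounded).\<close>

definition free_rank :: "('s, 'x) ring_scheme \<Rightarrow> ('s, 'a) module \<Rightarrow> enat" where
  "free_rank S M = Sup {enat n | n. \<exists>F. direct_summand S M F \<and> free_of_rank S M F n}"

text \<open>The conormal module \<open>I/I\<^sup>2\<close>, as a module over \<open>R Quot I\<close>; \<open>I \<cdot>\<^bsub>R\<^esub> I\<close> is the product ideal.\<close>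

definition conormal :: "('r, 'x) ring_scheme \<Rightarrow> 'r set \<Rightarrow> ('r set, 'r set) module" where
  "conormal R I =
     \<lparr>carrier = {(I \<cdot>\<^bsub>R\<^esub> I) +>\<^bsub>R\<^esub> x | x. x \<in> I}, monoid.mult = undefined, one = undefined,
      ring.zero = I \<cdot>\<^bsub>R\<^esub> I, add = set_add R,
      smult = (\<lambda>a C. \<Union>r\<in>a. \<Union>x\<in>C. (I \<cdot>\<^bsub>R\<^esub> I) +>\<^bsub>R\<^esub> (r \<otimes>\<^bsub>R\<^esub> x))\<rparr>"

section \<open>Complexes\<close>

text \<open>Complexes are graded homologically: \<open>bdry X i\<close> maps \<open>grade X i\<close> to \<open>grade X (i - 1)\<close>.\<close>

record ('r, 'a) cpx =
  grade :: "int \<Rightarrow> ('r, 'a) module"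
  bdry :: "int \<Rightarrow> 'a \<Rightarrow> 'a"

definition chain_complex :: "('r, 'x) ring_scheme \<Rightarrow> ('r, 'a) cpx \<Rightarrow> bool" where
  "chain_complex R X \<longleftrightarrow>
     (\<forall>i. module R (grade X i)) \<and>
     (\<forall>i. lin_map R (grade X i) (grade X (i - 1)) (bdry X i)) \<and>
     (\<forall>i. \<forall>x \<in> carrier (grade X i). bdry X (i - 1) (bdry X i x) = \<zero>\<^bsub>grade X (i - 1 - 1)\<^esub>)"

definition chain_map ::
  "('r, 'x) ring_scheme \<Rightarrow> ('r, 'a) cpx \<Rightarrow> ('r, 'b) cpx \<Rightarrow> (int \<Rightarrow> 'a \<Rightarrow> 'b) \<Rightarrow> bool" where
  "chain_map R X Y f \<longleftrightarrow>
     (\<forall>i. lin_map R (grade X i) (grade Y i) (f i)) \<and>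
     (\<forall>i. \<forall>x \<in> carrier (grade X i). f (i - 1) (bdry X i x) = bdry Y i (f i x))"

definition chain_iso ::
  "('r, 'x) ring_scheme \<Rightarrow> ('r, 'a) cpx \<Rightarrow> ('r, 'b) cpx \<Rightarrow> (int \<Rightarrow> 'a \<Rightarrow> 'b) \<Rightarrow> bool" where
  "chain_iso R X Y f \<longleftrightarrow> chain_complex R X \<and> chain_complex R Y \<and> chain_map R X Y f \<and>
     (\<forall>i. bij_betw (f i) (carrier (grade X i)) (carrier (grade Y i)))"

definition chain_isomorphic ::
  "('r, 'x) ring_scheme \<Rightarrow> ('r, 'a) cpx \<Rightarrow> ('r, 'b) cpx \<Rightarrow> bool" where
  "chain_isomorphic R X Y \<longleftrightarrow> (\<exists>f. chain_iso R X Y f)"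

definition homotopic ::
  "('r, 'x) ring_scheme \<Rightarrow> ('r, 'a) cpx \<Rightarrow> ('r, 'b) cpx \<Rightarrow>
   (int \<Rightarrow> 'a \<Rightarrow> 'b) \<Rightarrow> (int \<Rightarrow> 'a \<Rightarrow> 'b) \<Rightarrow> bool" where
  "homotopic R X Y f g \<longleftrightarrow>
     (\<exists>h. (\<forall>i. lin_map R (grade X i) (grade Y (i + 1)) (h i)) \<and>
        (\<forall>i. \<forall>x \<in> carrier (grade X i).
           f i x = g i x \<oplus>\<^bsub>grade Y i\<^esub>
             (bdry Y (i + 1) (h i x) \<oplus>\<^bsub>grade Y i\<^esub> h (i - 1) (bdry X i x))))"

definition cycles :: "('r, 'a) cpx \<Rightarrow> int \<Rightarrow> 'a set" where
  "cycles X i = {x \<in> carrier (grade X i). bdry X i x = \<zero>\<^bsub>grade X (i - 1)\<^esub>}"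

definition boundaries :: "('r, 'a) cpx \<Rightarrow> int \<Rightarrow> 'a set" where
  "boundaries X i = bdry X (i + 1) ` carrier (grade X (i + 1))"

definition homology :: "('r, 'a) cpx \<Rightarrow> int \<Rightarrow> ('r, 'a set) module" where
  "homology X i = quot_module ((grade X i)\<lparr>carrier := cycles X i\<rparr>) (boundaries X i)"

definition homology_map ::
  "('r, 'b) cpx \<Rightarrow> (int \<Rightarrow> 'a \<Rightarrow> 'b) \<Rightarrow> int \<Rightarrow> 'a set \<Rightarrow> 'b set" where
  "homology_map Y f i C = (\<Union>z\<in>C. boundaries Y i +>\<^bsub>grade Y i\<^esub> f i z)"

definition quasi_iso ::
  "('r, 'x) ring_scheme \<Rightarrow> ('r, 'a) cpx \<Rightarrow> ('r, 'b) cpx \<Rightarrow> (int \<Rightarrow> 'a \<Rightarrow> 'b) \<Rightarrow> bool" where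
  "quasi_iso R X Y f \<longleftrightarrow> chain_complex R X \<and> chain_complex R Y \<and> chain_map R X Y f \<and>
     (\<forall>i. bij_betw (homology_map Y f i) (carrier (homology X i)) (carrier (homology Y i)))"

definition shift :: "('r, 'a) cpx \<Rightarrow> ('r, 'a) cpx" where
  "shift X = \<lparr>grade = (\<lambda>i. grade X (i - 1)),
              bdry = (\<lambda>i x. \<ominus>\<^bsub>grade X (i - 1 - 1)\<^esub> bdry X (i - 1) x)\<rparr>"

definition dsum :: "('r, 'a) cpx \<Rightarrow> ('r, 'b) cpx \<Rightarrow> ('r, 'a \<times> 'b) cpx" where
  "dsum X Y = \<lparr>grade = (\<lambda>i. dsum_module (grade X i) (grade Y i)),
               bdry = (\<lambda>i (x, y). (bdry X i x, bdry Y i y))\<rparr>"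

definition cone :: "('r, 'a) cpx \<Rightarrow> ('r, 'b) cpx \<Rightarrow> (int \<Rightarrow> 'a \<Rightarrow> 'b) \<Rightarrow> ('r, 'a \<times> 'b) cpx" where
  "cone X Y f =
     \<lparr>grade = (\<lambda>i. dsum_module (grade X (i - 1)) (grade Y i)),
      bdry = (\<lambda>i (x, y). (\<ominus>\<^bsub>grade X (i - 1 - 1)\<^esub> bdry X (i - 1) x,
                          f (i - 1) x \<oplus>\<^bsub>grade Y (i - 1)\<^esub> bdry Y i y))\<rparr>"

text \<open>
  For \<open>js = [j\<^sub>0, \<dots>, j\<^sub>p]\<close> the complex \<open>\<Sigma>\<^bsup>j\<^sub>0\<^esup> R \<oplus> \<dots> \<oplus> \<Sigma>\<^bsup>j\<^sub>p\<^esup> R\<close>, where \<open>\<Sigma>\<^sup>j R\<close> is \<open>R\<close> placed in degree \<open>j\<close>: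
  in degree \<open>i\<close> it is free on the positions \<open>k\<close> with \<open>j\<^sub>k = i\<close>, and its differential is zero.
\<close>

definition sum_of_shifts :: "('r, 'x) ring_scheme \<Rightarrow> int list \<Rightarrow> ('r, nat \<Rightarrow> 'r) cpx" where
  "sum_of_shifts R js =
     \<lparr>grade = (\<lambda>i. free_module R {k. k < length js \<and> js ! k = i}), bdry = (\<lambda>_ _ _. \<zero>\<^bsub>R\<^esub>)\<rparr>"

text \<open>
  The Koszul complex on \<open>x\<^sub>0, \<dots>, x\<^sub>n\<^sub>-\<^sub>1\<close>: degree \<open>i\<close> is free on the \<open>i\<close>-element subsets of \<open>{0, \<dots>, n-1}\<close>
  (the set \<open>S\<close> stands for the exterior product of its members in increasing order), and
  \<open>\<partial> e\<^sub>S = \<Sum>s\<in>S. (-1)\<^bsup>|{t \<in> S. t < s}|\<^esup> x\<^sub>s e\<^bsub>S-{s}\<^esub>\<close>. Below, this is written out in coordinates: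
  the coefficient of \<open>\<partial> c\<close> at \<open>T\<close> collects the contributions of all \<open>S = insert s T\<close> with \<open>s \<notin> T\<close>.
\<close>

definition koszul :: "('r, 'x) ring_scheme \<Rightarrow> 'r list \<Rightarrow> ('r, nat set \<Rightarrow> 'r) cpx" where
  "koszul R xs =
     \<lparr>grade = (\<lambda>i. free_module R {S. S \<subseteq> {..<length xs} \<and> int (card S) = i}),
      bdry = (\<lambda>_ c T. \<Oplus>\<^bsub>R\<^esub>s\<in>{..<length xs} - T.
         (if even (card {t \<in> T. t < s}) then xs ! s else \<ominus>\<^bsub>R\<^esub> (xs ! s)) \<otimes>\<^bsub>R\<^esub> c (insert s T))\<rparr>"

section \<open>The derived category\<close>

text \<open>
  The objects of \<open>D(R)\<close> are the complexes of \<open>R\<close>-modules whose elements are taken from a type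
  \<open>'u\<close>, which plays the role of a universe. A morphism \<open>X \<rightarrow> Y\<close> is represented by a roof
  \<open>X \<leftarrow> Z \<rightarrow> Y\<close> whose backward leg is a quasi-isomorphism. All notions below are relations on
  roofs that respect equality of the represented morphisms. Constructions that live in another type
  (direct sums, cones, finite sums of shifts of \<open>R\<close>) enter \<open>D(R)\<close> through isomorphic copies over \<open>'u\<close>.
\<close>

record ('r, 'u) roof =
  apex :: "('r, 'u) cpx"
  bleg :: "int \<Rightarrow> 'u \<Rightarrow> 'u"
  fleg :: "int \<Rightarrow> 'u \<Rightarrow> 'u"

definition D_hom ::
  "('r, 'x) ring_scheme \<Rightarrow> ('r, 'u) cpx \<Rightarrow> ('r, 'u) cpx \<Rightarrow> ('r, 'u) roof \<Rightarrow> bool" where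
  "D_hom R X Y \<rho> \<longleftrightarrow> chain_complex R X \<and> chain_complex R Y \<and>
     quasi_iso R (apex \<rho>) X (bleg \<rho>) \<and> chain_map R (apex \<rho>) Y (fleg \<rho>)"

text \<open>Two roofs represent the same morphism if they agree, up to homotopy, on a common refinement.\<close>

definition D_eq ::
  "('r, 'x) ring_scheme \<Rightarrow> ('r, 'u) cpx \<Rightarrow> ('r, 'u) cpx \<Rightarrow>
   ('r, 'u) roof \<Rightarrow> ('r, 'u) roof \<Rightarrow> bool" where
  "D_eq R X Y \<rho> \<sigma> \<longleftrightarrow> D_hom R X Y \<rho> \<and> D_hom R X Y \<sigma> \<and>
     (\<exists>(W :: ('r, 'u) cpx) p q. quasi_iso R W (apex \<rho>) p \<and> quasi_iso R W (apex \<sigma>) q \<and>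
        homotopic R W X (\<lambda>i. bleg \<rho> i \<circ> p i) (\<lambda>i. bleg \<sigma> i \<circ> q i) \<and>
        homotopic R W Y (\<lambda>i. fleg \<rho> i \<circ> p i) (\<lambda>i. fleg \<sigma> i \<circ> q i))"

text \<open>\<open>D_comp R X Y Z \<rho> \<sigma> \<tau>\<close>: the composite of \<open>\<rho> : X \<rightarrow> Y\<close> followed by \<open>\<sigma> : Y \<rightarrow> Z\<close> is \<open>\<tau>\<close>.\<close>

definition D_comp ::
  "('r, 'x) ring_scheme \<Rightarrow> ('r, 'u) cpx \<Rightarrow> ('r, 'u) cpx \<Rightarrow> ('r, 'u) cpx \<Rightarrow>
   ('r, 'u) roof \<Rightarrow> ('r, 'u) roof \<Rightarrow> ('r, 'u) roof \<Rightarrow> bool" where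
  "D_comp R X Y Z \<rho> \<sigma> \<tau> \<longleftrightarrow> D_hom R X Y \<rho> \<and> D_hom R Y Z \<sigma> \<and>
     (\<exists>(W :: ('r, 'u) cpx) p q. quasi_iso R W (apex \<rho>) p \<and> chain_map R W (apex \<sigma>) q \<and>
        homotopic R W Y (\<lambda>i. fleg \<rho> i \<circ> p i) (\<lambda>i. bleg \<sigma> i \<circ> q i) \<and>
        D_eq R X Z
          \<lparr>apex = W, bleg = (\<lambda>i. bleg \<rho> i \<circ> p i), fleg = (\<lambda>i. fleg \<sigma> i \<circ> q i)\<rparr> \<tau>)"

definition D_of :: "('r, 'u) cpx \<Rightarrow> (int \<Rightarrow> 'u \<Rightarrow> 'u) \<Rightarrow> ('r, 'u) roof" where
  "D_of X f = \<lparr>apex = X, bleg = (\<lambda>_ x. x), fleg = f\<rparr>"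

definition D_id :: "('r, 'u) cpx \<Rightarrow> ('r, 'u) roof" where
  "D_id X = D_of X (\<lambda>_ x. x)"

definition D_shift :: "('r, 'u) roof \<Rightarrow> ('r, 'u) roof" where
  "D_shift \<rho> = \<lparr>apex = shift (apex \<rho>), bleg = (\<lambda>i. bleg \<rho> (i - 1)),
               fleg = (\<lambda>i. fleg \<rho> (i - 1))\<rparr>"

definition D_iso ::
  "('r, 'x) ring_scheme \<Rightarrow> ('r, 'u) cpx \<Rightarrow> ('r, 'u) cpx \<Rightarrow> ('r, 'u) roof \<Rightarrow> bool" where
  "D_iso R X Y \<rho> \<longleftrightarrow>
     (\<exists>\<sigma>. D_comp R X Y X \<rho> \<sigma> (D_id X) \<and> D_comp R Y X Y \<sigma> \<rho> (D_id Y))"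

definition D_isomorphic ::
  "('r, 'x) ring_scheme \<Rightarrow> ('r, 'u) cpx \<Rightarrow> ('r, 'u) cpx \<Rightarrow> bool" where
  "D_isomorphic R X Y \<longleftrightarrow> (\<exists>\<rho>. D_iso R X Y \<rho>)"

definition D_square ::
  "('r, 'x) ring_scheme \<Rightarrow> ('r, 'u) cpx \<Rightarrow> ('r, 'u) cpx \<Rightarrow> ('r, 'u) cpx \<Rightarrow> ('r, 'u) cpx \<Rightarrow>
   ('r, 'u) roof \<Rightarrow> ('r, 'u) roof \<Rightarrow> ('r, 'u) roof \<Rightarrow> ('r, 'u) roof \<Rightarrow> bool" where
  "D_square R X Y X' Y' \<alpha> a b \<alpha>' \<longleftrightarrow>
     (\<exists>\<tau>. D_comp R X Y Y' \<alpha> b \<tau> \<and> D_comp R X X' Y' a \<alpha>' \<tau>)"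
  \<comment> \<open>\<open>\<alpha> : X \<rightarrow> Y\<close>, \<open>\<alpha>' : X' \<rightarrow> Y'\<close>, \<open>a : X \<rightarrow> X'\<close>, \<open>b : Y \<rightarrow> Y'\<close> and \<open>b \<circ> \<alpha> = \<alpha>' \<circ> a\<close>\<close>

text \<open>
  \<open>X \<rightarrow> Y \<rightarrow> C \<rightarrow> \<Sigma>X\<close> with maps \<open>f\<close>, \<open>g\<close>, \<open>h\<close> is a copy (via \<open>\<theta>\<close>) of the mapping cone triangle
  with \<open>y \<mapsto> (0, y)\<close> and \<open>(x, y) \<mapsto> x\<close>.
\<close>

definition cone_triangle ::
  "('r, 'x) ring_scheme \<Rightarrow> ('r, 'u) cpx \<Rightarrow> ('r, 'u) cpx \<Rightarrow> ('r, 'u) cpx \<Rightarrow>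
   (int \<Rightarrow> 'u \<Rightarrow> 'u) \<Rightarrow> (int \<Rightarrow> 'u \<Rightarrow> 'u) \<Rightarrow> (int \<Rightarrow> 'u \<Rightarrow> 'u) \<Rightarrow> bool" where
  "cone_triangle R X Y C f g h \<longleftrightarrow>
     chain_complex R X \<and> chain_complex R Y \<and>
     chain_map R X Y f \<and> chain_map R Y C g \<and> chain_map R C (shift X) h \<and>
     (\<exists>\<theta>. chain_iso R C (cone X Y f) \<theta> \<and>
        (\<forall>i. \<forall>y \<in> carrier (grade Y i). \<theta> i (g i y) = (\<zero>\<^bsub>grade X (i - 1)\<^esub>, y)) \<and>
        (\<forall>i. \<forall>z \<in> carrier (grade C i). h i z = fst (\<theta> i z)))"

definition exact_triangle ::
  "('r, 'x) ring_scheme \<Rightarrow> ('r, 'u) cpx \<Rightarrow> ('r, 'u) cpx \<Rightarrow> ('r, 'u) cpx \<Rightarrow>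
   ('r, 'u) roof \<Rightarrow> ('r, 'u) roof \<Rightarrow> ('r, 'u) roof \<Rightarrow> bool" where
  "exact_triangle R K E N \<alpha> \<beta> \<gamma> \<longleftrightarrow>
     (\<exists>X Y C f g h a b c. cone_triangle R X Y C f g h \<and>
        D_iso R K X a \<and> D_iso R E Y b \<and> D_iso R N C c \<and>
        D_square R K E X Y \<alpha> a b (D_of X f) \<and>
        D_square R E N Y C \<beta> b c (D_of Y g) \<and>
        D_square R N (shift K) C (shift X) \<gamma> c (D_shift a) (D_of C h))"

section \<open>Level\<close>

fun thick :: "('r, 'x) ring_scheme \<Rightarrow> nat \<Rightarrow> ('r, 'u) cpx \<Rightarrow> bool" where
  "thick R 0 M \<longleftrightarrow> chain_complex R M \<and> (\<forall>i. carrier (homology M i) = {\<zero>\<^bsub>homology M i\<^esub>})"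
| "thick R (Suc 0) M \<longleftrightarrow>
     (\<exists>(M' :: ('r, 'u) cpx) (E :: ('r, 'u) cpx) (F :: ('r, 'u) cpx) js.
        chain_complex R M \<and> chain_complex R M' \<and>
        chain_isomorphic R E (dsum M M') \<and> chain_isomorphic R F (sum_of_shifts R js) \<and>
        D_isomorphic R E F)"
| "thick R (Suc (Suc n)) M \<longleftrightarrow>
     (\<exists>(K :: ('r, 'u) cpx) (L :: ('r, 'u) cpx) (E :: ('r, 'u) cpx) (N :: ('r, 'u) cpx) \<alpha> \<beta> \<gamma>.
        chain_complex R L \<and> chain_complex R M \<and> chain_isomorphic R E (dsum L M) \<and>
        thick R (Suc 0) K \<and> thick R (Suc n) N \<and> exact_triangle R K E N \<alpha> \<beta> \<gamma>)"

text \<open>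
  The level of (a copy over \<open>'u\<close> of) \<open>A\<close> in the derived category with universe \<open>'u\<close>. It is \<open>\<infinity>\<close> (the infimum of the
  empty set) if there is no suitable \<open>n\<close>. Enlarging \<open>'u\<close> can only decrease it, so a lower bound valid
  for every \<open>'u\<close> is a bound for the level in \<open>D(R)\<close> without size restriction.
\<close>

definition level :: "'u itself \<Rightarrow> ('r, 'x) ring_scheme \<Rightarrow> ('r, 'a) cpx \<Rightarrow> enat" where
  "level U R A =
     Inf {enat n | n. \<exists>M :: ('r, 'u) cpx. chain_isomorphic R A M \<and> thick R n M}"

section \<open>Differential graded algebras\<close>

text \<open>\<open>dgmult A i j\<close> is the product \<open>A\<^sub>i \<times> A\<^sub>j \<rightarrow> A\<^bsub>i+j\<^esub>\<close>.\<close>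

record ('r, 'a) dga =
  underlying :: "('r, 'a) cpx"
  dgmult :: "int \<Rightarrow> int \<Rightarrow> 'a \<Rightarrow> 'a \<Rightarrow> 'a"
  dgone :: 'a

definition dg_algebra :: "('r, 'x) ring_scheme \<Rightarrow> ('r, 'a) dga \<Rightarrow> bool" where
  "dg_algebra R A \<longleftrightarrow>
    (let G = grade (underlying A); d = bdry (underlying A); \<mu> = dgmult A; u = dgone A in
      chain_complex R (underlying A) \<and>
      (\<forall>i < 0. carrier (G i) = {\<zero>\<^bsub>G i\<^esub>}) \<and>
      (\<forall>i j. \<forall>a \<in> carrier (G i). lin_map R (G j) (G (i + j)) (\<lambda>b. \<mu> i j a b)) \<and>
      (\<forall>i j. \<forall>b \<in> carrier (G j). lin_map R (G i) (G (i + j)) (\<lambda>a. \<mu> i j a b)) \<and>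
      (\<forall>i j k. \<forall>a \<in> carrier (G i). \<forall>b \<in> carrier (G j). \<forall>c \<in> carrier (G k).
         \<mu> (i + j) k (\<mu> i j a b) c = \<mu> i (j + k) a (\<mu> j k b c)) \<and>
      u \<in> carrier (G 0) \<and>
      (\<forall>i. \<forall>a \<in> carrier (G i). \<mu> 0 i u a = a \<and> \<mu> i 0 a u = a) \<and>
      (\<forall>i j. \<forall>a \<in> carrier (G i). \<forall>b \<in> carrier (G j).
         d (i + j) (\<mu> i j a b) =
           \<mu> (i - 1) j (d i a) b \<oplus>\<^bsub>G (i + j - 1)\<^esub>
           alt_sign (G (i + j - 1)) i (\<mu> i (j - 1) a (d j b))) \<and>
      (\<forall>i j. \<forall>a \<in> carrier (G i). \<forall>b \<in> carrier (G j).
         \<mu> i j a b = alt_sign (G (i + j)) (i * j) (\<mu> j i b a)) \<and>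
      (\<forall>i. odd i \<longrightarrow> (\<forall>a \<in> carrier (G i). \<mu> i i a a = \<zero>\<^bsub>G (i + i)\<^esub>)))"

text \<open>
  \<open>H\<^sub>0(A)\<close> as an \<open>R\<close>-algebra. Since \<open>A\<^sub>-\<^sub>1 = 0\<close>, all of \<open>A\<^sub>0\<close> consists of cycles.
\<close>

definition H0_algebra :: "('r, 'a) dga \<Rightarrow> ('r, 'a set) module" where
  "H0_algebra A =
     (let X = underlying A; B = boundaries X 0 in
       (homology X 0)
         \<lparr>monoid.mult := (\<lambda>C D. \<Union>a\<in>C. \<Union>b\<in>D. B +>\<^bsub>grade X 0\<^esub> dgmult A 0 0 a b),
          one := B +>\<^bsub>grade X 0\<^esub> dgone A\<rparr>)"

definition H0_is_quotient :: "('r, 'x) ring_scheme \<Rightarrow> ('r, 'a) dga \<Rightarrow> 'r set \<Rightarrow> bool" where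
  "H0_is_quotient R A I \<longleftrightarrow>
     (\<exists>\<phi> \<in> ring_iso (H0_algebra A) (R Quot I).
        \<forall>r \<in> carrier R. \<forall>c \<in> carrier (H0_algebra A).
          \<phi> (r \<odot>\<^bsub>H0_algebra A\<^esub> c) = (I +>\<^bsub>R\<^esub> r) \<otimes>\<^bsub>R Quot I\<^esub> \<phi> c)"

definition minimal_cpx :: "('r, 'x) ring_scheme \<Rightarrow> 'r set \<Rightarrow> ('r, 'a) cpx \<Rightarrow> bool" where
  "minimal_cpx R \<mm> X \<longleftrightarrow>
     (\<forall>i. bdry X i ` carrier (grade X i) \<subseteq> ideal_smult R \<mm> (grade X (i - 1)))"

definition noetherian_local_ring :: "('r, 'x) ring_scheme \<Rightarrow> 'r set \<Rightarrow> bool" where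
  "noetherian_local_ring R \<mm> \<longleftrightarrow> cring R \<and> noetherian_ring R \<and> maximalideal \<mm> R \<and>
     (\<forall>J. maximalideal J R \<longrightarrow> J = \<mm>)"

end

theory Submission
  imports Defs
begin

text \<open>
  The coordinates of a free summand of rank \<open>n\<close> of \<open>I/I\<^sup>2\<close> are \<open>n\<close> linear maps \<open>\<phi>\<^sub>k : I \<rightarrow> R/I\<close>, with
  \<open>y\<^sub>1, \<dots>, y\<^sub>n \<in> I\<close> such that \<open>\<phi>\<^sub>k y\<^sub>j\<close> is \<open>1\<close> if \<open>j = k\<close> and \<open>0\<close> otherwise. On complexes \<open>Q\<close> of flat modules each
  \<open>\<phi>\<^sub>k\<close> induces a natural map \<open>\<chi>\<^sub>k : H\<^sub>i(Q/IQ) \<rightarrow> H\<^bsub>i-1\<^esub>(Q/IQ)\<close>, \<open>z \<mapsto> (\<phi>\<^sub>k \<otimes> Q)(\<partial>z)\<close>, which vanishes if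
  \<open>Q\<close> has zero differential. Along the lines of the ghost lemma one proves by induction on \<open>m\<close>: if \<open>M\<close> has level
  at most \<open>m\<close>, then for every map \<open>Q \<rightarrow> M\<close> from a bounded below complex of projectives, an \<open>m\<close>-fold
  composite of maps \<open>\<chi>\<close> on \<open>H(Q/IQ)\<close> is killed by some factorization \<open>Q \<rightarrow> Q' \<rightarrow> M\<close> up to homotopy.
  The only morphisms of \<open>D(R)\<close> that occur then start in complexes of projectives, so they are
  represented by honest chain maps.

  If \<open>I\<close> acts on \<open>A\<close> by null-homotopic maps, then a cycle \<open>u \<in> A\<^sub>0\<close> extends to a chain map from the Koszul
  complex on \<open>y\<^sub>1, \<dots>, y\<^sub>n\<close> to \<open>A\<close>. Here \<open>\<chi>\<^sub>1 \<cdots> \<chi>\<^sub>n\<close> maps \<open>e\<^sub>1 \<and> \<dots> \<and> e\<^sub>n\<close> to \<open>\<plusminus>1\<close>, which is sent to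
  \<open>\<plusminus>u\<close>. If \<open>u \<notin> \<partial>A\<^sub>1 + I A\<^sub>0\<close>, this class is not killed, and so the level of \<open>A\<close> exceeds \<open>n\<close>. Both hypotheses
  hold for the unit of a dg-algebra with \<open>H\<^sub>0(A) = R/I\<close> and for the Koszul complex.
\<close>

section \<open>Linear maps, chain maps and homotopies\<close>

text \<open>The origin of \<open>\<chi>\<^sub>k\<close>: as Ext^1_R(R/I, R/I) is Hom(I, R/I), each
  \<open>\<phi>\<^sub>k\<close> is a morphism from R/I to its suspension in D(R), and so acts with
  degree -1, naturally in M, on the homology of the derived tensor product of R/I and M. On a shift
  of R it vanishes because R/I sits in a single degree; this is the ghost property that each layer
  of the thick filtration can absorb once. The obstacle is the universe \<open>'u\<close>. It is
  arbitrary, so M need not have a projective resolution over \<open>'u\<close>, and the derived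
  tensor product may not be available there. Hence M is probed from outside, by maps from complexes
  over the fixed type \<open>nat \<Rightarrow> 'r\<close>. Passing to a factor Q' of a map Q
  \<rightarrow> M stands in for vanishing in the colimit of the groups H(Q'/IQ') over all Q'
  \<rightarrow> M. Tensor products are not formed either. The graph of \<open>\<phi>\<^sub>k\<close>
  is a submodule of R \<times> R, and tensoring with Q becomes a linear relation on the elements of
  Q, single valued modulo IQ if Q is flat. Naturality is then the remark that linear maps preserve
  such relations.\<close>

context abelian_group
begin

text \<open>
  Sorting with \<open>a_ac\<close> leaves opposite summands apart; these rules cancel them
  across up to three others.
\<close>

lemma cancel_apart:
  assumes "x \<in> carrier G" "u \<in> carrier G"
  shows "x \<oplus> (u \<oplus> \<ominus> x) = u" "\<ominus> x \<oplus> (u \<oplus> x) = u"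
    "y \<in> carrier G \<Longrightarrow> x \<oplus> (u \<oplus> (\<ominus> x \<oplus> y)) = u \<oplus> y"
    "y \<in> carrier G \<Longrightarrow> \<ominus> x \<oplus> (u \<oplus> (x \<oplus> y)) = u \<oplus> y"
    "v \<in> carrier G \<Longrightarrow> x \<oplus> (u \<oplus> (v \<oplus> \<ominus> x)) = u \<oplus> v"
    "v \<in> carrier G \<Longrightarrow> \<ominus> x \<oplus> (u \<oplus> (v \<oplus> x)) = u \<oplus> v"
    "v \<in> carrier G \<Longrightarrow> y \<in> carrier G \<Longrightarrow> x \<oplus> (u \<oplus> (v \<oplus> (\<ominus> x \<oplus> y))) = u \<oplus> (v \<oplus> y)"
    "v \<in> carrier G \<Longrightarrow> y \<in> carrier G \<Longrightarrow> \<ominus> x \<oplus> (u \<oplus> (v \<oplus> (x \<oplus> y))) = u \<oplus> (v \<oplus> y)"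
    "v \<in> carrier G \<Longrightarrow> w \<in> carrier G \<Longrightarrow> x \<oplus> (u \<oplus> (v \<oplus> (w \<oplus> \<ominus> x))) = u \<oplus> (v \<oplus> w)"
    "v \<in> carrier G \<Longrightarrow> w \<in> carrier G \<Longrightarrow> \<ominus> x \<oplus> (u \<oplus> (v \<oplus> (w \<oplus> x))) = u \<oplus> (v \<oplus> w)"
  using assms
  by (simp_all add: a_lcomm[of x] a_lcomm[of "\<ominus> x"] a_comm[of x] a_comm[of "\<ominus> x"] r_neg l_neg r_neg1
      r_neg2)
    (simp_all add: a_assoc r_neg l_neg)

lemmas group_simps = a_minus_def minus_add a_ac r_neg l_neg r_neg1 r_neg2 cancel_apart

end

section \<open>Linear maps of modules\<close>

lemma lin_closed: "lin_map R M N f \<Longrightarrow> x \<in> carrier M \<Longrightarrow> f x \<in> carrier N"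
  by (auto simp: lin_map_def)

lemma lin_add:
  "lin_map R M N f \<Longrightarrow> x \<in> carrier M \<Longrightarrow> y \<in> carrier M \<Longrightarrow> f (x \<oplus>\<^bsub>M\<^esub> y) = f x \<oplus>\<^bsub>N\<^esub> f y"
  by (auto simp: lin_map_def)

lemma lin_smult:
  "lin_map R M N f \<Longrightarrow> r \<in> carrier R \<Longrightarrow> x \<in> carrier M \<Longrightarrow> f (r \<odot>\<^bsub>M\<^esub> x) = r \<odot>\<^bsub>N\<^esub> f x"
  by (auto simp: lin_map_def)

lemma lin_mapI:
  assumes "\<And>x. x \<in> carrier M \<Longrightarrow> f x \<in> carrier N"
    and "\<And>x y. x \<in> carrier M \<Longrightarrow> y \<in> carrier M \<Longrightarrow> f (x \<oplus>\<^bsub>M\<^esub> y) = f x \<oplus>\<^bsub>N\<^esub> f y"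
    and "\<And>r x. r \<in> carrier R \<Longrightarrow> x \<in> carrier M \<Longrightarrow> f (r \<odot>\<^bsub>M\<^esub> x) = r \<odot>\<^bsub>N\<^esub> f x"
  shows "lin_map R M N f"
  using assms by (auto simp: lin_map_def)

lemma lin_zero:
  assumes "module R M" "module R N" "lin_map R M N f"
  shows "f \<zero>\<^bsub>M\<^esub> = \<zero>\<^bsub>N\<^esub>"
proof -
  interpret M: module R M by fact
  interpret N: module R N by fact
  have "f (\<zero>\<^bsub>R\<^esub> \<odot>\<^bsub>M\<^esub> \<zero>\<^bsub>M\<^esub>) = \<zero>\<^bsub>R\<^esub> \<odot>\<^bsub>N\<^esub> f \<zero>\<^bsub>M\<^esub>"
    by (rule lin_smult[OF assms(3)]) auto
  then show ?thesis using lin_closed[OF assms(3), of "\<zero>\<^bsub>M\<^esub>"] by simp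
qed

lemma lin_neg:
  assumes "module R M" "module R N" "lin_map R M N f" "x \<in> carrier M"
  shows "f (\<ominus>\<^bsub>M\<^esub> x) = \<ominus>\<^bsub>N\<^esub> f x"
proof -
  interpret M: module R M by fact
  interpret N: module R N by fact
  have "f (\<ominus>\<^bsub>M\<^esub> x) \<oplus>\<^bsub>N\<^esub> f x = \<zero>\<^bsub>N\<^esub>"
    using lin_add[OF assms(3), of "\<ominus>\<^bsub>M\<^esub> x" x] lin_zero[OF assms(1-3)] assms(4)
    by (simp add: M.l_neg)
  then show ?thesis
    using N.minus_equality lin_closed[OF assms(3)] assms(4) by (metis M.a_inv_closed)
qed

lemma lin_minus:
  assumes "module R M" "module R N" "lin_map R M N f" "x \<in> carrier M" "y \<in> carrier M"
  shows "f (x \<ominus>\<^bsub>M\<^esub> y) = f x \<ominus>\<^bsub>N\<^esub> f y"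
proof -
  interpret M: module R M by fact
  interpret N: module R N by fact
  show ?thesis using assms by (simp add: a_minus_def lin_add lin_neg[OF assms(1-3)])
qed

lemma lin_comp: "lin_map R M N f \<Longrightarrow> lin_map R N P g \<Longrightarrow> lin_map R M P (g \<circ> f)"
  by (auto simp: lin_map_def Pi_iff)

lemma lin_id: "lin_map R M M (\<lambda>x. x)"
  by (auto simp: lin_map_def)

lemma lin_const_zero:
  assumes "module R N" shows "lin_map R M N (\<lambda>_. \<zero>\<^bsub>N\<^esub>)"
proof -
  interpret module R N by fact
  show ?thesis by (auto simp: lin_map_def)
qed

lemma lin_plus:
  assumes "module R N" "lin_map R M N f" "lin_map R M N g"
  shows "lin_map R M N (\<lambda>x. f x \<oplus>\<^bsub>N\<^esub> g x)"
proof -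
  interpret N: module R N by fact
  note c = lin_closed[OF assms(2)] lin_closed[OF assms(3)]
  show ?thesis
    by (rule lin_mapI)
      (auto simp: c lin_add[OF assms(2)] lin_add[OF assms(3)] lin_smult[OF assms(2)]
        lin_smult[OF assms(3)] N.smult_r_distr N.a_ac)
qed

lemma lin_uminus:
  assumes "module R N" "lin_map R M N f"
  shows "lin_map R M N (\<lambda>x. \<ominus>\<^bsub>N\<^esub> f x)"
proof -
  interpret N: module R N by fact
  note c = lin_closed[OF assms(2)]
  show ?thesis
    by (rule lin_mapI)
      (auto simp: c lin_add[OF assms(2)] lin_smult[OF assms(2)] N.smult_r_minus N.minus_add)
qed

lemma lin_scale:
  assumes "module R N" "lin_map R M N f" "a \<in> carrier R"
  shows "lin_map R M N (\<lambda>x. a \<odot>\<^bsub>N\<^esub> f x)"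
proof -
  interpret N: module R N by fact
  note c = lin_closed[OF assms(2)]
  have "r \<in> carrier R \<Longrightarrow> y \<in> carrier N \<Longrightarrow> a \<odot>\<^bsub>N\<^esub> (r \<odot>\<^bsub>N\<^esub> y) = r \<odot>\<^bsub>N\<^esub> (a \<odot>\<^bsub>N\<^esub> y)" for r y
    using assms(3) by (simp add: N.smult_assoc1[symmetric] N.R.m_comm)
  then show ?thesis
    by (intro lin_mapI)
      (auto simp: c lin_add[OF assms(2)] lin_smult[OF assms(2)] N.smult_r_distr assms(3))
qed

section \<open>Complexes and chain maps\<close>

lemma cpx_module: "chain_complex R X \<Longrightarrow> module R (grade X i)"
  by (auto simp: chain_complex_def)

lemma cpx_lin: "chain_complex R X \<Longrightarrow> lin_map R (grade X i) (grade X (i - 1)) (bdry X i)"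
  by (auto simp: chain_complex_def)

lemma cpx_lin1: "chain_complex R X \<Longrightarrow> lin_map R (grade X (i + 1)) (grade X i) (bdry X (i + 1))"
  using cpx_lin[of R X "i + 1"] by simp

lemma cpx_sq:
  "chain_complex R X \<Longrightarrow> x \<in> carrier (grade X i) \<Longrightarrow>
    bdry X (i - 1) (bdry X i x) = \<zero>\<^bsub>grade X (i - 1 - 1)\<^esub>"
  unfolding chain_complex_def by blast

lemma cpx_sq1:
  "chain_complex R X \<Longrightarrow> x \<in> carrier (grade X (i + 1)) \<Longrightarrow>
    bdry X i (bdry X (i + 1) x) = \<zero>\<^bsub>grade X (i - 1)\<^esub>"
  using cpx_sq[of R X x "i + 1"] by simp

lemma cmap_lin: "chain_map R X Y f \<Longrightarrow> lin_map R (grade X i) (grade Y i) (f i)"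
  by (auto simp: chain_map_def)

lemma cmap_bdry:
  "chain_map R X Y f \<Longrightarrow> x \<in> carrier (grade X i) \<Longrightarrow> f (i - 1) (bdry X i x) = bdry Y i (f i x)"
  unfolding chain_map_def by blast

lemma cmap_bdry1:
  "chain_map R X Y f \<Longrightarrow> x \<in> carrier (grade X (i + 1)) \<Longrightarrow>
    f i (bdry X (i + 1) x) = bdry Y (i + 1) (f (i + 1) x)"
  using cmap_bdry[of R X Y f x "i + 1"] by simp

lemma cmap_comp:
  assumes "chain_map R X Y f" "chain_map R Y Z g"
  shows "chain_map R X Z (\<lambda>i. g i \<circ> f i)"
  unfolding chain_map_def
proof (intro conjI allI ballI)
  show "lin_map R (grade X i) (grade Z i) (g i \<circ> f i)" for i
    by (rule lin_comp[OF cmap_lin[OF assms(1)] cmap_lin[OF assms(2)]])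
  show "(g (i - 1) \<circ> f (i - 1)) (bdry X i x) = bdry Z i ((g i \<circ> f i) x)"
    if "x \<in> carrier (grade X i)" for i x
    using that cmap_bdry[OF assms(1) that] cmap_bdry[OF assms(2) lin_closed[OF cmap_lin[OF assms(1)]
        that]]
    by simp
qed

section \<open>Homotopies of chain maps\<close>

lemma homotopic_refl:
  assumes "chain_complex R Y" "\<And>i. lin_map R (grade X i) (grade Y i) (f i)"
    and "\<And>i x. x \<in> carrier (grade X i) \<Longrightarrow> f i x = g i x"
  shows "homotopic R X Y f g"
  unfolding homotopic_def
proof (intro exI conjI allI ballI)
  show "lin_map R (grade X i) (grade Y (i + 1)) (\<lambda>_. \<zero>\<^bsub>grade Y (i + 1)\<^esub>)" for i
    by (rule lin_const_zero[OF cpx_module[OF assms(1)]])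
  fix i x assume x: "x \<in> carrier (grade X i)"
  interpret Y: module R "grade Y i" by (rule cpx_module[OF assms(1)])
  have "bdry Y (i + 1) \<zero>\<^bsub>grade Y (i + 1)\<^esub> = \<zero>\<^bsub>grade Y i\<^esub>"
    by (rule lin_zero[OF cpx_module[OF assms(1)] cpx_module[OF assms(1)] cpx_lin1[OF assms(1)]])
  then show "f i x = g i x \<oplus>\<^bsub>grade Y i\<^esub> (bdry Y (i + 1) \<zero>\<^bsub>grade Y (i + 1)\<^esub> \<oplus>\<^bsub>grade Y i\<^esub>
      \<zero>\<^bsub>grade Y (i - 1 + 1)\<^esub>)"
    using lin_closed[OF assms(2) x] assms(3)[OF x] by simp
qed

text \<open>Exposes the witness that \<open>homotopic\<close> hides, because the cone arguments
  split homotopies into components.\<close>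

definition homotopy ::
  "('r, 'x) ring_scheme \<Rightarrow> ('r, 'a) cpx \<Rightarrow> ('r, 'b) cpx \<Rightarrow>
   (int \<Rightarrow> 'a \<Rightarrow> 'b) \<Rightarrow> (int \<Rightarrow> 'a \<Rightarrow> 'b) \<Rightarrow> (int \<Rightarrow> 'a \<Rightarrow> 'b) \<Rightarrow> bool" where
  "homotopy R X Y f g h \<longleftrightarrow>
     (\<forall>i. lin_map R (grade X i) (grade Y (i + 1)) (h i)) \<and>
     (\<forall>i. \<forall>x \<in> carrier (grade X i). f i x = g i x \<oplus>\<^bsub>grade Y i\<^esub>
        (bdry Y (i + 1) (h i x) \<oplus>\<^bsub>grade Y i\<^esub> h (i - 1) (bdry X i x)))"

lemma homotopicE: "homotopic R X Y f g \<Longrightarrow> (\<And>h. homotopy R X Y f g h \<Longrightarrow> thesis) \<Longrightarrow> thesis"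
  unfolding homotopic_def homotopy_def by blast

text \<open>The last fact is the third one in degree \<open>i - 1\<close> with
  \<open>i - 1 + 1\<close> normalized to \<open>i\<close>, the form in which a homotopy is applied
  to a boundary.\<close>

lemma homotopyD:
  assumes "homotopy R X Y f g h"
  shows "\<And>i. lin_map R (grade X i) (grade Y (i + 1)) (h i)"
    "\<And>i x. x \<in> carrier (grade X i) \<Longrightarrow> f i x = g i x \<oplus>\<^bsub>grade Y i\<^esub>
             (bdry Y (i + 1) (h i x) \<oplus>\<^bsub>grade Y i\<^esub> h (i - 1) (bdry X i x))"
    "\<And>i x. x \<in> carrier (grade X i) \<Longrightarrow> h i x \<in> carrier (grade Y (i + 1))"
    "\<And>i x. x \<in> carrier (grade X (i - 1)) \<Longrightarrow> h (i - 1) x \<in> carrier (grade Y i)"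
proof -
  show l: "lin_map R (grade X i) (grade Y (i + 1)) (h i)" for i
    using assms by (simp add: homotopy_def)
  show "\<And>i x. x \<in> carrier (grade X i) \<Longrightarrow> f i x = g i x \<oplus>\<^bsub>grade Y i\<^esub>
             (bdry Y (i + 1) (h i x) \<oplus>\<^bsub>grade Y i\<^esub> h (i - 1) (bdry X i x))"
    using assms unfolding homotopy_def by blast
  show "x \<in> carrier (grade X i) \<Longrightarrow> h i x \<in> carrier (grade Y (i + 1))" for i x
    by (rule lin_closed[OF l])
  from this[of _ "i - 1" for i]
  show "x \<in> carrier (grade X (i - 1)) \<Longrightarrow> h (i - 1) x \<in> carrier (grade Y i)" for i x
    by simp
qed

lemma homotopic_sym:
  assumes X: "chain_complex R X" and Y: "chain_complex R Y"
    and g: "\<And>i. lin_map R (grade X i) (grade Y i) (g i)"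
    and fg: "homotopic R X Y f g"
  shows "homotopic R X Y g f"
proof -
  from fg obtain h where "homotopy R X Y f g h" by (rule homotopicE)
  note h = homotopyD[OF this]
  show ?thesis unfolding homotopic_def
  proof (intro exI conjI allI ballI)
    show "lin_map R (grade X i) (grade Y (i + 1)) (\<lambda>x. \<ominus>\<^bsub>grade Y (i + 1)\<^esub> h i x)" for i
      by (rule lin_uminus[OF cpx_module[OF Y] h(1)])
    fix i x assume x: "x \<in> carrier (grade X i)"
    interpret Y: module R "grade Y i" by (rule cpx_module[OF Y])
    have b: "bdry X i x \<in> carrier (grade X (i - 1))" by (rule lin_closed[OF cpx_lin[OF X] x])
    have "bdry Y (i + 1) (\<ominus>\<^bsub>grade Y (i + 1)\<^esub> h i x) = \<ominus>\<^bsub>grade Y i\<^esub> bdry Y (i + 1) (h i x)"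
      by (rule lin_neg[OF cpx_module[OF Y] cpx_module[OF Y] cpx_lin1[OF Y] h(3)[OF x]])
    then show "g i x = f i x \<oplus>\<^bsub>grade Y i\<^esub> (bdry Y (i + 1) (\<ominus>\<^bsub>grade Y (i + 1)\<^esub> h i x)
        \<oplus>\<^bsub>grade Y i\<^esub> \<ominus>\<^bsub>grade Y (i - 1 + 1)\<^esub> h (i - 1) (bdry X i x))"
      using lin_closed[OF g x] lin_closed[OF cpx_lin1[OF Y] h(3)[OF x]] h(4)[OF b]
      by (simp add: h(2)[OF x] Y.group_simps)
  qed
qed

lemma homotopic_trans:
  assumes X: "chain_complex R X" and Y: "chain_complex R Y"
    and k: "\<And>i. lin_map R (grade X i) (grade Y i) (k i)"
    and fg: "homotopic R X Y f g" and gk: "homotopic R X Y g k"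
  shows "homotopic R X Y f k"
proof -
  from fg obtain h where "homotopy R X Y f g h" by (rule homotopicE)
  note h = homotopyD[OF this]
  from gk obtain h' where "homotopy R X Y g k h'" by (rule homotopicE)
  note h' = homotopyD[OF this]
  show ?thesis unfolding homotopic_def
  proof (intro exI conjI allI ballI)
    show "lin_map R (grade X i) (grade Y (i + 1)) (\<lambda>x. h i x \<oplus>\<^bsub>grade Y (i + 1)\<^esub> h' i x)" for i
      by (rule lin_plus[OF cpx_module[OF Y] h(1) h'(1)])
    fix i x assume x: "x \<in> carrier (grade X i)"
    interpret Y: module R "grade Y i" by (rule cpx_module[OF Y])
    have b: "bdry X i x \<in> carrier (grade X (i - 1))" by (rule lin_closed[OF cpx_lin[OF X] x])
    have "bdry Y (i + 1) (h i x \<oplus>\<^bsub>grade Y (i + 1)\<^esub> h' i x) =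
        bdry Y (i + 1) (h i x) \<oplus>\<^bsub>grade Y i\<^esub> bdry Y (i + 1) (h' i x)"
      by (rule lin_add[OF cpx_lin1[OF Y] h(3)[OF x] h'(3)[OF x]])
    then show "f i x = k i x \<oplus>\<^bsub>grade Y i\<^esub> (bdry Y (i + 1) (h i x \<oplus>\<^bsub>grade Y (i + 1)\<^esub> h' i x)
        \<oplus>\<^bsub>grade Y i\<^esub> (h (i - 1) (bdry X i x) \<oplus>\<^bsub>grade Y (i - 1 + 1)\<^esub> h' (i - 1) (bdry X i x)))"
      using lin_closed[OF k x] lin_closed[OF cpx_lin1[OF Y] h(3)[OF x]] h(4)[OF b]
        lin_closed[OF cpx_lin1[OF Y] h'(3)[OF x]] h'(4)[OF b]
      by (simp add: h(2)[OF x] h'(2)[OF x] Y.group_simps)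
  qed
qed

lemma homotopic_comp_left:
  assumes X: "chain_complex R X" and Y: "chain_complex R Y"
    and g: "\<And>i. lin_map R (grade X i) (grade Y i) (g i)"
    and k: "chain_map R Y Z k" and fg: "homotopic R X Y f g"
  shows "homotopic R X Z (\<lambda>i. k i \<circ> f i) (\<lambda>i. k i \<circ> g i)"
proof -
  from fg obtain h where "homotopy R X Y f g h" by (rule homotopicE)
  note h = homotopyD[OF this]
  show ?thesis unfolding homotopic_def
  proof (intro exI conjI allI ballI)
    show "lin_map R (grade X i) (grade Z (i + 1)) (k (i + 1) \<circ> h i)" for i
      by (rule lin_comp[OF h(1) cmap_lin[OF k]])
    fix i x assume x: "x \<in> carrier (grade X i)"
    interpret Y: module R "grade Y i" by (rule cpx_module[OF Y])
    have b: "bdry X i x \<in> carrier (grade X (i - 1))" by (rule lin_closed[OF cpx_lin[OF X] x])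
    show "(k i \<circ> f i) x = (k i \<circ> g i) x \<oplus>\<^bsub>grade Z i\<^esub> (bdry Z (i + 1) ((k (i + 1) \<circ> h i) x)
        \<oplus>\<^bsub>grade Z i\<^esub> (k (i - 1 + 1) \<circ> h (i - 1)) (bdry X i x))"
      using lin_closed[OF g x] lin_closed[OF cpx_lin1[OF Y] h(3)[OF x]] h(4)[OF b]
      by (simp add: h(2)[OF x] lin_add[OF cmap_lin[OF k]] cmap_bdry1[OF k h(3)[OF x]])
  qed
qed

lemma homotopic_comp_right:
  assumes p: "chain_map R W X p" and fg: "homotopic R X Y f g"
  shows "homotopic R W Y (\<lambda>i. f i \<circ> p i) (\<lambda>i. g i \<circ> p i)"
proof -
  from fg obtain h where "homotopy R X Y f g h" by (rule homotopicE)
  note h = homotopyD[OF this]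
  show ?thesis unfolding homotopic_def
  proof (intro exI conjI allI ballI)
    show "lin_map R (grade W i) (grade Y (i + 1)) (h i \<circ> p i)" for i
      by (rule lin_comp[OF cmap_lin[OF p] h(1)])
    fix i x assume x: "x \<in> carrier (grade W i)"
    show "(f i \<circ> p i) x = (g i \<circ> p i) x \<oplus>\<^bsub>grade Y i\<^esub> (bdry Y (i + 1) ((h i \<circ> p i) x)
        \<oplus>\<^bsub>grade Y i\<^esub> (h (i - 1) \<circ> p (i - 1)) (bdry W i x))"
      using h(2)[OF lin_closed[OF cmap_lin[OF p] x]] by (simp add: cmap_bdry[OF p x])
  qed
qed

section \<open>Suspension and homology\<close>

lemma cycles_iff: "x \<in> cycles X i \<longleftrightarrow> x \<in> carrier (grade X i) \<and> bdry X i x = \<zero>\<^bsub>grade X (i - 1)\<^esub>"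
  by (simp add: cycles_def)

lemma shift_simps [simp]:
  "grade (shift X) i = grade X (i - 1)"
  "bdry (shift X) i x = \<ominus>\<^bsub>grade X (i - 1 - 1)\<^esub> bdry X (i - 1) x"
  by (simp_all add: shift_def)

lemma (in abelian_group) neg_zero: "\<ominus> \<zero> = \<zero>"
  by (metis a_inv_closed l_zero r_neg zero_closed)

lemma shift_cpx:
  assumes X: "chain_complex R X" shows "chain_complex R (shift X)"
  unfolding chain_complex_def
proof (intro conjI allI ballI)
  show "module R (grade (shift X) i)" for i using cpx_module[OF X] by (simp add: shift_def)
  show "lin_map R (grade (shift X) i) (grade (shift X) (i - 1)) (bdry (shift X) i)" for i
    using lin_uminus[OF cpx_module[OF X] cpx_lin[OF X, of "i - 1"]] by (simp add: shift_def)
  fix i x assume "x \<in> carrier (grade (shift X) i)"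
  then have x: "x \<in> carrier (grade X (i - 1))" by (simp add: shift_def)
  interpret M: abelian_group "grade X (i - 1 - 1 - 1)" by (rule module.axioms(2)[OF cpx_module[OF
      X]])
  note b = lin_closed[OF cpx_lin[OF X] x]
  have "\<ominus>\<^bsub>grade X (i - 1 - 1 - 1)\<^esub> bdry X (i - 1 - 1) (\<ominus>\<^bsub>grade X (i - 1 - 1)\<^esub> bdry X (i - 1) x) =
      \<zero>\<^bsub>grade X (i - 1 - 1 - 1)\<^esub>"
    unfolding lin_neg[OF cpx_module[OF X] cpx_module[OF X] cpx_lin[OF X] b] cpx_sq[OF X x]
    by (simp only: M.neg_zero)
  then show "bdry (shift X) (i - 1) (bdry (shift X) i x) = \<zero>\<^bsub>grade (shift X) (i - 1 - 1)\<^esub>"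
    by (simp add: shift_def)
qed

lemma boundaries_additive_subgroup:
  assumes X: "chain_complex R X"
  shows "additive_subgroup (boundaries X i) (grade X i)"
proof -
  interpret M: module R "grade X i" by (rule cpx_module[OF X])
  interpret N: module R "grade X (i + 1)" by (rule cpx_module[OF X])
  note l = cpx_lin1[OF X, of i]
  have "submodule (boundaries X i) R (grade X i)"
  proof (rule M.submoduleI)
    show "boundaries X i \<subseteq> carrier (grade X i)"
      by (auto simp: boundaries_def intro: lin_closed[OF l])
    show "\<zero>\<^bsub>grade X i\<^esub> \<in> boundaries X i"
      unfolding boundaries_def
      using lin_zero[OF N.module_axioms M.module_axioms l] N.zero_closed by (metis imageI)
    show "\<ominus>\<^bsub>grade X i\<^esub> a \<in> boundaries X i" if a: "a \<in> boundaries X i" for a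
    proof -
      obtain y where "y \<in> carrier (grade X (i+1))" "a = bdry X (i+1) y"
        using a by (auto simp: boundaries_def)
      then show ?thesis unfolding boundaries_def
        using lin_neg[OF N.module_axioms M.module_axioms l] by (metis N.a_inv_closed imageI)
    qed
    show "a \<oplus>\<^bsub>grade X i\<^esub> b \<in> boundaries X i" if a: "a \<in> boundaries X i" and b: "b \<in> boundaries X i"
        for a b
    proof -
      obtain y z where "y \<in> carrier (grade X (i+1))" "a = bdry X (i+1) y"
          "z \<in> carrier (grade X (i+1))" "b = bdry X (i+1) z"
        using a b by (auto simp: boundaries_def)
      then show ?thesis unfolding boundaries_def
        using lin_add[OF l] by (metis N.a_closed imageI)
    qed
    show "r \<odot>\<^bsub>grade X i\<^esub> a \<in> boundaries X i" if r: "r \<in> carrier R" and a: "a \<in> boundaries X i" for r a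
    proof -
      obtain y where "y \<in> carrier (grade X (i+1))" "a = bdry X (i+1) y"
        using a by (auto simp: boundaries_def)
      then show ?thesis unfolding boundaries_def
        using lin_smult[OF l r] r by (metis N.smult_closed imageI)
    qed
  qed
  then show ?thesis
    by (simp add: additive_subgroup_def submodule_def)
qed

lemma mem_rcoset: "x \<in> B +>\<^bsub>M\<^esub> y \<longleftrightarrow> (\<exists>b\<in>B. x = b \<oplus>\<^bsub>M\<^esub> y)"
  by (auto simp: a_r_coset_def r_coset_def)

lemma homology_carrier:
  "carrier (homology X i) = {boundaries X i +>\<^bsub>grade X i\<^esub> z | z. z \<in> cycles X i}"
  by (auto simp: homology_def quot_module_def A_RCOSETS_def RCOSETS_def a_r_coset_def r_coset_def)

lemma homology_zero: "\<zero>\<^bsub>homology X i\<^esub> = boundaries X i"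
  by (simp add: homology_def quot_module_def)

lemma rcoset_eq_iff:
  assumes "abelian_group M" "additive_subgroup B M" "x \<in> carrier M" "y \<in> carrier M"
  shows "B +>\<^bsub>M\<^esub> x = B +>\<^bsub>M\<^esub> y \<longleftrightarrow> (\<exists>b\<in>B. x = b \<oplus>\<^bsub>M\<^esub> y)"
proof -
  interpret abelian_group M by fact
  interpret additive_subgroup B M by fact
  have self: "x \<in> B +>\<^bsub>M\<^esub> x" unfolding mem_rcoset using assms(3) zero_closed by (metis l_zero)
  show ?thesis
  proof
    assume "B +>\<^bsub>M\<^esub> x = B +>\<^bsub>M\<^esub> y"
    then show "\<exists>b\<in>B. x = b \<oplus>\<^bsub>M\<^esub> y" using self by (simp add: mem_rcoset)
  next
    assume "\<exists>b\<in>B. x = b \<oplus>\<^bsub>M\<^esub> y"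
    then have "x \<in> B +>\<^bsub>M\<^esub> y" by (simp add: mem_rcoset)
    then show "B +>\<^bsub>M\<^esub> x = B +>\<^bsub>M\<^esub> y"
      using a_repr_independence[OF _ assms(4) a_subgroup] by simp
  qed
qed

text \<open>The union in \<open>homology_map\<close> collapses to one coset: two representatives
  differ by a boundary, and \<open>f\<close> sends boundaries to boundaries.\<close>

lemma homology_map_coset:
  assumes X: "chain_complex R X" and Y: "chain_complex R Y" and f: "chain_map R X Y f"
    and z: "z \<in> cycles X i"
  shows "homology_map Y f i (boundaries X i +>\<^bsub>grade X i\<^esub> z) = boundaries Y i +>\<^bsub>grade Y i\<^esub> f i z"
proof -
  interpret X: module R "grade X i" by (rule cpx_module[OF X])
  interpret Y: module R "grade Y i" by (rule cpx_module[OF Y])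
  interpret BX: additive_subgroup "boundaries X i" "grade X i" by (rule
      boundaries_additive_subgroup[OF X])
  interpret BY: additive_subgroup "boundaries Y i" "grade Y i" by (rule
      boundaries_additive_subgroup[OF Y])
  have zc: "z \<in> carrier (grade X i)" using z by (simp add: cycles_iff)
  note fl = cmap_lin[OF f, of i]
  have "boundaries Y i +>\<^bsub>grade Y i\<^esub> f i w = boundaries Y i +>\<^bsub>grade Y i\<^esub> f i z"
    if w: "w \<in> boundaries X i +>\<^bsub>grade X i\<^esub> z" for w
  proof -
    obtain b where b: "b \<in> carrier (grade X (i+1))" "w = bdry X (i+1) b \<oplus>\<^bsub>grade X i\<^esub> z"
      using w by (auto simp: mem_rcoset boundaries_def)
    have bb: "bdry X (i+1) b \<in> carrier (grade X i)" by (rule lin_closed[OF cpx_lin1[OF X] b(1)])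
    have "f i w = bdry Y (i+1) (f (i+1) b) \<oplus>\<^bsub>grade Y i\<^esub> f i z"
      by (simp add: b(2) lin_add[OF fl bb zc] cmap_bdry1[OF f b(1)])
    moreover have "bdry Y (i+1) (f (i+1) b) \<in> boundaries Y i"
      unfolding boundaries_def using lin_closed[OF cmap_lin[OF f] b(1)] by blast
    moreover have "w \<in> carrier (grade X i)" using b(2) bb zc by simp
    ultimately show ?thesis
      using rcoset_eq_iff[OF Y.abelian_group_axioms BY.is_additive_subgroup]
        lin_closed[OF fl] zc by blast
  qed
  moreover have "z \<in> boundaries X i +>\<^bsub>grade X i\<^esub> z"
    using rcoset_eq_iff[OF X.abelian_group_axioms BX.is_additive_subgroup zc zc]
    by (auto simp: mem_rcoset)
  ultimately show ?thesis unfolding homology_map_def by blast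
qed

lemma acyclic_cycles:
  assumes X: "chain_complex R X" and "carrier (homology X i) = {\<zero>\<^bsub>homology X i\<^esub>}"
    and z: "z \<in> cycles X i"
  shows "z \<in> boundaries X i"
proof -
  interpret X: module R "grade X i" by (rule cpx_module[OF X])
  interpret BX: additive_subgroup "boundaries X i" "grade X i" by (rule
      boundaries_additive_subgroup[OF X])
  have zc: "z \<in> carrier (grade X i)" using z by (simp add: cycles_iff)
  have "boundaries X i +>\<^bsub>grade X i\<^esub> z = boundaries X i"
    using assms(2) z by (auto simp: homology_carrier homology_zero)
  then show ?thesis using X.a_coset_join1 zc BX.a_subgroup by blast
qed

text \<open>The mapping cone of a quasi-isomorphism is acyclic.\<close>

lemma quasi_iso_cone_acyclic:
  assumes f: "quasi_iso R Z Y f"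
    and z: "z \<in> carrier (grade Z (i - 1))" and y: "y \<in> carrier (grade Y i)"
    and "bdry Z (i - 1) z = \<zero>\<^bsub>grade Z (i - 1 - 1)\<^esub>" "f (i - 1) z = bdry Y i y"
  shows "\<exists>a \<in> carrier (grade Z i). \<exists>b \<in> carrier (grade Y (i + 1)).
    bdry Z i a = z \<and> y = f i a \<oplus>\<^bsub>grade Y i\<^esub> bdry Y (i + 1) b"
proof -
  have Z: "chain_complex R Z" and Y: "chain_complex R Y" and fm: "chain_map R Z Y f"
    and bij: "\<And>i. bij_betw (homology_map Y f i) (carrier (homology Z i)) (carrier (homology Y i))"
    using f by (auto simp: quasi_iso_def)
  interpret Zj: module R "grade Z (i - 1)" by (rule cpx_module[OF Z])
  interpret Yj: module R "grade Y (i - 1)" by (rule cpx_module[OF Y])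
  interpret Zi: module R "grade Z i" by (rule cpx_module[OF Z])
  interpret Yi: module R "grade Y i" by (rule cpx_module[OF Y])
  interpret BY: additive_subgroup "boundaries Y i" "grade Y i" by (rule
      boundaries_additive_subgroup[OF Y])
  interpret BYj: additive_subgroup "boundaries Y (i - 1)" "grade Y (i - 1)" by (rule
      boundaries_additive_subgroup[OF Y])
  interpret BZj: additive_subgroup "boundaries Z (i - 1)" "grade Z (i - 1)" by (rule
      boundaries_additive_subgroup[OF Z])
  have zcyc: "z \<in> cycles Z (i - 1)" using assms by (simp add: cycles_iff)
  have z0: "\<zero>\<^bsub>grade Z (i - 1)\<^esub> \<in> cycles Z (i - 1)"
    by (simp add: cycles_iff lin_zero[OF cpx_module[OF Z] cpx_module[OF Z] cpx_lin[OF Z]])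
  have bd: "bdry Y i y \<in> boundaries Y (i - 1)" using y by (auto simp: boundaries_def)
  \<comment> \<open>Since \<open>f z\<close> is the boundary of \<open>y\<close>, the class of
    \<open>z\<close> maps to zero; injectivity in degree \<open>i - 1\<close> then makes
    \<open>z\<close> a boundary.\<close>
  have "homology_map Y f (i - 1) (boundaries Z (i - 1) +>\<^bsub>grade Z (i - 1)\<^esub> z) =
      homology_map Y f (i - 1) (boundaries Z (i - 1) +>\<^bsub>grade Z (i - 1)\<^esub> \<zero>\<^bsub>grade Z (i - 1)\<^esub>)"
    unfolding homology_map_coset[OF Z Y fm zcyc] homology_map_coset[OF Z Y fm z0] assms(5)
      lin_zero[OF cpx_module[OF Z] cpx_module[OF Y] cmap_lin[OF fm]]
    using Yj.a_coset_join2[OF _ BYj.a_subgroup bd] BYj.a_subset bd by auto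
  then have "boundaries Z (i - 1) +>\<^bsub>grade Z (i - 1)\<^esub> z =
      boundaries Z (i - 1) +>\<^bsub>grade Z (i - 1)\<^esub> \<zero>\<^bsub>grade Z (i - 1)\<^esub>"
    by (rule inj_onD[OF bij_betw_imp_inj_on[OF bij]]) (use zcyc z0 in \<open>auto simp: homology_carrier\<close>)
  then have "z \<in> boundaries Z (i - 1)"
    using Zj.a_coset_join1[OF _ z BZj.a_subgroup] BZj.a_subset by simp
  then obtain a0 where a0: "a0 \<in> carrier (grade Z i)" "bdry Z i a0 = z"
    by (auto simp: boundaries_def)
  have fa0: "f i a0 \<in> carrier (grade Y i)" by (rule lin_closed[OF cmap_lin[OF fm] a0(1)])
  \<comment> \<open>The primitive \<open>a0\<close> of \<open>z\<close> still has to be corrected by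
    a cycle: \<open>y - f a0\<close> is a cycle, and surjectivity in degree \<open>i\<close> writes
    it as \<open>f c\<close> plus a boundary.\<close>
  let ?c = "y \<ominus>\<^bsub>grade Y i\<^esub> f i a0"
  have "bdry Y i ?c = bdry Y i y \<ominus>\<^bsub>grade Y (i - 1)\<^esub> bdry Y i (f i a0)"
    by (rule lin_minus[OF cpx_module[OF Y] cpx_module[OF Y] cpx_lin[OF Y] y fa0])
  also have "bdry Y i (f i a0) = bdry Y i y"
    using cmap_bdry[OF fm a0(1)] a0(2) assms(5) by simp
  finally have "?c \<in> cycles Y i"
    using y fa0 lin_closed[OF cpx_lin[OF Y] y] by (simp add: cycles_iff Yj.r_neg a_minus_def)
  then have "boundaries Y i +>\<^bsub>grade Y i\<^esub> ?c \<in> carrier (homology Y i)" by (auto simp: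
      homology_carrier)
  then have "boundaries Y i +>\<^bsub>grade Y i\<^esub> ?c \<in> homology_map Y f i ` carrier (homology Z i)"
    using bij_betw_imp_surj_on[OF bij] by blast
  then obtain c where c: "c \<in> cycles Z i"
    "boundaries Y i +>\<^bsub>grade Y i\<^esub> ?c = boundaries Y i +>\<^bsub>grade Y i\<^esub> f i c"
    using homology_map_coset[OF Z Y fm] by (auto simp: homology_carrier)
  have cc: "c \<in> carrier (grade Z i)" "bdry Z i c = \<zero>\<^bsub>grade Z (i - 1)\<^esub>" using c by (auto simp:
      cycles_iff)
  have fc: "f i c \<in> carrier (grade Y i)" by (rule lin_closed[OF cmap_lin[OF fm] cc(1)])
  obtain b where b: "b \<in> carrier (grade Y (i+1))" "?c = bdry Y (i+1) b \<oplus>\<^bsub>grade Y i\<^esub> f i c"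
    using c(2) rcoset_eq_iff[OF Yi.abelian_group_axioms BY.is_additive_subgroup, of ?c "f i c"] y
        fa0 fc
    by (auto simp: boundaries_def)
  have bb: "bdry Y (i+1) b \<in> carrier (grade Y i)" by (rule lin_closed[OF cpx_lin1[OF Y] b(1)])
  have "y = f i a0 \<oplus>\<^bsub>grade Y i\<^esub> ?c" using y fa0 by (simp add: Yi.group_simps)
  also have "\<dots> = f i (a0 \<oplus>\<^bsub>grade Z i\<^esub> c) \<oplus>\<^bsub>grade Y i\<^esub> bdry Y (i+1) b"
    unfolding b(2) lin_add[OF cmap_lin[OF fm] a0(1) cc(1)] using fa0 fc bb by (simp add: Yi.a_ac)
  finally have "y = f i (a0 \<oplus>\<^bsub>grade Z i\<^esub> c) \<oplus>\<^bsub>grade Y i\<^esub> bdry Y (i+1) b" .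
  moreover have "bdry Z i (a0 \<oplus>\<^bsub>grade Z i\<^esub> c) = z"
    using lin_add[OF cpx_lin[OF Z] a0(1) cc(1)] z by (simp add: a0(2) cc(2))
  ultimately show ?thesis using a0(1) cc(1) b(1) Zi.a_closed by blast
qed

section \<open>Bounded below complexes of projective modules\<close>

text \<open>The usual lifting problem for g : P \<rightarrow> N along a surjection e : M
  \<rightarrow> N is the case where \<open>\<Gamma>\<close> consists of the pairs (x, m) with g x =
  e m. Formulated with a relation that is total on P, the property asks for a linear selection and
  mentions a single module \<open>M\<close>. The type \<open>'m\<close> of its elements is a
  parameter because a definition cannot quantify over types.\<close>

definition projective :: "'m itself \<Rightarrow> ('r, 'x) ring_scheme \<Rightarrow> ('r, 'a) module \<Rightarrow> bool" where
  "projective U R P \<longleftrightarrow>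
     (\<forall>(M :: ('r, 'm) module) \<Gamma>. module R M \<and> \<Gamma> \<subseteq> carrier P \<times> carrier M \<and>
        (\<forall>x y x' y'. (x, y) \<in> \<Gamma> \<longrightarrow> (x', y') \<in> \<Gamma> \<longrightarrow> (x \<oplus>\<^bsub>P\<^esub> x', y \<oplus>\<^bsub>M\<^esub> y') \<in> \<Gamma>) \<and>
        (\<forall>r x y. r \<in> carrier R \<longrightarrow> (x, y) \<in> \<Gamma> \<longrightarrow> (r \<odot>\<^bsub>P\<^esub> x, r \<odot>\<^bsub>M\<^esub> y) \<in> \<Gamma>) \<and>
        (\<forall>x \<in> carrier P. \<exists>y. (x, y) \<in> \<Gamma>) \<longrightarrow>
        (\<exists>f. lin_map R P M f \<and> (\<forall>x \<in> carrier P. (x, f x) \<in> \<Gamma>)))"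

lemma projectiveD:
  fixes M :: "('r, 'm) module"
  assumes "projective TYPE('m) R P" "module R M" "\<Gamma> \<subseteq> carrier P \<times> carrier M"
    and "\<And>x y x' y'. (x, y) \<in> \<Gamma> \<Longrightarrow> (x', y') \<in> \<Gamma> \<Longrightarrow> (x \<oplus>\<^bsub>P\<^esub> x', y \<oplus>\<^bsub>M\<^esub> y') \<in> \<Gamma>"
    and "\<And>r x y. r \<in> carrier R \<Longrightarrow> (x, y) \<in> \<Gamma> \<Longrightarrow> (r \<odot>\<^bsub>P\<^esub> x, r \<odot>\<^bsub>M\<^esub> y) \<in> \<Gamma>"
    and "\<And>x. x \<in> carrier P \<Longrightarrow> \<exists>y. (x, y) \<in> \<Gamma>"
  obtains f where "lin_map R P M f" "\<And>x. x \<in> carrier P \<Longrightarrow> (x, f x) \<in> \<Gamma>"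
proof -
  have "\<exists>f. lin_map R P M f \<and> (\<forall>x \<in> carrier P. (x, f x) \<in> \<Gamma>)"
    using assms(1)[unfolded projective_def, THEN spec[where x = M], THEN spec[where x = \<Gamma>]]
        assms(2-)
    by blast
  then show ?thesis using that by blast
qed

lemma dsum_module_module:
  assumes "module R M" "module R N"
  shows "module R (dsum_module M N)"
proof -
  interpret M: module R M by fact
  interpret N: module R N by fact
  show ?thesis
  proof (rule moduleI)
    show "cring R" by (rule M.R.is_cring)
    show "abelian_group (dsum_module M N)"
    proof (rule abelian_groupI)
      fix x assume "x \<in> carrier (dsum_module M N)"
      then show "\<exists>y\<in>carrier (dsum_module M N). y \<oplus>\<^bsub>dsum_module M N\<^esub> x = \<zero>\<^bsub>dsum_module M N\<^esub>"
        by (intro bexI[of _ "(\<ominus>\<^bsub>M\<^esub> fst x, \<ominus>\<^bsub>N\<^esub> snd x)"])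
          (auto simp: dsum_module_def M.l_neg N.l_neg)
    qed (auto simp: dsum_module_def M.a_ac N.a_ac)
  qed (auto simp: dsum_module_def M.smult_l_distr N.smult_l_distr M.smult_r_distr N.smult_r_distr
      M.smult_assoc1 N.smult_assoc1)
qed

lemma lin_dsum_fst: "lin_map R M (dsum_module A B) s \<Longrightarrow> lin_map R M A (\<lambda>x. fst (s x))"
  and lin_dsum_snd: "lin_map R M (dsum_module A B) s \<Longrightarrow> lin_map R M B (\<lambda>x. snd (s x))"
  by (auto simp: lin_map_def dsum_module_def Pi_iff case_prod_beta mem_Times_iff)

definition bounded_projective :: "'m itself \<Rightarrow> ('r, 'x) ring_scheme \<Rightarrow> ('r, 'a) cpx \<Rightarrow> bool" where
  "bounded_projective U R Q \<longleftrightarrow> chain_complex R Q \<and>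
     (\<exists>b. \<forall>i < b. carrier (grade Q i) = {\<zero>\<^bsub>grade Q i\<^esub>}) \<and> (\<forall>i. projective U R (grade Q i))"

lemma bounded_projective_cpx: "bounded_projective U R Q \<Longrightarrow> chain_complex R Q"
  by (simp add: bounded_projective_def)

lemma shift_bounded_projective:
  assumes "bounded_projective U R Q" shows "bounded_projective U R (shift Q)"
proof -
  obtain b where b: "\<And>i. i < b \<Longrightarrow> carrier (grade Q i) = {\<zero>\<^bsub>grade Q i\<^esub>}"
    using assms by (auto simp: bounded_projective_def)
  then have "\<forall>i < b + 1. carrier (grade (shift Q) i) = {\<zero>\<^bsub>grade (shift Q) i\<^esub>}" by auto
  moreover have "\<forall>i. projective U R (grade (shift Q) i)" using assms by (simp add:
      bounded_projective_def)
  ultimately show ?thesis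
    unfolding bounded_projective_def using shift_cpx[OF bounded_projective_cpx[OF assms]] by blast
qed

text \<open>The homotopy is built upwards from the degree below which \<open>Q\<close> vanishes. In
  each degree, \<phi> x minus the value of the previous component at the boundary of x is a cycle,
  hence a boundary, and projectivity chooses the primitives linearly in x.\<close>

lemma null_homotopy_to_acyclic:
  fixes C :: "('r, 'm) cpx"
  assumes Q: "bounded_projective TYPE('m) R Q" and C: "chain_complex R C" and \<phi>: "chain_map R Q C \<phi>"
    and acyclic: "\<And>i c. c \<in> carrier (grade C i) \<Longrightarrow> bdry C i c = \<zero>\<^bsub>grade C (i - 1)\<^esub> \<Longrightarrow>
      \<exists>b \<in> carrier (grade C (i + 1)). bdry C (i + 1) b = c"
  obtains h where "\<And>i. lin_map R (grade Q i) (grade C (i + 1)) (h i)"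
    "\<And>i x. x \<in> carrier (grade Q i) \<Longrightarrow> \<phi> i x = bdry C (i + 1) (h i x) \<oplus>\<^bsub>grade C i\<^esub> h (i - 1) (bdry Q i
        x)"
proof -
  have Qc: "chain_complex R Q" and proj: "\<And>i. projective TYPE('m) R (grade Q i)"
    using Q by (auto simp: bounded_projective_def)
  obtain b where bound: "\<And>i. i < b \<Longrightarrow> carrier (grade Q i) = {\<zero>\<^bsub>grade Q i\<^esub>}"
    using Q by (auto simp: bounded_projective_def)
  note mQ = cpx_module[OF Qc] and mC = cpx_module[OF C]
  \<comment> \<open>\<open>P\<close> keeps of a component only what the next degree needs, its
    behaviour on cycles. \<open>S\<close> is the homotopy equation that links consecutive
    components.\<close>
  define P where "P i s \<longleftrightarrow> lin_map R (grade Q i) (grade C (i + 1)) s \<and>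
    (\<forall>y \<in> carrier (grade Q i). bdry Q i y = \<zero>\<^bsub>grade Q (i - 1)\<^esub> \<longrightarrow> \<phi> i y = bdry C (i + 1) (s y))" for i
        s
  define S where "S i s s' \<longleftrightarrow> (\<forall>x \<in> carrier (grade Q i).
     \<phi> i x = bdry C (i + 1) (s' x) \<oplus>\<^bsub>grade C i\<^esub> s (bdry Q i x))" for i s s'
  \<comment> \<open>\<open>F n\<close> is the component in degree \<open>b - 1 + n\<close>. The
    start in degree \<open>b - 1\<close> is the zero map, which works since \<open>Q\<close>
    vanishes there.\<close>
  have "\<exists>F. \<forall>n. P (b - 1 + int n) (F n) \<and> S (b + int n) (F n) (F (Suc n))"
  proof (rule dependent_nat_choice)
    have "\<phi> (b - 1) \<zero>\<^bsub>grade Q (b - 1)\<^esub> = bdry C b \<zero>\<^bsub>grade C b\<^esub>"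
      using lin_zero[OF mC mC cpx_lin[OF C], of b] by (simp add: lin_zero[OF mQ mC cmap_lin[OF \<phi>]])
    then have "P (b - 1) (\<lambda>_. \<zero>\<^bsub>grade C b\<^esub>)"
      using bound[of "b - 1"] lin_const_zero[OF mC] by (simp add: P_def)
    then show "\<exists>s. P (b - 1 + int 0) s" by auto
  next
    fix s n assume "P (b - 1 + int n) s"
    define i where "i = b + int n"
    have i: "b - 1 + int n = i - 1" "b - 1 + int (Suc n) = i" by (auto simp: i_def)
    have sl: "lin_map R (grade Q (i - 1)) (grade C i) s"
      and sb: "\<And>y. y \<in> carrier (grade Q (i - 1)) \<Longrightarrow> bdry Q (i - 1) y = \<zero>\<^bsub>grade Q (i - 1 - 1)\<^esub> \<Longrightarrow>
        \<phi> (i - 1) y = bdry C i (s y)"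
      using \<open>P (b - 1 + int n) s\<close> by (simp_all add: P_def i)
    interpret Ci: module R "grade C i" by (rule mC)
    interpret Cj: abelian_group "grade C (i - 1)" by (rule module.axioms(2)[OF mC])
    interpret Ck: module R "grade C (i + 1)" by (rule mC)
    interpret Qi: module R "grade Q i" by (rule mQ)
    note bQ = lin_closed[OF cpx_lin[OF Qc]] and bC = lin_closed[OF cpx_lin1[OF C]]
      and fc = lin_closed[OF cmap_lin[OF \<phi>]] and sc = lin_closed[OF sl]
    \<comment> \<open>Pairs each \<open>x\<close> with all values at \<open>x\<close> that satisfy
      the homotopy equation; a linear selection is the new component.\<close>
    let ?\<Gamma> = "{(x, m). x \<in> carrier (grade Q i) \<and> m \<in> carrier (grade C (i + 1)) \<and>
      \<phi> i x = bdry C (i + 1) m \<oplus>\<^bsub>grade C i\<^esub> s (bdry Q i x)}"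
    obtain s' where s': "lin_map R (grade Q i) (grade C (i + 1)) s'"
      "\<And>x. x \<in> carrier (grade Q i) \<Longrightarrow> (x, s' x) \<in> ?\<Gamma>"
    proof (rule projectiveD[OF proj mC, of ?\<Gamma>])
      show "?\<Gamma> \<subseteq> carrier (grade Q i) \<times> carrier (grade C (i + 1))" by blast
      show "(x \<oplus>\<^bsub>grade Q i\<^esub> x', y \<oplus>\<^bsub>grade C (i + 1)\<^esub> y') \<in> ?\<Gamma>"
        if "(x, y) \<in> ?\<Gamma>" "(x', y') \<in> ?\<Gamma>" for x y x' y'
        using that bQ bC sc
        by (simp add: lin_add[OF cmap_lin[OF \<phi>]] lin_add[OF cpx_lin1[OF C]] lin_add[OF cpx_lin[OF
            Qc]]
            lin_add[OF sl] Ci.M.a_ac)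
      show "(r \<odot>\<^bsub>grade Q i\<^esub> x, r \<odot>\<^bsub>grade C (i + 1)\<^esub> y) \<in> ?\<Gamma>"
        if "r \<in> carrier R" "(x, y) \<in> ?\<Gamma>" for r x y
        using that bQ bC sc
        by (simp add: lin_smult[OF cmap_lin[OF \<phi>]] lin_smult[OF cpx_lin1[OF C]] lin_smult[OF
            cpx_lin[OF Qc]]
            lin_smult[OF sl] Ci.smult_r_distr)
      show "\<exists>y. (x, y) \<in> ?\<Gamma>" if x: "x \<in> carrier (grade Q i)" for x
      proof -
        have c: "\<phi> i x \<in> carrier (grade C i)" "s (bdry Q i x) \<in> carrier (grade C i)"
          "bdry C i (\<phi> i x) \<in> carrier (grade C (i - 1))"
          by (rule fc[OF x] sc[OF bQ[OF x]] lin_closed[OF cpx_lin[OF C] fc[OF x]])+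
        \<comment> \<open>The boundary of \<open>x\<close> is a cycle, so the invariant on cycles
          applies to it.\<close>
        have "bdry C i (s (bdry Q i x)) = bdry C i (\<phi> i x)"
          using sb[OF bQ[OF x] cpx_sq[OF Qc x]] cmap_bdry[OF \<phi> x] by simp
        then have "bdry C i (\<phi> i x \<ominus>\<^bsub>grade C i\<^esub> s (bdry Q i x)) = \<zero>\<^bsub>grade C (i - 1)\<^esub>"
          using c(3) unfolding lin_minus[OF mC mC cpx_lin[OF C] c(1,2)] by (simp add:
              Cj.group_simps)
        then obtain m where "m \<in> carrier (grade C (i + 1))" "bdry C (i + 1) m = \<phi> i x \<ominus>\<^bsub>grade C i\<^esub> s
            (bdry Q i x)"
          using acyclic c(1,2) Ci.M.minus_closed by blast
        moreover from this have "\<phi> i x = bdry C (i + 1) m \<oplus>\<^bsub>grade C i\<^esub> s (bdry Q i x)"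
          using c by (simp add: Ci.M.group_simps)
        ultimately show ?thesis using x by blast
      qed
    qed blast
    have "s \<zero>\<^bsub>grade Q (i - 1)\<^esub> = \<zero>\<^bsub>grade C i\<^esub>" by (rule lin_zero[OF mQ mC sl])
    then have "P i s'" using s' bC by (simp add: P_def)
    moreover have "S i s s'" using s'(2) by (simp add: S_def)
    ultimately show "\<exists>s'. P (b - 1 + int (Suc n)) s' \<and> S (b + int n) s s'" unfolding i
        i_def[symmetric] by blast
  qed
  then obtain F where F: "\<And>n. P (b - 1 + int n) (F n)" "\<And>n. S (b + int n) (F n) (F (Suc n))" by
      blast
  define h where "h i = (if i \<ge> b - 1 then F (nat (i - (b - 1))) else (\<lambda>_. \<zero>\<^bsub>grade C (i + 1)\<^esub>))" for i
  have hl: "lin_map R (grade Q i) (grade C (i + 1)) (h i)" for i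
  proof (cases "i \<ge> b - 1")
    case True
    then have "b - 1 + int (nat (i - (b - 1))) = i" by simp
    then show ?thesis using F(1)[of "nat (i - (b - 1))"] True by (simp add: h_def P_def)
  qed (simp add: h_def lin_const_zero[OF mC])
  have "\<phi> i x = bdry C (i + 1) (h i x) \<oplus>\<^bsub>grade C i\<^esub> h (i - 1) (bdry Q i x)"
    if x: "x \<in> carrier (grade Q i)" for i x
  proof (cases "i < b")
    case True
    interpret abelian_group "grade C i" by (rule module.axioms(2)[OF mC])
    have "x = \<zero>\<^bsub>grade Q i\<^esub>" using bound[OF True] x by simp
    moreover have "h (i - 1) \<zero>\<^bsub>grade Q (i - 1)\<^esub> = \<zero>\<^bsub>grade C i\<^esub>" using lin_zero[OF mQ mC hl, of "i - 1"]
        by simp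
    ultimately show ?thesis
      by (simp add: lin_zero[OF mQ mC cmap_lin[OF \<phi>]] lin_zero[OF mQ mC hl] lin_zero[OF mC mC
          cpx_lin1[OF C]]
          lin_zero[OF mQ mQ cpx_lin[OF Qc]])
  next
    case False
    let ?n = "nat (i - b)"
    have n: "b + int ?n = i" "nat (i - (b - 1)) = Suc ?n" "nat (i - 1 - (b - 1)) = ?n" using False
        by auto
    show ?thesis using F(2)[of ?n] x False unfolding S_def n by (simp add: h_def n)
  qed
  with hl show ?thesis using that by blast
qed

section \<open>Mapping cones and lifting along quasi-isomorphisms\<close>

lemma cone_simps [simp]:
  "grade (cone X Y f) i = dsum_module (grade X (i - 1)) (grade Y i)"
  "bdry (cone X Y f) i c = (\<ominus>\<^bsub>grade X (i - 1 - 1)\<^esub> bdry X (i - 1) (fst c),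
     f (i - 1) (fst c) \<oplus>\<^bsub>grade Y (i - 1)\<^esub> bdry Y i (snd c))"
  by (simp_all add: cone_def split: prod.splits)

lemma lin_Pair:
  "lin_map R P M f \<Longrightarrow> lin_map R P N g \<Longrightarrow> lin_map R P (dsum_module M N) (\<lambda>x. (f x, g x))"
  by (auto simp: lin_map_def dsum_module_def)

lemma cone_cpx:
  assumes X: "chain_complex R X" and Y: "chain_complex R Y" and f: "chain_map R X Y f"
  shows "chain_complex R (cone X Y f)"
  unfolding chain_complex_def
proof (intro conjI allI ballI)
  note mX = cpx_module[OF X] and mY = cpx_module[OF Y]
  fix i
  show "module R (grade (cone X Y f) i)" by (simp add: dsum_module_module mX mY)
  have p: "lin_map R (dsum_module (grade X (i - 1)) (grade Y i)) (grade X (i - 1)) (\<lambda>c. fst c)"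
    "lin_map R (dsum_module (grade X (i - 1)) (grade Y i)) (grade Y i) (\<lambda>c. snd c)"
    by (rule lin_dsum_fst[OF lin_id], rule lin_dsum_snd[OF lin_id])
  have b: "bdry (cone X Y f) i = (\<lambda>c. (\<ominus>\<^bsub>grade X (i - 1 - 1)\<^esub> bdry X (i - 1) (fst c),
     f (i - 1) (fst c) \<oplus>\<^bsub>grade Y (i - 1)\<^esub> bdry Y i (snd c)))"
    by (rule ext) simp
  show "lin_map R (grade (cone X Y f) i) (grade (cone X Y f) (i - 1)) (bdry (cone X Y f) i)"
    unfolding b cone_simps(1)
    using lin_Pair[OF lin_uminus[OF mX lin_comp[OF p(1) cpx_lin[OF X]]]
        lin_plus[OF mY lin_comp[OF p(1) cmap_lin[OF f]] lin_comp[OF p(2) cpx_lin[OF Y]]]]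
    by (simp add: comp_def)
  fix c assume "c \<in> carrier (grade (cone X Y f) i)"
  then obtain x y where c: "c = (x, y)" and x: "x \<in> carrier (grade X (i - 1))" and y: "y \<in> carrier
      (grade Y i)"
    by (auto simp: dsum_module_def)
  interpret Xk: abelian_group "grade X (i - 1 - 1 - 1)" by (rule module.axioms(2)[OF mX])
  interpret Yk: abelian_group "grade Y (i - 1 - 1)" by (rule module.axioms(2)[OF mY])
  note bx = lin_closed[OF cpx_lin[OF X] x] and yb = lin_closed[OF cpx_lin[OF Y] y]
    and fx = lin_closed[OF cmap_lin[OF f] x]
  have 1: "\<ominus>\<^bsub>grade X (i - 1 - 1 - 1)\<^esub> bdry X (i - 1 - 1) (\<ominus>\<^bsub>grade X (i - 1 - 1)\<^esub> bdry X (i - 1) x) =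
      \<zero>\<^bsub>grade X (i - 1 - 1 - 1)\<^esub>"
    unfolding lin_neg[OF mX mX cpx_lin[OF X] bx] cpx_sq[OF X x] by (simp only: Xk.neg_zero)
  have 2: "f (i - 1 - 1) (\<ominus>\<^bsub>grade X (i - 1 - 1)\<^esub> bdry X (i - 1) x) \<oplus>\<^bsub>grade Y (i - 1 - 1)\<^esub>
      bdry Y (i - 1) (f (i - 1) x \<oplus>\<^bsub>grade Y (i - 1)\<^esub> bdry Y i y) = \<zero>\<^bsub>grade Y (i - 1 - 1)\<^esub>"
    unfolding lin_neg[OF mX mY cmap_lin[OF f] bx] lin_add[OF cpx_lin[OF Y] fx yb] cpx_sq[OF Y y]
        cmap_bdry[OF f x]
    using lin_closed[OF cpx_lin[OF Y] fx] by (simp only: Yk.r_zero Yk.l_neg)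
  show "bdry (cone X Y f) (i - 1) (bdry (cone X Y f) i c) = \<zero>\<^bsub>grade (cone X Y f) (i - 1 - 1)\<^esub>"
    unfolding c cone_simps fst_conv snd_conv 1 2 by (simp add: dsum_module_def)
qed

text \<open>For a cycle (z, y) of the cone, \<open>f z\<close> is minus the boundary of
  \<open>y\<close>; thus \<open>quasi_iso_cone_acyclic\<close> applies to the pair (-z, y), and its
  witnesses form a primitive.\<close>

lemma cone_acyclic:
  assumes f: "quasi_iso R Z Y f" and c: "c \<in> carrier (grade (cone Z Y f) i)"
    and bc: "bdry (cone Z Y f) i c = \<zero>\<^bsub>grade (cone Z Y f) (i - 1)\<^esub>"
  shows "\<exists>b \<in> carrier (grade (cone Z Y f) (i + 1)). bdry (cone Z Y f) (i + 1) b = c"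
proof -
  have Z: "chain_complex R Z" and Y: "chain_complex R Y" and fm: "chain_map R Z Y f"
    using f by (auto simp: quasi_iso_def)
  note mZ = cpx_module[OF Z] and mY = cpx_module[OF Y]
  interpret Zi: abelian_group "grade Z (i - 1)" by (rule module.axioms(2)[OF mZ])
  interpret Yj: abelian_group "grade Y (i - 1)" by (rule module.axioms(2)[OF mY])
  obtain z y where zy: "c = (z, y)" and z: "z \<in> carrier (grade Z (i - 1))" and y: "y \<in> carrier
      (grade Y i)"
    using c by (auto simp: dsum_module_def)
  have bz: "\<ominus>\<^bsub>grade Z (i - 1 - 1)\<^esub> bdry Z (i - 1) z = \<zero>\<^bsub>grade Z (i - 1 - 1)\<^esub>"
    and fz: "f (i - 1) z \<oplus>\<^bsub>grade Y (i - 1)\<^esub> bdry Y i y = \<zero>\<^bsub>grade Y (i - 1)\<^esub>"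
    using bc by (simp_all add: zy dsum_module_def)
  have nz: "\<ominus>\<^bsub>grade Z (i - 1)\<^esub> z \<in> carrier (grade Z (i - 1))" using z by simp
  have n: "bdry Z (i - 1) (\<ominus>\<^bsub>grade Z (i - 1)\<^esub> z) = \<zero>\<^bsub>grade Z (i - 1 - 1)\<^esub>"
    using lin_neg[OF mZ mZ cpx_lin[OF Z] z] bz by simp
  have "f (i - 1) (\<ominus>\<^bsub>grade Z (i - 1)\<^esub> z) = bdry Y i y"
    using lin_neg[OF mZ mY cmap_lin[OF fm] z] fz
      Yj.minus_equality[of "bdry Y i y" "f (i - 1) z"] lin_closed[OF cmap_lin[OF fm] z]
          lin_closed[OF cpx_lin[OF Y] y]
    by (simp add: Yj.a_comm)
  then obtain a b where ab: "a \<in> carrier (grade Z i)" "b \<in> carrier (grade Y (i + 1))"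
    "bdry Z i a = \<ominus>\<^bsub>grade Z (i - 1)\<^esub> z" "y = f i a \<oplus>\<^bsub>grade Y i\<^esub> bdry Y (i + 1) b"
    using quasi_iso_cone_acyclic[OF f nz y n] by blast
  then show ?thesis
    using z by (intro bexI[of _ "(a, b)"]) (simp_all add: zy dsum_module_def)
qed

text \<open>The map x \<mapsto> (0, g x) into the acyclic cone of \<open>f\<close> is
  null-homotopic. The first coordinate of the homotopy is the lift \<open>l\<close>, a chain map;
  the second is a homotopy from \<open>f l\<close> to \<open>g\<close>. The cone has elements in
  \<open>'z \<times> 'y\<close>, whence the type in the projectivity assumption.\<close>

lemma lift_exists:
  fixes Z :: "('r, 'z) cpx" and Y :: "('r, 'y) cpx"
  assumes Q: "bounded_projective TYPE('z \<times> 'y) R Q" and f: "quasi_iso R Z Y f" and g: "chain_map R Q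
      Y g"
  shows "\<exists>l. chain_map R Q Z l \<and> homotopic R Q Y g (\<lambda>i. f i \<circ> l i)"
proof -
  have Z: "chain_complex R Z" and Y: "chain_complex R Y" and fm: "chain_map R Z Y f"
    using f by (auto simp: quasi_iso_def)
  note mZ = cpx_module[OF Z] and mY = cpx_module[OF Y] and Qc = bounded_projective_cpx[OF Q]
  have "chain_map R Q (cone Z Y f) (\<lambda>i x. (\<zero>\<^bsub>grade Z (i - 1)\<^esub>, g i x))"
    unfolding chain_map_def
  proof (intro conjI allI ballI)
    show "lin_map R (grade Q i) (grade (cone Z Y f) i) (\<lambda>x. (\<zero>\<^bsub>grade Z (i - 1)\<^esub>, g i x))" for i
      by (simp add: lin_Pair lin_const_zero[OF mZ] cmap_lin[OF g])
    fix i x assume x: "x \<in> carrier (grade Q i)"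
    interpret Zk: abelian_group "grade Z (i - 1 - 1)" by (rule module.axioms(2)[OF mZ])
    interpret Yj: abelian_group "grade Y (i - 1)" by (rule module.axioms(2)[OF mY])
    have "bdry Y i (g i x) \<in> carrier (grade Y (i - 1))"
      by (rule lin_closed[OF cpx_lin[OF Y] lin_closed[OF cmap_lin[OF g] x]])
    then show "(\<zero>\<^bsub>grade Z (i - 1 - 1)\<^esub>, g (i - 1) (bdry Q i x)) =
        bdry (cone Z Y f) i (\<zero>\<^bsub>grade Z (i - 1)\<^esub>, g i x)"
      unfolding cone_simps fst_conv snd_conv lin_zero[OF mZ mZ cpx_lin[OF Z]] lin_zero[OF mZ mY
          cmap_lin[OF fm]]
        Zk.neg_zero cmap_bdry[OF g x] by simp
  qed
  then obtain h where h: "\<And>i. lin_map R (grade Q i) (grade (cone Z Y f) (i + 1)) (h i)"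
    "\<And>i x. x \<in> carrier (grade Q i) \<Longrightarrow> (\<zero>\<^bsub>grade Z (i - 1)\<^esub>, g i x) =
      bdry (cone Z Y f) (i + 1) (h i x) \<oplus>\<^bsub>grade (cone Z Y f) i\<^esub> h (i - 1) (bdry Q i x)"
    using null_homotopy_to_acyclic[OF Q cone_cpx[OF Z Y fm] _ cone_acyclic[OF f]] by blast
  define l where "l i x = fst (h i x)" for i x
  define k where "k i x = snd (h i x)" for i x
  have l: "lin_map R (grade Q i) (grade Z i) (l i)" for i
    using lin_dsum_fst[OF h(1)[of i, unfolded cone_simps]] by (simp add: l_def[abs_def])
  have k: "lin_map R (grade Q i) (grade Y (i + 1)) (k i)" for i
    using lin_dsum_snd[OF h(1)[of i, unfolded cone_simps]] by (simp add: k_def[abs_def])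
  have "l (i - 1) (bdry Q i x) = bdry Z i (l i x)"
    "g i x = f i (l i x) \<oplus>\<^bsub>grade Y i\<^esub> (bdry Y (i + 1) (k i x) \<oplus>\<^bsub>grade Y i\<^esub> k (i - 1) (bdry Q i x))"
    if x: "x \<in> carrier (grade Q i)" for i x
  proof -
    interpret Zj: abelian_group "grade Z (i - 1)" by (rule module.axioms(2)[OF mZ])
    interpret Yi: abelian_group "grade Y i" by (rule module.axioms(2)[OF mY])
    note xb = lin_closed[OF cpx_lin[OF Qc] x]
    have c: "bdry Z i (l i x) \<in> carrier (grade Z (i - 1))" "l (i - 1) (bdry Q i x) \<in> carrier (grade
        Z (i - 1))"
      "f i (l i x) \<in> carrier (grade Y i)" "bdry Y (i + 1) (k i x) \<in> carrier (grade Y i)"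
      by (rule lin_closed[OF cpx_lin[OF Z] lin_closed[OF l x]] lin_closed[OF l xb]
          lin_closed[OF cmap_lin[OF fm] lin_closed[OF l x]] lin_closed[OF cpx_lin1[OF Y]
              lin_closed[OF k x]])+
    have d: "k (i - 1) (bdry Q i x) \<in> carrier (grade Y i)" using lin_closed[OF k xb] by simp
    have "\<zero>\<^bsub>grade Z (i - 1)\<^esub> = \<ominus>\<^bsub>grade Z (i - 1)\<^esub> bdry Z i (l i x) \<oplus>\<^bsub>grade Z (i - 1)\<^esub> l (i - 1) (bdry Q i
        x)"
      and e: "g i x = (f i (l i x) \<oplus>\<^bsub>grade Y i\<^esub> bdry Y (i + 1) (k i x)) \<oplus>\<^bsub>grade Y i\<^esub> k (i - 1) (bdry Q i
          x)"
      using h(2)[OF x] by (simp_all add: dsum_module_def l_def k_def case_prod_beta)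
    then show "l (i - 1) (bdry Q i x) = bdry Z i (l i x)"
      using Zj.r_neg1[OF c(1,2)] c by (metis Zj.minus_equality Zj.minus_minus Zj.a_inv_closed
          Zj.a_comm)
    show "g i x = f i (l i x) \<oplus>\<^bsub>grade Y i\<^esub> (bdry Y (i + 1) (k i x) \<oplus>\<^bsub>grade Y i\<^esub> k (i - 1) (bdry Q i x))"
      unfolding e using c d by (simp add: Yi.a_assoc)
  qed
  then have "chain_map R Q Z l" "homotopic R Q Y g (\<lambda>i. f i \<circ> l i)"
    using l k by (auto simp: chain_map_def homotopic_def)
  then show ?thesis by blast
qed

text \<open>The difference of the two lifts and the homotopy form a map \<open>\<Sigma>Q \<rightarrow> cone f\<close>.\<close>

lemma lift_unique:
  fixes Z :: "('r, 'z) cpx" and Y :: "('r, 'y) cpx"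
  assumes Q: "bounded_projective TYPE('z \<times> 'y) R Q" and f: "quasi_iso R Z Y f"
    and l1: "chain_map R Q Z l1" and l2: "chain_map R Q Z l2"
    and hom: "homotopic R Q Y (\<lambda>i. f i \<circ> l1 i) (\<lambda>i. f i \<circ> l2 i)"
  shows "homotopic R Q Z l1 l2"
proof -
  have Z: "chain_complex R Z" and Y: "chain_complex R Y" and fm: "chain_map R Z Y f"
    using f by (auto simp: quasi_iso_def)
  note mZ = cpx_module[OF Z] and mY = cpx_module[OF Y] and Qc = bounded_projective_cpx[OF Q]
  note mQ = cpx_module[OF Qc]
  from hom obtain H where "homotopy R Q Y (\<lambda>i. f i \<circ> l1 i) (\<lambda>i. f i \<circ> l2 i) H" by (rule homotopicE)
  note H = homotopyD[OF this]
  define a where "a i x = l1 i x \<oplus>\<^bsub>grade Z i\<^esub> \<ominus>\<^bsub>grade Z i\<^esub> l2 i x" for i x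
  have a: "lin_map R (grade Q i) (grade Z i) (a i)" for i
    using lin_plus[OF mZ cmap_lin[OF l1] lin_uminus[OF mZ cmap_lin[OF l2]]] by (simp add:
        a_def[abs_def])
  have ab: "a (i - 1) (bdry Q i x) = bdry Z i (a i x)" if x: "x \<in> carrier (grade Q i)" for i x
  proof -
    note c = lin_closed[OF cmap_lin[OF l1] x] lin_closed[OF cmap_lin[OF l2] x]
    interpret abelian_group "grade Z i" by (rule module.axioms(2)[OF mZ])
    show ?thesis
      using c by (simp add: a_def cmap_bdry[OF l1 x] cmap_bdry[OF l2 x] lin_add[OF cpx_lin[OF Z]]
          lin_neg[OF mZ mZ cpx_lin[OF Z]])
  qed
  have fa: "f i (a i x) = bdry Y (i + 1) (H i x) \<oplus>\<^bsub>grade Y i\<^esub> H (i - 1) (bdry Q i x)"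
    if x: "x \<in> carrier (grade Q i)" for i x
  proof -
    interpret Zi: abelian_group "grade Z i" by (rule module.axioms(2)[OF mZ])
    interpret Yi: abelian_group "grade Y i" by (rule module.axioms(2)[OF mY])
    note c = lin_closed[OF cmap_lin[OF l1] x] lin_closed[OF cmap_lin[OF l2] x]
    note d = lin_closed[OF cmap_lin[OF fm] c(2)] lin_closed[OF cpx_lin1[OF Y] H(3)[OF x]]
      H(4)[OF lin_closed[OF cpx_lin[OF Qc] x]]
    show ?thesis
      using c d H(2)[OF x]
      by (simp add: a_def lin_add[OF cmap_lin[OF fm]] lin_neg[OF mZ mY cmap_lin[OF fm]]
          Yi.group_simps)
  qed
  \<comment> \<open>The minus sign on \<open>H\<close> compensates the sign in the differential of
    \<open>shift Q\<close>; with it, \<open>fa\<close> says that the pair commutes with the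
    differentials.\<close>
  let ?\<phi> = "\<lambda>i x. (a (i - 1) x, \<ominus>\<^bsub>grade Y i\<^esub> H (i - 1) x)"
  have "chain_map R (shift Q) (cone Z Y f) ?\<phi>"
    unfolding chain_map_def
  proof (intro conjI allI ballI)
    fix i
    have H': "lin_map R (grade Q (i - 1)) (grade Y i) (H (i - 1))" using H(1)[of "i - 1"] by simp
    show "lin_map R (grade (shift Q) i) (grade (cone Z Y f) i) (?\<phi> i)"
      using lin_Pair[OF a lin_uminus[OF mY H']] by simp
    fix x assume "x \<in> carrier (grade (shift Q) i)"
    then have x: "x \<in> carrier (grade Q (i - 1))" by simp
    interpret Yj: abelian_group "grade Y (i - 1)" by (rule module.axioms(2)[OF mY])
    note xb = lin_closed[OF cpx_lin[OF Qc] x] and Hx = lin_closed[OF H' x]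
    have H'': "lin_map R (grade Q (i - 1 - 1)) (grade Y (i - 1)) (H (i - 1 - 1))" using H(1)[of "i -
        1 - 1"] by simp
    have c: "H (i - 1 - 1) (bdry Q (i - 1) x) \<in> carrier (grade Y (i - 1))" "bdry Y i (H (i - 1) x) \<in>
        carrier (grade Y (i - 1))"
      by (rule lin_closed[OF H'' xb] lin_closed[OF cpx_lin[OF Y] Hx])+
    have fa': "f (i - 1) (a (i - 1) x) = bdry Y i (H (i - 1) x) \<oplus>\<^bsub>grade Y (i - 1)\<^esub> H (i - 1 - 1) (bdry
        Q (i - 1) x)"
      using fa[OF x] by simp
    show "?\<phi> (i - 1) (bdry (shift Q) i x) = bdry (cone Z Y f) i (?\<phi> i x)"
      unfolding cone_simps shift_simps fst_conv snd_conv lin_neg[OF mQ mZ a xb] ab[OF x] lin_neg[OF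
          mQ mY H'' xb]
        lin_neg[OF mY mY cpx_lin[OF Y] Hx] fa'
      using c by (simp only: prod.inject refl Yj.group_simps Yj.a_closed Yj.a_inv_closed simp_thms
          Yj.minus_minus Yj.r_zero)
  qed
  then obtain h where h: "\<And>i. lin_map R (grade (shift Q) i) (grade (cone Z Y f) (i + 1)) (h i)"
    "\<And>i x. x \<in> carrier (grade (shift Q) i) \<Longrightarrow> ?\<phi> i x =
      bdry (cone Z Y f) (i + 1) (h i x) \<oplus>\<^bsub>grade (cone Z Y f) i\<^esub> h (i - 1) (bdry (shift Q) i x)"
    using null_homotopy_to_acyclic[OF shift_bounded_projective[OF Q] cone_cpx[OF Z Y fm] _
        cone_acyclic[OF f]]
    by blast
  \<comment> \<open>First coordinate of the null-homotopy, reindexed to undo the suspension; its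
    negative is a homotopy between the lifts.\<close>
  define k where "k i x = fst (h (i + 1) x)" for i x
  have k: "lin_map R (grade Q i) (grade Z (i + 1)) (k i)" for i
    using lin_dsum_fst[OF h(1)[of "i + 1", unfolded cone_simps]] by (simp add: k_def[abs_def]
        add.commute)
  show ?thesis
    unfolding homotopic_def
  proof (intro exI conjI allI ballI)
    show "lin_map R (grade Q i) (grade Z (i + 1)) (\<lambda>x. \<ominus>\<^bsub>grade Z (i + 1)\<^esub> k i x)" for i
      by (rule lin_uminus[OF mZ k])
    fix i x assume x: "x \<in> carrier (grade Q i)"
    interpret Zi: abelian_group "grade Z i" by (rule module.axioms(2)[OF mZ])
    note xb = lin_closed[OF cpx_lin[OF Qc] x]
    have k': "lin_map R (grade Q (i - 1)) (grade Z i) (k (i - 1))" using k[of "i - 1"] by simp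
    have "a i x = \<ominus>\<^bsub>grade Z i\<^esub> bdry Z (i + 1) (k i x) \<oplus>\<^bsub>grade Z i\<^esub> k (i - 1) (\<ominus>\<^bsub>grade Q (i - 1)\<^esub> bdry Q i
        x)"
      using h(2)[of x "i + 1"] x by (simp add: dsum_module_def k_def case_prod_beta add.commute)
    then have e: "l1 i x \<oplus>\<^bsub>grade Z i\<^esub> \<ominus>\<^bsub>grade Z i\<^esub> l2 i x =
        \<ominus>\<^bsub>grade Z i\<^esub> bdry Z (i + 1) (k i x) \<oplus>\<^bsub>grade Z i\<^esub> \<ominus>\<^bsub>grade Z i\<^esub> k (i - 1) (bdry Q i x)"
      unfolding a_def lin_neg[OF mQ mZ k' xb] .
    note c = lin_closed[OF cmap_lin[OF l1] x] lin_closed[OF cmap_lin[OF l2] x]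
      lin_closed[OF cpx_lin1[OF Z] lin_closed[OF k x]] lin_closed[OF k' xb]
    have "l1 i x = l2 i x \<oplus>\<^bsub>grade Z i\<^esub> (l1 i x \<oplus>\<^bsub>grade Z i\<^esub> \<ominus>\<^bsub>grade Z i\<^esub> l2 i x)"
      using c by (simp add: Zi.group_simps)
    then show "l1 i x = l2 i x \<oplus>\<^bsub>grade Z i\<^esub> (bdry Z (i + 1) (\<ominus>\<^bsub>grade Z (i + 1)\<^esub> k i x) \<oplus>\<^bsub>grade Z i\<^esub>
        \<ominus>\<^bsub>grade Z (i - 1 + 1)\<^esub> k (i - 1) (bdry Q i x))"
      unfolding e by (simp add: lin_neg[OF mZ mZ cpx_lin1[OF Z] lin_closed[OF k x]])
  qed
qed

section \<open>Morphisms of the derived category on homotopy classes\<close>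

text \<open>For a bounded below complex \<open>Q\<close> of projectives, homotopy classes Q
  \<rightarrow> X are the morphisms from \<open>Q\<close> to \<open>X\<close> in the derived
  category, and this is composition with \<open>\<rho>\<close>. It relates representatives, as the
  lift along the backward leg is determined only up to homotopy. \<open>Q\<close> may live over a
  type other than \<open>'u\<close>, so it is not itself the source of a roof.\<close>

definition carries ::
  "('r, 'x) ring_scheme \<Rightarrow> ('r, 'q) cpx \<Rightarrow> ('r, 'u) cpx \<Rightarrow> ('r, 'u) cpx \<Rightarrow> ('r, 'u) roof \<Rightarrow>
    (int \<Rightarrow> 'q \<Rightarrow> 'u) \<Rightarrow> (int \<Rightarrow> 'q \<Rightarrow> 'u) \<Rightarrow> bool" where
  "carries R Q X Y \<rho> g g' \<longleftrightarrow> (\<exists>l. chain_map R Q (apex \<rho>) l \<and>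
     homotopic R Q X (\<lambda>i. bleg \<rho> i \<circ> l i) g \<and> homotopic R Q Y (\<lambda>i. fleg \<rho> i \<circ> l i) g')"

lemma D_homD:
  assumes "D_hom R X Y \<rho>"
  shows "chain_complex R X" "chain_complex R Y" "quasi_iso R (apex \<rho>) X (bleg \<rho>)"
    "chain_map R (apex \<rho>) X (bleg \<rho>)" "chain_map R (apex \<rho>) Y (fleg \<rho>)" "chain_complex R (apex \<rho>)"
  using assms by (auto simp: D_hom_def quasi_iso_def)

lemma carries_exists:
  fixes X Y :: "('r, 'u) cpx"
  assumes Q: "bounded_projective TYPE('u \<times> 'u) R Q" and \<rho>: "D_hom R X Y \<rho>" and g: "chain_map R Q X
      g"
  shows "\<exists>g'. chain_map R Q Y g' \<and> carries R Q X Y \<rho> g g'"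
proof -
  note d = D_homD[OF \<rho>] and Qc = bounded_projective_cpx[OF Q]
  obtain l where l: "chain_map R Q (apex \<rho>) l" "homotopic R Q X g (\<lambda>i. bleg \<rho> i \<circ> l i)"
    using lift_exists[OF Q d(3) g] by blast
  have "homotopic R Q X (\<lambda>i. bleg \<rho> i \<circ> l i) g"
    by (rule homotopic_sym[OF Qc d(1) _ l(2)]) (rule cmap_lin[OF cmap_comp[OF l(1) d(4)]])
  moreover have c: "chain_map R Q Y (\<lambda>i. fleg \<rho> i \<circ> l i)" by (rule cmap_comp[OF l(1) d(5)])
  moreover have "homotopic R Q Y (\<lambda>i. fleg \<rho> i \<circ> l i) (\<lambda>i. fleg \<rho> i \<circ> l i)"
    by (rule homotopic_refl[OF d(2) cmap_lin[OF c]]) simp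
  ultimately show ?thesis using l(1) unfolding carries_def by blast
qed

text \<open>Two lifts of homotopic maps along the quasi-isomorphism \<open>bleg \<rho>\<close> are
  homotopic by \<open>lift_unique\<close>, and composing with \<open>fleg \<rho>\<close> preserves
  this.\<close>

lemma carries_unique:
  fixes X Y :: "('r, 'u) cpx"
  assumes Q: "bounded_projective TYPE('u \<times> 'u) R Q" and \<rho>: "D_hom R X Y \<rho>"
    and c1: "carries R Q X Y \<rho> g1 h1" and c2: "carries R Q X Y \<rho> g2 h2"
    and g2: "chain_map R Q X g2" and h1: "chain_map R Q Y h1" and h2: "chain_map R Q Y h2"
    and hom: "homotopic R Q X g1 g2"
  shows "homotopic R Q Y h1 h2"
proof -
  note d = D_homD[OF \<rho>] and Qc = bounded_projective_cpx[OF Q]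
  obtain k where k: "chain_map R Q (apex \<rho>) k" "homotopic R Q X (\<lambda>i. bleg \<rho> i \<circ> k i) g1"
    "homotopic R Q Y (\<lambda>i. fleg \<rho> i \<circ> k i) h1"
    using c1 by (auto simp: carries_def)
  obtain l where l: "chain_map R Q (apex \<rho>) l" "homotopic R Q X (\<lambda>i. bleg \<rho> i \<circ> l i) g2"
    "homotopic R Q Y (\<lambda>i. fleg \<rho> i \<circ> l i) h2"
    using c2 by (auto simp: carries_def)
  note bl = cmap_lin[OF cmap_comp[OF l(1) d(4)]] and fl = cmap_lin[OF cmap_comp[OF l(1) d(5)]]
  have "homotopic R Q X g1 (\<lambda>i. bleg \<rho> i \<circ> l i)"
    by (rule homotopic_trans[OF Qc d(1) bl hom homotopic_sym[OF Qc d(1) cmap_lin[OF g2] l(2)]])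
  then have "homotopic R Q X (\<lambda>i. bleg \<rho> i \<circ> k i) (\<lambda>i. bleg \<rho> i \<circ> l i)"
    by (rule homotopic_trans[OF Qc d(1) bl k(2)])
  then have "homotopic R Q (apex \<rho>) k l" by (rule lift_unique[OF Q d(3) k(1) l(1)])
  then have "homotopic R Q Y (\<lambda>i. fleg \<rho> i \<circ> k i) (\<lambda>i. fleg \<rho> i \<circ> l i)"
    by (rule homotopic_comp_left[OF Qc d(6) cmap_lin[OF l(1)] d(5)])
  then have "homotopic R Q Y (\<lambda>i. fleg \<rho> i \<circ> k i) h2"
    by (rule homotopic_trans[OF Qc d(2) cmap_lin[OF h2] _ l(3)])
  moreover have "homotopic R Q Y h1 (\<lambda>i. fleg \<rho> i \<circ> k i)"
    by (rule homotopic_sym[OF Qc d(2) cmap_lin[OF h1] k(3)])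
  ultimately show ?thesis using homotopic_trans[OF Qc d(2) cmap_lin[OF h2]] by blast
qed

lemma carries_precomp:
  assumes "chain_map R Q Q' q" "carries R Q' X Y \<rho> g g'"
  shows "carries R Q X Y \<rho> (\<lambda>i. g i \<circ> q i) (\<lambda>i. g' i \<circ> q i)"
proof -
  obtain l where l: "chain_map R Q' (apex \<rho>) l" "homotopic R Q' X (\<lambda>i. bleg \<rho> i \<circ> l i) g"
    "homotopic R Q' Y (\<lambda>i. fleg \<rho> i \<circ> l i) g'"
    using assms(2) by (auto simp: carries_def)
  show ?thesis
    unfolding carries_def
    using cmap_comp[OF assms(1) l(1)] homotopic_comp_right[OF assms(1) l(2)]
      homotopic_comp_right[OF assms(1) l(3)]
    by (auto simp: comp_assoc intro!: exI[of _ "\<lambda>i. l i \<circ> q i"])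
qed

text \<open>The refinement \<open>V\<close> that witnesses the identity composite maps to the apexes
  of both roofs. One lift of \<open>g\<close> to \<open>V\<close> therefore yields compatible lifts
  along \<open>\<rho>\<close> and \<open>\<sigma>\<close>, and the homotopies stored with
  \<open>V\<close> bring the result back to \<open>g\<close>.\<close>

lemma carries_back_and_forth:
  fixes X Y :: "('r, 'u) cpx"
  assumes Q: "bounded_projective TYPE('u \<times> 'u) R Q" and comp: "D_comp R X Y X \<rho> \<sigma> (D_id X)"
    and g: "chain_map R Q X g"
  shows "\<exists>g'. chain_map R Q Y g' \<and> carries R Q X Y \<rho> g g' \<and> carries R Q Y X \<sigma> g' g"
proof -
  have \<rho>: "D_hom R X Y \<rho>" and \<sigma>: "D_hom R Y X \<sigma>" using comp by (auto simp: D_comp_def)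
  note d = D_homD[OF \<rho>] and e = D_homD[OF \<sigma>] and Qc = bounded_projective_cpx[OF Q]
  obtain W p q where W: "quasi_iso R W (apex \<rho>) p" "chain_map R W (apex \<sigma>) q"
    "homotopic R W Y (\<lambda>i. fleg \<rho> i \<circ> p i) (\<lambda>i. bleg \<sigma> i \<circ> q i)"
    "D_eq R X X \<lparr>apex = W, bleg = (\<lambda>i. bleg \<rho> i \<circ> p i), fleg = (\<lambda>i. fleg \<sigma> i \<circ> q i)\<rparr> (D_id X)"
    using comp by (auto simp: D_comp_def)
  obtain V :: "('r, 'u) cpx" and a b where V: "quasi_iso R V W a" "quasi_iso R V X b"
    "homotopic R V X (\<lambda>i. bleg \<rho> i \<circ> p i \<circ> a i) (\<lambda>i. (\<lambda>x. x) \<circ> b i)"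
    "homotopic R V X (\<lambda>i. fleg \<sigma> i \<circ> q i \<circ> a i) (\<lambda>i. (\<lambda>x. x) \<circ> b i)"
    using W(4) by (auto simp: D_eq_def D_id_def D_of_def)
  have id: "(\<lambda>x. x) \<circ> b i = b i" for i by (simp add: fun_eq_iff)
  have pm: "chain_map R W (apex \<rho>) p" and am: "chain_map R V W a" and bm: "chain_map R V X b"
    using W V by (auto simp: quasi_iso_def)
  obtain m where m: "chain_map R Q V m" "homotopic R Q X g (\<lambda>i. b i \<circ> m i)"
    using lift_exists[OF Q V(2) g] by blast
  have bm_g: "homotopic R Q X (\<lambda>i. b i \<circ> m i) g"
    by (rule homotopic_sym[OF Qc d(1) cmap_lin[OF cmap_comp[OF m(1) bm]] m(2)])
  let ?l = "\<lambda>i. p i \<circ> (a i \<circ> m i)" and ?k = "\<lambda>i. q i \<circ> (a i \<circ> m i)"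
  note l = cmap_comp[OF cmap_comp[OF m(1) am] pm] and k = cmap_comp[OF cmap_comp[OF m(1) am] W(2)]
  let ?g = "\<lambda>i. fleg \<rho> i \<circ> ?l i"
  note g' = cmap_comp[OF l d(5)]
  have "homotopic R Q X (\<lambda>i. bleg \<rho> i \<circ> ?l i) g"
    using homotopic_trans[OF Qc d(1) cmap_lin[OF g] homotopic_comp_right[OF m(1) V(3)]] bm_g
    by (simp add: id comp_assoc)
  moreover have "homotopic R Q X (\<lambda>i. fleg \<sigma> i \<circ> ?k i) g"
    using homotopic_trans[OF Qc d(1) cmap_lin[OF g] homotopic_comp_right[OF m(1) V(4)]] bm_g
    by (simp add: id comp_assoc)
  moreover have "homotopic R Q Y ?g ?g" by (rule homotopic_refl[OF d(2) cmap_lin[OF g']]) simp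
  moreover have "homotopic R Q Y ?g (\<lambda>i. bleg \<sigma> i \<circ> ?k i)"
    using homotopic_comp_right[OF cmap_comp[OF m(1) am] W(3)] by (simp add: comp_assoc)
  then have "homotopic R Q Y (\<lambda>i. bleg \<sigma> i \<circ> ?k i) ?g"
    by (rule homotopic_sym[OF Qc d(2) cmap_lin[OF cmap_comp[OF k e(4)]]])
  ultimately show ?thesis using l k g' unfolding carries_def by blast
qed

section \<open>Elements that die modulo an ideal\<close>

text \<open>
  The graph of an \<open>R\<close>-linear map \<open>\<phi> : I \<rightarrow> R/I\<close>, pulled back to a relation between \<open>I\<close> and \<open>R\<close>.
  For a module \<open>M\<close> it induces a relation between \<open>I M\<close> and \<open>M\<close>; if \<open>M\<close> is flat this is the
  pullback of the graph of \<open>I M = I \<otimes> M \<rightarrow> M / I M\<close>.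
\<close>

definition graph_mod :: "('r, 'x) ring_scheme \<Rightarrow> 'r set \<Rightarrow> ('r \<times> 'r) set \<Rightarrow> bool" where
  "graph_mod R I G \<longleftrightarrow> G \<subseteq> carrier R \<times> carrier R \<and>
     (\<forall>a b a' b'. (a, b) \<in> G \<longrightarrow> (a', b') \<in> G \<longrightarrow> (a \<oplus>\<^bsub>R\<^esub> a', b \<oplus>\<^bsub>R\<^esub> b') \<in> G) \<and>
     (\<forall>r a b. r \<in> carrier R \<longrightarrow> (a, b) \<in> G \<longrightarrow> (r \<otimes>\<^bsub>R\<^esub> a, r \<otimes>\<^bsub>R\<^esub> b) \<in> G) \<and>
     (\<forall>a \<in> I. \<exists>b. (a, b) \<in> G) \<and> (\<forall>b. (\<zero>\<^bsub>R\<^esub>, b) \<in> G \<longrightarrow> b \<in> I)"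

inductive_set induced :: "('r, 'x) ring_scheme \<Rightarrow> ('r \<times> 'r) set \<Rightarrow> ('r, 'a) module \<Rightarrow> ('a \<times> 'a) set"
  for R G M where
    prod: "\<lbrakk>(a, b) \<in> G; x \<in> carrier M\<rbrakk> \<Longrightarrow> (a \<odot>\<^bsub>M\<^esub> x, b \<odot>\<^bsub>M\<^esub> x) \<in> induced R G M"
  | sum: "\<lbrakk>(x, y) \<in> induced R G M; (x', y') \<in> induced R G M\<rbrakk> \<Longrightarrow>
      (x \<oplus>\<^bsub>M\<^esub> x', y \<oplus>\<^bsub>M\<^esub> y') \<in> induced R G M"

lemma induced_closed:
  assumes "module R M" "graph_mod R I G" "(x, y) \<in> induced R G M"
  shows "x \<in> carrier M" "y \<in> carrier M"
proof -
  interpret M: module R M by fact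
  have "x \<in> carrier M \<and> y \<in> carrier M" using assms(3)
    by induction (use assms(2) in \<open>auto simp: graph_mod_def\<close>)
  then show "x \<in> carrier M" "y \<in> carrier M" by auto
qed

lemma induced_lin:
  assumes "module R M" "graph_mod R I G" "lin_map R M N f" "(x, y) \<in> induced R G M"
  shows "(f x, f y) \<in> induced R G N"
  using assms(4)
proof induction
  case (prod a b x)
  then have "a \<in> carrier R" "b \<in> carrier R" using assms(2) by (auto simp: graph_mod_def)
  then show ?case
    using induced.prod[OF prod(1) lin_closed[OF assms(3) prod(2)], where R = R] prod
    by (simp add: lin_smult[OF assms(3)])
next
  case (sum x y x' y')
  then show ?case
    using induced.sum[OF sum(3,4)] induced_closed[OF assms(1,2)]
    by (metis lin_add[OF assms(3)])
qed

lemma ideal_smult_closed: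
  assumes "module R M" "I \<subseteq> carrier R" "x \<in> ideal_smult R I M"
  shows "x \<in> carrier M"
proof -
  interpret M: module R M by fact
  show ?thesis using assms(3) by induction (use assms(2) in auto)
qed

lemma ideal_smult_lin:
  assumes "module R M" "I \<subseteq> carrier R" "lin_map R M N f" "x \<in> ideal_smult R I M"
  shows "f x \<in> ideal_smult R I N"
  using assms(4)
proof induction
  case (prod a x)
  then have "a \<in> carrier R" using assms(2) by auto
  then show ?case
    using ideal_smult.prod[OF prod(1) lin_closed[OF assms(3) prod(2)], where R = R] prod
    by (simp add: lin_smult[OF assms(3)])
next
  case (sum x y)
  then show ?case
    using ideal_smult.sum[OF sum(3,4)] ideal_smult_closed[OF assms(1,2)]
    by (metis lin_add[OF assms(3)])
qed

lemma ideal_smult_zero: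
  assumes "module R M" "ideal I R"
  shows "\<zero>\<^bsub>M\<^esub> \<in> ideal_smult R I M"
proof -
  interpret M: module R M by fact
  interpret ideal I R by fact
  show ?thesis using ideal_smult.prod[of "\<zero>\<^bsub>R\<^esub>" I "\<zero>\<^bsub>M\<^esub>" M R] by simp
qed

lemma ideal_smult_neg:
  assumes "module R M" "ideal I R" "x \<in> ideal_smult R I M"
  shows "\<ominus>\<^bsub>M\<^esub> x \<in> ideal_smult R I M"
proof -
  interpret M: module R M by fact
  interpret ideal I R by fact
  show ?thesis
    by (rule ideal_smult_lin[OF assms(1) a_subset lin_uminus[OF assms(1) lin_id] assms(3)])
qed

lemma induced_total:
  assumes "graph_mod R I G" "x \<in> ideal_smult R I M"
  shows "\<exists>y. (x, y) \<in> induced R G M"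
  using assms(2)
proof induction
  case (prod a x)
  then obtain b where "(a, b) \<in> G" using assms(1) by (auto simp: graph_mod_def)
  then show ?case using induced.prod prod(2) by metis
next
  case (sum x y)
  then show ?case using induced.sum by metis
qed

text \<open>Says that the relation induced by a graph is single valued modulo I M. Flat modules have
  this property, because I \<otimes> M \<rightarrow> I M is then injective and a map I \<rightarrow>
  R/I can be tensored with M.\<close>

definition graph_flat :: "('r, 'x) ring_scheme \<Rightarrow> 'r set \<Rightarrow> ('r, 'a) module \<Rightarrow> bool" where
  "graph_flat R I M \<longleftrightarrow>
     (\<forall>G p. graph_mod R I G \<longrightarrow> (\<zero>\<^bsub>M\<^esub>, p) \<in> induced R G M \<longrightarrow> p \<in> ideal_smult R I M)"

text \<open>\<open>U\<close> fixes the modules against which \<open>Q\<close> is projective. It will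
  be the type of \<open>'u \<times> 'u\<close>, where cones of maps between complexes over
  \<open>'u\<close> live.\<close>

definition test_complex :: "'m itself \<Rightarrow> ('r, 'x) ring_scheme \<Rightarrow> 'r set \<Rightarrow> ('r, 'a) cpx \<Rightarrow> bool" where
  "test_complex U R I Q \<longleftrightarrow> bounded_projective U R Q \<and> (\<forall>i. graph_flat R I (grade Q i))"

text \<open>In other words, the image of \<open>z\<close> in Q/IQ is a boundary.\<close>

definition dies :: "('r, 'x) ring_scheme \<Rightarrow> 'r set \<Rightarrow> ('r, 'a) cpx \<Rightarrow> int \<Rightarrow> 'a \<Rightarrow> bool" where
  "dies R I Q i z \<longleftrightarrow> (\<exists>y \<in> carrier (grade Q (i + 1)). \<exists>e \<in> ideal_smult R I (grade Q i).
     z = bdry Q (i + 1) y \<oplus>\<^bsub>grade Q i\<^esub> e)"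

text \<open>Vanishing of the class of \<open>z\<close> in the colimit of H(Q'/IQ') over all maps
  from test complexes \<open>Q'\<close> to \<open>M\<close>, a substitute for Tor with values in
  \<open>M\<close> that needs no resolution of \<open>M\<close>.\<close>

definition killed ::
  "('r, 'x) ring_scheme \<Rightarrow> 'r set \<Rightarrow> ('r, nat \<Rightarrow> 'r) cpx \<Rightarrow> ('r, 'u) cpx \<Rightarrow>
    (int \<Rightarrow> (nat \<Rightarrow> 'r) \<Rightarrow> 'u) \<Rightarrow> int \<Rightarrow> (nat \<Rightarrow> 'r) \<Rightarrow> bool" where
  "killed R I Q M g d z \<longleftrightarrow>
     (\<exists>(Q' :: ('r, nat \<Rightarrow> 'r) cpx) q g'. test_complex TYPE('u \<times> 'u) R I Q' \<and> chain_map R Q Q' q \<and>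
        chain_map R Q' M g' \<and> homotopic R Q M (\<lambda>i. g' i \<circ> q i) g \<and> dies R I Q' d (q d z))"

text \<open>Every n-fold composite of maps \<chi> ends in zero. Here \<open>z i\<close> is a value
  at \<open>z (i + 1)\<close> of the map \<chi> that belongs to \<open>G i\<close>, so
  \<open>z (d + int n)\<close> is the starting element and \<open>z d\<close> the result; the graphs
  may differ from degree to degree. Only the start needs a membership condition, since
  \<open>induced\<close> puts the other \<open>z i\<close> in their modules.\<close>

definition kills :: "('r, 'x) ring_scheme \<Rightarrow> 'r set \<Rightarrow> nat \<Rightarrow> ('r, 'u) cpx \<Rightarrow> bool" where
  "kills R I n M \<longleftrightarrow> (\<forall>(Q :: ('r, nat \<Rightarrow> 'r) cpx) g d z G.
     test_complex TYPE('u \<times> 'u) R I Q \<and> chain_map R Q M g \<and>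
     z (d + int n) \<in> carrier (grade Q (d + int n)) \<and>
     (\<forall>i. d \<le> i \<and> i < d + int n \<longrightarrow> graph_mod R I (G i) \<and>
        (bdry Q (i + 1) (z (i + 1)), z i) \<in> induced R (G i) (grade Q i)) \<longrightarrow>
     killed R I Q M g d (z d))"

lemma killsD:
  fixes M :: "('r, 'u) cpx" and Q :: "('r, nat \<Rightarrow> 'r) cpx"
  assumes "kills R I n M" "test_complex TYPE('u \<times> 'u) R I Q" "chain_map R Q M g"
    "z (d + int n) \<in> carrier (grade Q (d + int n))"
    "\<And>i. d \<le> i \<Longrightarrow> i < d + int n \<Longrightarrow> graph_mod R I (G i)"
    "\<And>i. d \<le> i \<Longrightarrow> i < d + int n \<Longrightarrow> (bdry Q (i + 1) (z (i + 1)), z i) \<in> induced R (G i) (grade Q i)"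
  obtains Q' :: "('r, nat \<Rightarrow> 'r) cpx" and q g' where "test_complex TYPE('u \<times> 'u) R I Q'"
    "chain_map R Q Q' q" "chain_map R Q' M g'" "homotopic R Q M (\<lambda>i. g' i \<circ> q i) g"
    "dies R I Q' d (q d (z d))"
proof -
  have "killed R I Q M g d (z d)"
    by (rule assms(1)[unfolded kills_def, rule_format, of Q g z d G]) (use assms(2-) in blast)
  then show ?thesis using that unfolding killed_def by blast
qed

lemma test_complexD:
  assumes "test_complex U R I Q"
  shows "bounded_projective U R Q" "chain_complex R Q"
  using assms by (auto simp: test_complex_def bounded_projective_def)

text \<open>Test \<open>E\<close> with \<iota> g, and compose the resulting factorization with
  \<pi>.\<close>

lemma kills_retract:
  fixes M E :: "('r, 'u) cpx"
  assumes E: "kills R I n E" and Mc: "chain_complex R M" and Ec: "chain_complex R E"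
    and i: "chain_map R M E \<iota>" and p: "chain_map R E M \<pi>"
    and pi_iota: "\<And>i x. x \<in> carrier (grade M i) \<Longrightarrow> \<pi> i (\<iota> i x) = x"
  shows "kills R I n M"
  unfolding kills_def
proof (intro allI impI, elim conjE)
  fix Q :: "('r, nat \<Rightarrow> 'r) cpx" and g d z G
  assume Q: "test_complex TYPE('u \<times> 'u) R I Q" and g: "chain_map R Q M g"
    and z: "z (d + int n) \<in> carrier (grade Q (d + int n))"
    and G: "\<forall>i. d \<le> i \<and> i < d + int n \<longrightarrow> graph_mod R I (G i) \<and>
        (bdry Q (i + 1) (z (i + 1)), z i) \<in> induced R (G i) (grade Q i)"
  note Qc = test_complexD(2)[OF Q]
  obtain Q' :: "('r, nat \<Rightarrow> 'r) cpx" and q h where Q': "test_complex TYPE('u \<times> 'u) R I Q'"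
    "chain_map R Q Q' q" "chain_map R Q' E h" "homotopic R Q E (\<lambda>j. h j \<circ> q j) (\<lambda>j. \<iota> j \<circ> g j)"
    "dies R I Q' d (q d (z d))"
    by (rule killsD[OF E Q cmap_comp[OF g i], where z = z and d = d and G = G]) (use z G in auto)
  note ph = cmap_comp[OF Q'(3) p]
  have "homotopic R Q M (\<lambda>j. (\<pi> j \<circ> h j) \<circ> q j) (\<lambda>j. \<pi> j \<circ> (\<iota> j \<circ> g j))"
    using homotopic_comp_left[OF Qc Ec cmap_lin[OF cmap_comp[OF g i]] p Q'(4)] by (simp add:
        comp_assoc)
  moreover have "homotopic R Q M (\<lambda>j. \<pi> j \<circ> (\<iota> j \<circ> g j)) g"
    by (rule homotopic_refl[OF Mc cmap_lin[OF cmap_comp[OF cmap_comp[OF g i] p]]])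
      (simp add: pi_iota lin_closed[OF cmap_lin[OF g]])
  ultimately have "homotopic R Q M (\<lambda>j. (\<pi> j \<circ> h j) \<circ> q j) g"
    by (rule homotopic_trans[OF Qc Mc cmap_lin[OF g]])
  then show "killed R I Q M g d (z d)"
    unfolding killed_def using Q'(1,2,5) ph by blast
qed

text \<open>A test map into \<open>Y\<close> is carried to \<open>X\<close> by the inverse morphism,
  factored there, and the second factor is carried forward to \<open>Y\<close>. Uniqueness up to
  homotopy identifies the composite with the given map, which the round trip has returned.\<close>

lemma kills_D_iso:
  fixes X Y :: "('r, 'u) cpx"
  assumes X: "kills R I n X" and iso: "D_iso R X Y \<rho>"
  shows "kills R I n Y"
  unfolding kills_def
proof (intro allI impI, elim conjE)
  fix Q :: "('r, nat \<Rightarrow> 'r) cpx" and g d z G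
  assume Q: "test_complex TYPE('u \<times> 'u) R I Q" and g: "chain_map R Q Y g"
    and z: "z (d + int n) \<in> carrier (grade Q (d + int n))"
    and G: "\<forall>i. d \<le> i \<and> i < d + int n \<longrightarrow> graph_mod R I (G i) \<and>
        (bdry Q (i + 1) (z (i + 1)), z i) \<in> induced R (G i) (grade Q i)"
  note Qc = test_complexD(2)[OF Q] and Qp = test_complexD(1)[OF Q]
  obtain \<sigma> where \<sigma>: "D_comp R X Y X \<rho> \<sigma> (D_id X)" "D_comp R Y X Y \<sigma> \<rho> (D_id Y)"
    using iso by (auto simp: D_iso_def)
  have \<rho>: "D_hom R X Y \<rho>" using \<sigma> by (auto simp: D_comp_def)
  obtain g1 where g1: "chain_map R Q X g1" "carries R Q Y X \<sigma> g g1" "carries R Q X Y \<rho> g1 g"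
    using carries_back_and_forth[OF Qp \<sigma>(2) g] by blast
  obtain Q' :: "('r, nat \<Rightarrow> 'r) cpx" and q h where Q': "test_complex TYPE('u \<times> 'u) R I Q'"
    "chain_map R Q Q' q" "chain_map R Q' X h" "homotopic R Q X (\<lambda>j. h j \<circ> q j) g1"
    "dies R I Q' d (q d (z d))"
    by (rule killsD[OF X Q g1(1), where z = z and d = d and G = G]) (use z G in auto)
  obtain g' where g': "chain_map R Q' Y g'" "carries R Q' X Y \<rho> h g'"
    using carries_exists[OF test_complexD(1)[OF Q'(1)] \<rho> Q'(3)] by blast
  have "homotopic R Q Y (\<lambda>i. g' i \<circ> q i) g"
    by (rule carries_unique[OF Qp \<rho> carries_precomp[OF Q'(2) g'(2)] g1(3,1)
          cmap_comp[OF Q'(2) g'(1)] g Q'(4)])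
  then show "killed R I Q Y g d (z d)"
    unfolding killed_def using Q'(1,2,5) g'(1) by blast
qed

lemma D_iso_sym: "D_iso R X Y \<rho> \<Longrightarrow> \<exists>\<sigma>. D_iso R Y X \<sigma>"
  by (auto simp: D_iso_def)

lemma chain_iso_inverse:
  assumes "chain_iso R X Y f"
  shows "chain_iso R Y X (\<lambda>i. inv_into (carrier (grade X i)) (f i))"
proof -
  have X: "chain_complex R X" and Y: "chain_complex R Y" and f: "chain_map R X Y f"
    and b: "\<And>i. bij_betw (f i) (carrier (grade X i)) (carrier (grade Y i))"
    using assms by (auto simp: chain_iso_def)
  let ?g = "\<lambda>i. inv_into (carrier (grade X i)) (f i)"
  have bg: "bij_betw (?g i) (carrier (grade Y i)) (carrier (grade X i))" for i
    by (rule bij_betw_inv_into[OF b])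
  have gc: "?g i y \<in> carrier (grade X i)" if "y \<in> carrier (grade Y i)" for i y
    using bij_betwE[OF bg] that by blast
  have fg: "f i (?g i y) = y" if "y \<in> carrier (grade Y i)" for i y
    by (rule bij_betw_inv_into_right[OF b that])
  have gf: "?g i x = y" if "y \<in> carrier (grade X i)" "f i y = x" for i x y
    using bij_betw_inv_into_left[OF b that(1)] that(2) by simp
  have l: "lin_map R (grade Y i) (grade X i) (?g i)" for i
  proof (rule lin_mapI)
    interpret Xi: module R "grade X i" by (rule cpx_module[OF X])
    fix x y assume xy: "x \<in> carrier (grade Y i)" "y \<in> carrier (grade Y i)"
    show "?g i (x \<oplus>\<^bsub>grade Y i\<^esub> y) = ?g i x \<oplus>\<^bsub>grade X i\<^esub> ?g i y"
      by (rule gf) (use gc xy in \<open>simp_all add: lin_add[OF cmap_lin[OF f]] fg\<close>)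
  next
    interpret Xi: module R "grade X i" by (rule cpx_module[OF X])
    fix r x assume xy: "r \<in> carrier R" "x \<in> carrier (grade Y i)"
    show "?g i (r \<odot>\<^bsub>grade Y i\<^esub> x) = r \<odot>\<^bsub>grade X i\<^esub> ?g i x"
      by (rule gf) (use gc xy in \<open>simp_all add: lin_smult[OF cmap_lin[OF f]] fg\<close>)
  qed (rule gc)
  have "?g (i - 1) (bdry Y i x) = bdry X i (?g i x)" if x: "x \<in> carrier (grade Y i)" for i x
  proof (rule gf)
    show "bdry X i (?g i x) \<in> carrier (grade X (i - 1))" by (rule lin_closed[OF cpx_lin[OF X] gc[OF
        x]])
    show "f (i - 1) (bdry X i (?g i x)) = bdry Y i x" by (simp add: cmap_bdry[OF f gc[OF x]] fg[OF
        x])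
  qed
  with l X Y bg show ?thesis by (auto simp: chain_iso_def chain_map_def)
qed

lemma dsum_retract:
  assumes iso: "chain_iso R E (dsum L M) \<theta>" and L: "chain_complex R L" and M: "chain_complex R M"
  shows "\<exists>\<iota> \<pi>. chain_map R M E \<iota> \<and> chain_map R E M \<pi> \<and> (\<forall>i. \<forall>x\<in>carrier (grade M i). \<pi> i (\<iota> i x) =
      x)"
    "\<exists>\<iota> \<pi>. chain_map R L E \<iota> \<and> chain_map R E L \<pi> \<and> (\<forall>i. \<forall>x\<in>carrier (grade L i). \<pi> i (\<iota> i x) = x)"
proof -
  have f: "chain_map R E (dsum L M) \<theta>"
    and b: "\<And>i. bij_betw (\<theta> i) (carrier (grade E i)) (carrier (grade (dsum L M) i))"
    using iso by (auto simp: chain_iso_def)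
  let ?g = "\<lambda>i. inv_into (carrier (grade E i)) (\<theta> i)"
  have g: "chain_map R (dsum L M) E ?g" using chain_iso_inverse[OF iso] by (simp add: chain_iso_def)
  have fg: "\<theta> i (?g i y) = y" if "y \<in> carrier (grade (dsum L M) i)" for i y
    by (rule bij_betw_inv_into_right[OF b that])
  have 1: "chain_map R M (dsum L M) (\<lambda>i x. (\<zero>\<^bsub>grade L i\<^esub>, x))"
    "chain_map R (dsum L M) M (\<lambda>i. snd)"
    "chain_map R L (dsum L M) (\<lambda>i x. (x, \<zero>\<^bsub>grade M i\<^esub>))"
    "chain_map R (dsum L M) L (\<lambda>i. fst)"
  proof -
    interpret Li: module R "grade L i" for i by (rule cpx_module[OF L])
    interpret Mi: module R "grade M i" for i by (rule cpx_module[OF M])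
    show "chain_map R M (dsum L M) (\<lambda>i x. (\<zero>\<^bsub>grade L i\<^esub>, x))"
      by (auto simp: chain_map_def dsum_def dsum_module_def lin_map_def
          lin_zero[OF cpx_module[OF L] cpx_module[OF L] cpx_lin[OF L]])
    show "chain_map R L (dsum L M) (\<lambda>i x. (x, \<zero>\<^bsub>grade M i\<^esub>))"
      by (auto simp: chain_map_def dsum_def dsum_module_def lin_map_def
          lin_zero[OF cpx_module[OF M] cpx_module[OF M] cpx_lin[OF M]])
    show "chain_map R (dsum L M) M (\<lambda>i. snd)" "chain_map R (dsum L M) L (\<lambda>i. fst)"
      by (auto simp: chain_map_def dsum_def dsum_module_def lin_map_def)
  qed
  show "\<exists>\<iota> \<pi>. chain_map R M E \<iota> \<and> chain_map R E M \<pi> \<and> (\<forall>i. \<forall>x\<in>carrier (grade M i). \<pi> i (\<iota> i x) = x)"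
  proof (intro exI conjI allI ballI)
    show "chain_map R M E (\<lambda>i. ?g i \<circ> (\<lambda>x. (\<zero>\<^bsub>grade L i\<^esub>, x)))" by (rule cmap_comp[OF 1(1) g])
    show "chain_map R E M (\<lambda>i. snd \<circ> \<theta> i)" by (rule cmap_comp[OF f 1(2)])
    show "(snd \<circ> \<theta> i) ((?g i \<circ> (\<lambda>x. (\<zero>\<^bsub>grade L i\<^esub>, x))) x) = x" if "x \<in> carrier (grade M i)" for i x
      using fg[OF lin_closed[OF cmap_lin[OF 1(1)] that]] by simp
  qed
  show "\<exists>\<iota> \<pi>. chain_map R L E \<iota> \<and> chain_map R E L \<pi> \<and> (\<forall>i. \<forall>x\<in>carrier (grade L i). \<pi> i (\<iota> i x) = x)"
  proof (intro exI conjI allI ballI)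
    show "chain_map R L E (\<lambda>i. ?g i \<circ> (\<lambda>x. (x, \<zero>\<^bsub>grade M i\<^esub>)))" by (rule cmap_comp[OF 1(3) g])
    show "chain_map R E L (\<lambda>i. fst \<circ> \<theta> i)" by (rule cmap_comp[OF f 1(4)])
    show "(fst \<circ> \<theta> i) ((?g i \<circ> (\<lambda>x. (x, \<zero>\<^bsub>grade M i\<^esub>))) x) = x" if "x \<in> carrier (grade L i)" for i x
      using fg[OF lin_closed[OF cmap_lin[OF 1(3)] that]] by simp
  qed
qed

lemma test_complexI:
  assumes "chain_complex R Q" "\<And>i. i < b \<Longrightarrow> carrier (grade Q i) = {\<zero>\<^bsub>grade Q i\<^esub>}"
    "\<And>i. projective U R (grade Q i)" "\<And>i. graph_flat R I (grade Q i)"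
  shows "test_complex U R I Q"
  using assms by (auto simp: test_complex_def bounded_projective_def)

section \<open>Finite free complexes\<close>

lemma free_module_module:
  fixes R :: "('r, 'x) ring_scheme" (structure)
  assumes "cring R" shows "module R (free_module R B)"
proof -
  interpret cring R by fact
  show ?thesis
  proof (rule moduleI)
    show "abelian_group (free_module R B)"
    proof (rule abelian_groupI)
      fix x assume x: "x \<in> carrier (free_module R B)"
      then show "\<exists>y\<in>carrier (free_module R B). y \<oplus>\<^bsub>free_module R B\<^esub> x = \<zero>\<^bsub>free_module R B\<^esub>"
        by (intro bexI[of _ "\<lambda>b. if b \<in> B then \<ominus> (x b) else \<zero>"])
          (auto simp: free_module_def l_neg fun_eq_iff)
      show "\<zero>\<^bsub>free_module R B\<^esub> \<oplus>\<^bsub>free_module R B\<^esub> x = x"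
      proof -
        have "\<zero> \<oplus> x b = x b" for b using x by (cases "b \<in> B") (auto simp: free_module_def)
        then show ?thesis by (simp add: free_module_def)
      qed
    next
      fix x y assume xy: "x \<in> carrier (free_module R B)" "y \<in> carrier (free_module R B)"
      have "x b \<oplus> y b = y b \<oplus> x b" for b
        using xy by (cases "b \<in> B") (auto simp: free_module_def a_comm)
      then show "x \<oplus>\<^bsub>free_module R B\<^esub> y = y \<oplus>\<^bsub>free_module R B\<^esub> x"
        by (simp add: free_module_def)
      fix z assume z: "z \<in> carrier (free_module R B)"
      have "x b \<oplus> y b \<oplus> z b = x b \<oplus> (y b \<oplus> z b)" for b
        using xy z by (cases "b \<in> B") (auto simp: free_module_def a_assoc)
      then show "x \<oplus>\<^bsub>free_module R B\<^esub> y \<oplus>\<^bsub>free_module R B\<^esub> z =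
          x \<oplus>\<^bsub>free_module R B\<^esub> (y \<oplus>\<^bsub>free_module R B\<^esub> z)"
        by (simp add: free_module_def)
    qed (auto simp: free_module_def)
  next
    fix a x assume ax: "a \<in> carrier R" "x \<in> carrier (free_module R B)"
    have xb: "x b \<in> carrier R" for b using ax by (cases "b \<in> B") (auto simp: free_module_def)
    fix b assume b: "b \<in> carrier R"
    show "(a \<oplus> b) \<odot>\<^bsub>free_module R B\<^esub> x = a \<odot>\<^bsub>free_module R B\<^esub> x \<oplus>\<^bsub>free_module R B\<^esub> b \<odot>\<^bsub>free_module R B\<^esub> x"
      using xb ax b by (simp add: free_module_def l_distr)
    show "(a \<otimes> b) \<odot>\<^bsub>free_module R B\<^esub> x = a \<odot>\<^bsub>free_module R B\<^esub> (b \<odot>\<^bsub>free_module R B\<^esub> x)"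
      using xb ax b by (simp add: free_module_def m_assoc)
  next
    fix a x y assume ax: "a \<in> carrier R" "x \<in> carrier (free_module R B)" "y \<in> carrier (free_module R
        B)"
    have xb: "x b \<in> carrier R" "y b \<in> carrier R" for b
      using ax by (cases "b \<in> B", auto simp: free_module_def)+
    show "a \<odot>\<^bsub>free_module R B\<^esub> (x \<oplus>\<^bsub>free_module R B\<^esub> y) =
       a \<odot>\<^bsub>free_module R B\<^esub> x \<oplus>\<^bsub>free_module R B\<^esub> a \<odot>\<^bsub>free_module R B\<^esub> y"
      using xb ax by (simp add: free_module_def r_distr)
  next
    fix x assume x: "x \<in> carrier (free_module R B)"
    have "\<one> \<otimes> x b = x b" for b using x by (cases "b \<in> B") (auto simp: free_module_def)
    then show "\<one> \<odot>\<^bsub>free_module R B\<^esub> x = x" by (simp add: free_module_def)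
  next
    show "a \<odot>\<^bsub>free_module R B\<^esub> x \<in> carrier (free_module R B)"
      if "a \<in> carrier R" "x \<in> carrier (free_module R B)" for a x
      using that by (simp add: free_module_def)
  qed (rule is_cring)
qed

lemma free_module_coordinate:
  "cring R \<Longrightarrow> c \<in> carrier (free_module R B) \<Longrightarrow> c b \<in> carrier R"
  by (cases "b \<in> B") (auto simp: free_module_def cring_def ring.ring_simprules(2))

text \<open>Induction over the truncations of the fixed vector \<open>c\<close>, one coordinate at a
  time, so that \<open>P\<close> is needed for no other vectors.\<close>

lemma free_module_induct:
  assumes "cring R" "finite B" and c: "c \<in> carrier (free_module R B)"
    and zero: "P (\<lambda>_. \<zero>\<^bsub>R\<^esub>)"
    and step: "\<And>b S. b \<in> B \<Longrightarrow> S \<subseteq> B \<Longrightarrow> b \<notin> S \<Longrightarrow> P (\<lambda>k. if k \<in> S then c k else \<zero>\<^bsub>R\<^esub>) \<Longrightarrow>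
      P (\<lambda>k. (c b \<otimes>\<^bsub>R\<^esub> (if k = b then \<one>\<^bsub>R\<^esub> else \<zero>\<^bsub>R\<^esub>)) \<oplus>\<^bsub>R\<^esub> (if k \<in> S then c k else \<zero>\<^bsub>R\<^esub>))"
  shows "P c"
proof -
  interpret cring R by fact
  have cb: "c b \<in> carrier R" for b by (rule free_module_coordinate[OF assms(1) c])
  have "P (\<lambda>k. if k \<in> S then c k else \<zero>\<^bsub>R\<^esub>)" if "finite S" "S \<subseteq> B" for S
    using that
  proof induction
    case (insert b S)
    have "(\<lambda>k. (c b \<otimes>\<^bsub>R\<^esub> (if k = b then \<one>\<^bsub>R\<^esub> else \<zero>\<^bsub>R\<^esub>)) \<oplus>\<^bsub>R\<^esub> (if k \<in> S then c k else \<zero>\<^bsub>R\<^esub>)) =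
        (\<lambda>k. if k \<in> insert b S then c k else \<zero>\<^bsub>R\<^esub>)"
      using insert.hyps cb by (auto simp: fun_eq_iff)
    with step[of b S] insert show ?case by simp
  qed (use zero in simp)
  from this[OF assms(2) subset_refl] have "P (\<lambda>k. if k \<in> B then c k else \<zero>\<^bsub>R\<^esub>)" .
  moreover have "(\<lambda>k. if k \<in> B then c k else \<zero>\<^bsub>R\<^esub>) = c"
    using c by (auto simp: free_module_def)
  ultimately show ?thesis by simp
qed

lemma unit_vector_closed:
  "cring R \<Longrightarrow> b \<in> B \<Longrightarrow> (\<lambda>k. if k = b then \<one>\<^bsub>R\<^esub> else \<zero>\<^bsub>R\<^esub>) \<in> carrier (free_module R B)"
  by (auto simp: free_module_def cring_def ring.ring_simprules)

text \<open>Choose a partner \<open>m b\<close> for every unit vector and extend linearly. As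
  \<Gamma> is closed under sums and multiples, the extension stays in \<Gamma>; this is checked on
  truncations of \<open>c\<close>.\<close>

lemma free_module_projective:
  fixes R :: "('r, 'x) ring_scheme" and B :: "'b set"
  assumes R: "cring R" and B: "finite B"
  shows "projective (U :: 'm itself) R (free_module R B)"
  unfolding projective_def
proof (intro allI impI, elim conjE)
  fix M :: "('r, 'm) module" and \<Gamma>
  assume M: "module R M" and \<Gamma>: "\<Gamma> \<subseteq> carrier (free_module R B) \<times> carrier M"
    and add: "\<forall>x y x' y'. (x, y) \<in> \<Gamma> \<longrightarrow> (x', y') \<in> \<Gamma> \<longrightarrow> (x \<oplus>\<^bsub>free_module R B\<^esub> x', y \<oplus>\<^bsub>M\<^esub> y') \<in> \<Gamma>"
    and smult: "\<forall>r x y. r \<in> carrier R \<longrightarrow> (x, y) \<in> \<Gamma> \<longrightarrow> (r \<odot>\<^bsub>free_module R B\<^esub> x, r \<odot>\<^bsub>M\<^esub> y) \<in> \<Gamma>"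
    and total: "\<forall>x\<in>carrier (free_module R B). \<exists>y. (x, y) \<in> \<Gamma>"
  interpret M: module R M by fact
  interpret F: module R "free_module R B" by (rule free_module_module[OF R])
  define e where "e b = (\<lambda>k :: 'b. if k = b then \<one>\<^bsub>R\<^esub> else \<zero>\<^bsub>R\<^esub>)" for b
  have "\<exists>y. (e b, y) \<in> \<Gamma>" if "b \<in> B" for b
    using total[rule_format, OF unit_vector_closed[OF R that]] by (simp add: e_def)
  then obtain m where m: "\<And>b. b \<in> B \<Longrightarrow> (e b, m b) \<in> \<Gamma>"
    using bchoice[of B "\<lambda>b y. (e b, y) \<in> \<Gamma>"] by auto
  then have mc: "b \<in> B \<Longrightarrow> m b \<in> carrier M" for b using \<Gamma> by blast
  define f where "f S c = (\<Oplus>\<^bsub>M\<^esub>b\<in>S. c b \<odot>\<^bsub>M\<^esub> m b)" for S c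
  have co: "b \<in> B \<Longrightarrow> c \<in> carrier (free_module R B) \<Longrightarrow> c b \<in> carrier R" for b c
    using free_module_coordinate[OF R] .
  have fM: "f S c \<in> carrier M" if "S \<subseteq> B" "c \<in> carrier (free_module R B)" for S c
    unfolding f_def by (rule M.M.finsum_closed) (use that(1) mc co[OF _ that(2)] in auto)
  have lin: "lin_map R (free_module R B) M (f B)"
  proof (rule lin_mapI)
    fix c d assume cd: "c \<in> carrier (free_module R B)" "d \<in> carrier (free_module R B)"
    have "f B (c \<oplus>\<^bsub>free_module R B\<^esub> d) = (\<Oplus>\<^bsub>M\<^esub>b\<in>B. c b \<odot>\<^bsub>M\<^esub> m b \<oplus>\<^bsub>M\<^esub> d b \<odot>\<^bsub>M\<^esub> m b)"
      unfolding f_def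
    proof (rule M.M.finsum_cong'[OF refl])
      show "(\<lambda>b. c b \<odot>\<^bsub>M\<^esub> m b \<oplus>\<^bsub>M\<^esub> d b \<odot>\<^bsub>M\<^esub> m b) \<in> B \<rightarrow> carrier M"
        using mc co[OF _ cd(1)] co[OF _ cd(2)] by simp
      show "(c \<oplus>\<^bsub>free_module R B\<^esub> d) b \<odot>\<^bsub>M\<^esub> m b = c b \<odot>\<^bsub>M\<^esub> m b \<oplus>\<^bsub>M\<^esub> d b \<odot>\<^bsub>M\<^esub> m b" if "b \<in> B" for b
        using M.smult_l_distr[OF co[OF that cd(1)] co[OF that cd(2)] mc[OF that]]
        by (simp add: free_module_def)
    qed
    also have "\<dots> = f B c \<oplus>\<^bsub>M\<^esub> f B d"
      unfolding f_def by (rule M.M.finsum_addf) (use cd mc co[OF _ cd(1)] co[OF _ cd(2)] in auto)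
    finally show "f B (c \<oplus>\<^bsub>free_module R B\<^esub> d) = f B c \<oplus>\<^bsub>M\<^esub> f B d" .
  next
    fix r c assume cd: "r \<in> carrier R" "c \<in> carrier (free_module R B)"
    have "f B (r \<odot>\<^bsub>free_module R B\<^esub> c) = (\<Oplus>\<^bsub>M\<^esub>b\<in>B. r \<odot>\<^bsub>M\<^esub> (c b \<odot>\<^bsub>M\<^esub> m b))"
      unfolding f_def
    proof (rule M.M.finsum_cong'[OF refl])
      show "(\<lambda>b. r \<odot>\<^bsub>M\<^esub> (c b \<odot>\<^bsub>M\<^esub> m b)) \<in> B \<rightarrow> carrier M"
        using mc cd(1) co[OF _ cd(2)] by simp
      show "(r \<odot>\<^bsub>free_module R B\<^esub> c) b \<odot>\<^bsub>M\<^esub> m b = r \<odot>\<^bsub>M\<^esub> (c b \<odot>\<^bsub>M\<^esub> m b)" if "b \<in> B" for b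
        using M.smult_assoc1[OF cd(1) co[OF that cd(2)] mc[OF that]] by (simp add: free_module_def)
    qed
    also have "\<dots> = r \<odot>\<^bsub>M\<^esub> f B c"
      unfolding f_def by (rule M.finsum_smult_ldistr[symmetric]) (use B cd mc co[OF _ cd(2)] in
          auto)
    finally show "f B (r \<odot>\<^bsub>free_module R B\<^esub> c) = r \<odot>\<^bsub>M\<^esub> f B c" .
  next
    show "f B c \<in> carrier M" if "c \<in> carrier (free_module R B)" for c
      by (rule fM[OF subset_refl that])
  qed
  \<comment> \<open>Closure under zero is not among the conditions on \<Gamma>; it comes from
    scaling some pair by the zero of the ring.\<close>
  have z: "(\<zero>\<^bsub>free_module R B\<^esub>, \<zero>\<^bsub>M\<^esub>) \<in> \<Gamma>"
  proof -
    obtain y where y: "(\<zero>\<^bsub>free_module R B\<^esub>, y) \<in> \<Gamma>" using total F.zero_closed by blast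
    then have "y \<in> carrier M" using \<Gamma> by blast
    then show ?thesis using smult[rule_format, OF M.R.zero_closed y] F.zero_closed by simp
  qed
  have "(c, f B c) \<in> \<Gamma>" if c: "c \<in> carrier (free_module R B)" for c
  proof -
    have "((\<lambda>k. if k \<in> S then c k else \<zero>\<^bsub>R\<^esub>), f S c) \<in> \<Gamma>" if "finite S" "S \<subseteq> B" for S
      using that
    proof induction
      case empty
      then show ?case using z by (simp add: f_def free_module_def)
    next
      case (insert b S)
      have "f (insert b S) c = c b \<odot>\<^bsub>M\<^esub> m b \<oplus>\<^bsub>M\<^esub> f S c"
        unfolding f_def by (rule M.M.finsum_insert) (use insert mc co[OF _ c] in auto)
      moreover have "(c b \<odot>\<^bsub>free_module R B\<^esub> e b) \<oplus>\<^bsub>free_module R B\<^esub> (\<lambda>k. if k \<in> S then c k else \<zero>\<^bsub>R\<^esub>) =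
          (\<lambda>k. if k \<in> insert b S then c k else \<zero>\<^bsub>R\<^esub>)"
        using insert.hyps free_module_coordinate[OF R c]
        by (auto simp: free_module_def e_def fun_eq_iff)
      moreover have 1: "(c b \<odot>\<^bsub>free_module R B\<^esub> e b, c b \<odot>\<^bsub>M\<^esub> m b) \<in> \<Gamma>"
        using smult[rule_format, OF free_module_coordinate[OF R c] m] insert.prems by simp
      moreover have 2: "((\<lambda>k. if k \<in> S then c k else \<zero>\<^bsub>R\<^esub>), f S c) \<in> \<Gamma>" using insert by simp
      ultimately show ?case using add[rule_format, OF 1 2] by simp
    qed
    from this[OF B subset_refl] have "((\<lambda>k. if k \<in> B then c k else \<zero>\<^bsub>R\<^esub>), f B c) \<in> \<Gamma>" .
    moreover have "(\<lambda>k. if k \<in> B then c k else \<zero>\<^bsub>R\<^esub>) = c" using c by (auto simp: free_module_def)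
    ultimately show ?thesis by simp
  qed
  then show "\<exists>f. lin_map R (free_module R B) M f \<and> (\<forall>x\<in>carrier (free_module R B). (x, f x) \<in> \<Gamma>)"
    using lin by blast
qed

lemma free_module_ideal_smult_iff:
  assumes R: "cring R" and I: "ideal I R" and B: "finite B" and c: "c \<in> carrier (free_module R B)"
  shows "c \<in> ideal_smult R I (free_module R B) \<longleftrightarrow> (\<forall>b \<in> B. c b \<in> I)"
proof
  interpret ideal I R by fact
  assume "c \<in> ideal_smult R I (free_module R B)"
  then have "\<forall>b \<in> B. c b \<in> I"
  proof induction
    case (prod r x)
    then show ?case by (auto simp: free_module_def I_r_closed)
  next
    case (sum x y)
    then show ?case by (auto simp: free_module_def)
  qed
  then show "\<forall>b \<in> B. c b \<in> I" .
next
  interpret ideal I R by fact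
  let ?F = "free_module R B"
  assume cI: "\<forall>b \<in> B. c b \<in> I"
  show "c \<in> ideal_smult R I ?F"
  proof (rule free_module_induct[OF R B c])
    show "(\<lambda>_. \<zero>\<^bsub>R\<^esub>) \<in> ideal_smult R I ?F"
      using ideal_smult_zero[OF free_module_module[OF R] I, of B] by (simp add: free_module_def)
    fix b S assume "b \<in> B" "(\<lambda>k. if k \<in> S then c k else \<zero>\<^bsub>R\<^esub>) \<in> ideal_smult R I ?F"
    then have "(c b \<odot>\<^bsub>?F\<^esub> (\<lambda>k. if k = b then \<one>\<^bsub>R\<^esub> else \<zero>\<^bsub>R\<^esub>)) \<oplus>\<^bsub>?F\<^esub>
        (\<lambda>k. if k \<in> S then c k else \<zero>\<^bsub>R\<^esub>) \<in> ideal_smult R I ?F"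
      using cI unit_vector_closed[OF R] by (intro ideal_smult.intros) auto
    then show "(\<lambda>k. (c b \<otimes>\<^bsub>R\<^esub> (if k = b then \<one>\<^bsub>R\<^esub> else \<zero>\<^bsub>R\<^esub>)) \<oplus>\<^bsub>R\<^esub> (if k \<in> S then c k else \<zero>\<^bsub>R\<^esub>))
        \<in> ideal_smult R I ?F" by (simp add: free_module_def)
  qed
qed

text \<open>Since \<open>G\<close> is a submodule of R \<times> R, the coordinates of an induced
  pair form pairs in \<open>G\<close>. If the first vector is zero, the last clause of
  \<open>graph_mod\<close> puts every coordinate of the second in \<open>I\<close>.\<close>

lemma free_module_graph_flat:
  assumes R: "cring R" and I: "ideal I R" and B: "finite B"
  shows "graph_flat R I (free_module R B)"
  unfolding graph_flat_def
proof (intro allI impI)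
  fix G p assume G: "graph_mod R I G"
    and p: "(\<zero>\<^bsub>free_module R B\<^esub>, p) \<in> induced R G (free_module R B)"
  interpret cring R by fact
  have "(x b, y b) \<in> G" if "(x, y) \<in> induced R G (free_module R B)" "b \<in> B" for x y b
    using that
  proof induction
    case (prod r s x)
    then have "r \<otimes>\<^bsub>R\<^esub> x b = x b \<otimes>\<^bsub>R\<^esub> r" "s \<otimes>\<^bsub>R\<^esub> x b = x b \<otimes>\<^bsub>R\<^esub> s" "x b \<in> carrier R"
      using G by (auto simp: graph_mod_def free_module_def intro!: m_comm)
    then show ?case using prod G by (simp add: graph_mod_def free_module_def)
  next
    case (sum x y x' y')
    then show ?case using G by (simp add: graph_mod_def free_module_def)
  qed
  from this[OF p] have "\<forall>b\<in>B. p b \<in> I" using G by (auto simp: graph_mod_def free_module_def)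
  then show "p \<in> ideal_smult R I (free_module R B)"
    using free_module_ideal_smult_iff[OF R I B induced_closed(2)[OF free_module_module[OF R] G p]]
        by simp
qed

lemma sum_of_shifts_cpx:
  assumes "cring R" shows "chain_complex R (sum_of_shifts R js)"
proof -
  interpret cring R by fact
  show ?thesis
    unfolding chain_complex_def
  proof (intro conjI allI ballI)
    show "module R (grade (sum_of_shifts R js) i)" for i
      using free_module_module[OF assms] by (simp add: sum_of_shifts_def)
  qed (auto simp: sum_of_shifts_def lin_map_def free_module_def)
qed

lemma sum_of_shifts_test_complex:
  assumes R: "cring R" and I: "ideal I R"
  shows "test_complex U R I (sum_of_shifts R js)"
  unfolding test_complex_def bounded_projective_def
proof (intro conjI allI)
  show "chain_complex R (sum_of_shifts R js)" by (rule sum_of_shifts_cpx[OF R])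
  have fin: "finite {k. k < length js \<and> js ! k = i}" for i by simp
  show "projective U R (grade (sum_of_shifts R js) i)" for i
    using free_module_projective[OF R fin] by (simp add: sum_of_shifts_def)
  show "graph_flat R I (grade (sum_of_shifts R js) i)" for i
    using free_module_graph_flat[OF R I fin] by (simp add: sum_of_shifts_def)
  show "\<exists>b. \<forall>i<b. carrier (grade (sum_of_shifts R js) i) = {\<zero>\<^bsub>grade (sum_of_shifts R js) i\<^esub>}"
  proof (intro exI allI impI)
    \<comment> \<open>Inserting \<open>0\<close> keeps the set nonempty when \<open>js\<close> is
      the empty list.\<close>
    fix i assume i: "i < Min (insert 0 (set js))"
    have "{k. k < length js \<and> js ! k = i} = {}" using i by auto
    then show "carrier (grade (sum_of_shifts R js) i) = {\<zero>\<^bsub>grade (sum_of_shifts R js) i\<^esub>}"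
      by (auto simp: sum_of_shifts_def free_module_def)
  qed
qed

section \<open>Extensions of complexes\<close>

text \<open>
  Interleaving of sequences identifies \<open>(nat \<Rightarrow> 'r) \<times> (nat \<Rightarrow> 'r)\<close> with \<open>nat \<Rightarrow> 'r\<close>, so that
  extensions of complexes over \<open>nat \<Rightarrow> 'r\<close> live over the same type.
\<close>

definition fst_seq :: "(nat \<Rightarrow> 'r) \<Rightarrow> nat \<Rightarrow> 'r" where
  "fst_seq c = (\<lambda>n. c (2 * n))"

definition snd_seq :: "(nat \<Rightarrow> 'r) \<Rightarrow> nat \<Rightarrow> 'r" where
  "snd_seq c = (\<lambda>n. c (2 * n + 1))"

definition pair_seq :: "(nat \<Rightarrow> 'r) \<Rightarrow> (nat \<Rightarrow> 'r) \<Rightarrow> nat \<Rightarrow> 'r" where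
  "pair_seq a b = (\<lambda>n. if even n then a (n div 2) else b (n div 2))"

lemma pair_seq_simps [simp]:
  "fst_seq (pair_seq a b) = a" "snd_seq (pair_seq a b) = b" "pair_seq (fst_seq c) (snd_seq c) = c"
  "pair_seq a b = pair_seq a' b' \<longleftrightarrow> a = a' \<and> b = b'"
proof -
  show 1: "fst_seq (pair_seq a b) = a" "snd_seq (pair_seq a b) = b" for a b :: "nat \<Rightarrow> 'r"
    by (auto simp: fst_seq_def snd_seq_def pair_seq_def)
  show "pair_seq (fst_seq c) (snd_seq c) = c"
    by (auto simp: fst_seq_def snd_seq_def pair_seq_def fun_eq_iff)
  show "pair_seq a b = pair_seq a' b' \<longleftrightarrow> a = a' \<and> b = b'" by (metis 1)
qed

section \<open>Direct sums of modules of sequences\<close>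

definition seq_dsum :: "('r, nat \<Rightarrow> 's) module \<Rightarrow> ('r, nat \<Rightarrow> 's) module \<Rightarrow> ('r, nat \<Rightarrow> 's) module" where
  "seq_dsum M N =
     \<lparr>carrier = {c. fst_seq c \<in> carrier M \<and> snd_seq c \<in> carrier N}, monoid.mult = undefined, one =
         undefined,
      ring.zero = pair_seq \<zero>\<^bsub>M\<^esub> \<zero>\<^bsub>N\<^esub>,
      add = (\<lambda>c d. pair_seq (fst_seq c \<oplus>\<^bsub>M\<^esub> fst_seq d) (snd_seq c \<oplus>\<^bsub>N\<^esub> snd_seq d)),
      smult = (\<lambda>r c. pair_seq (r \<odot>\<^bsub>M\<^esub> fst_seq c) (r \<odot>\<^bsub>N\<^esub> snd_seq c))\<rparr>"

lemma seq_dsum_simps [simp]: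
  "c \<in> carrier (seq_dsum M N) \<longleftrightarrow> fst_seq c \<in> carrier M \<and> snd_seq c \<in> carrier N"
  "\<zero>\<^bsub>seq_dsum M N\<^esub> = pair_seq \<zero>\<^bsub>M\<^esub> \<zero>\<^bsub>N\<^esub>"
  "c \<oplus>\<^bsub>seq_dsum M N\<^esub> d = pair_seq (fst_seq c \<oplus>\<^bsub>M\<^esub> fst_seq d) (snd_seq c \<oplus>\<^bsub>N\<^esub> snd_seq d)"
  "r \<odot>\<^bsub>seq_dsum M N\<^esub> c = pair_seq (r \<odot>\<^bsub>M\<^esub> fst_seq c) (r \<odot>\<^bsub>N\<^esub> snd_seq c)"
  by (simp_all add: seq_dsum_def)

lemma seq_dsum_module:
  assumes "module R M" "module R N"
  shows "module R (seq_dsum M N)"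
proof -
  interpret M: module R M by fact
  interpret N: module R N by fact
  show ?thesis
  proof (rule moduleI)
    show "cring R" by (rule M.R.is_cring)
    show "abelian_group (seq_dsum M N)"
    proof (rule abelian_groupI)
      fix x assume "x \<in> carrier (seq_dsum M N)"
      then show "\<exists>y\<in>carrier (seq_dsum M N). y \<oplus>\<^bsub>seq_dsum M N\<^esub> x = \<zero>\<^bsub>seq_dsum M N\<^esub>"
        by (intro bexI[of _ "pair_seq (\<ominus>\<^bsub>M\<^esub> fst_seq x) (\<ominus>\<^bsub>N\<^esub> snd_seq x)"])
          (auto simp: M.l_neg N.l_neg)
    qed (auto simp: M.a_ac N.a_ac)
  qed (auto simp: M.smult_l_distr N.smult_l_distr M.smult_r_distr N.smult_r_distr
      M.smult_assoc1 N.smult_assoc1)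
qed

lemma seq_dsum_lin:
  assumes "module R M" "module R N"
  shows "lin_map R (seq_dsum M N) M fst_seq" "lin_map R (seq_dsum M N) N snd_seq"
    "lin_map R M (seq_dsum M N) (\<lambda>x. pair_seq x \<zero>\<^bsub>N\<^esub>)"
    "lin_map R N (seq_dsum M N) (\<lambda>x. pair_seq \<zero>\<^bsub>M\<^esub> x)"
proof -
  interpret M: module R M by fact
  interpret N: module R N by fact
  show "lin_map R (seq_dsum M N) M fst_seq" "lin_map R (seq_dsum M N) N snd_seq"
    "lin_map R M (seq_dsum M N) (\<lambda>x. pair_seq x \<zero>\<^bsub>N\<^esub>)"
    "lin_map R N (seq_dsum M N) (\<lambda>x. pair_seq \<zero>\<^bsub>M\<^esub> x)"
    by (auto intro!: lin_mapI)
qed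

lemma lin_pair_seq:
  "lin_map R P M f \<Longrightarrow> lin_map R P N g \<Longrightarrow> lin_map R P (seq_dsum M N) (\<lambda>x. pair_seq (f x) (g x))"
  by (auto simp: lin_map_def)

text \<open>The relation \<Gamma> restricts to a total relation on each summand, and the sum of the
  two selections is a selection for \<Gamma>.\<close>

lemma seq_dsum_projective:
  fixes R :: "('r, 'x) ring_scheme"
  assumes mod: "module R P" "module R P'"
    and P: "projective TYPE('m) R P" and P': "projective TYPE('m) R P'"
  shows "projective TYPE('m) R (seq_dsum P P')"
  unfolding projective_def
proof (intro allI impI, elim conjE)
  fix M :: "('r, 'm) module" and \<Gamma>
  assume M: "module R M" and \<Gamma>: "\<Gamma> \<subseteq> carrier (seq_dsum P P') \<times> carrier M"
    and add: "\<forall>x y x' y'. (x, y) \<in> \<Gamma> \<longrightarrow> (x', y') \<in> \<Gamma> \<longrightarrow> (x \<oplus>\<^bsub>seq_dsum P P'\<^esub> x', y \<oplus>\<^bsub>M\<^esub> y') \<in> \<Gamma>"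
    and smult: "\<forall>r x y. r \<in> carrier R \<longrightarrow> (x, y) \<in> \<Gamma> \<longrightarrow> (r \<odot>\<^bsub>seq_dsum P P'\<^esub> x, r \<odot>\<^bsub>M\<^esub> y) \<in> \<Gamma>"
    and total: "\<forall>x\<in>carrier (seq_dsum P P'). \<exists>y. (x, y) \<in> \<Gamma>"
  interpret P: module R P by fact
  interpret P': module R P' by fact
  have add': "(pair_seq (fst_seq x \<oplus>\<^bsub>P\<^esub> fst_seq x') (snd_seq x \<oplus>\<^bsub>P'\<^esub> snd_seq x'), y \<oplus>\<^bsub>M\<^esub> y') \<in> \<Gamma>"
    if "(x, y) \<in> \<Gamma>" "(x', y') \<in> \<Gamma>" for x y x' y' using add that by simp
  have smult': "(pair_seq (r \<odot>\<^bsub>P\<^esub> fst_seq x) (r \<odot>\<^bsub>P'\<^esub> snd_seq x), r \<odot>\<^bsub>M\<^esub> y) \<in> \<Gamma>"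
    if "r \<in> carrier R" "(x, y) \<in> \<Gamma>" for r x y using smult that by simp
  obtain f where f: "lin_map R P M f" "\<And>x. x \<in> carrier P \<Longrightarrow> (pair_seq x \<zero>\<^bsub>P'\<^esub>, f x) \<in> \<Gamma>"
  proof (rule projectiveD[OF P M, where \<Gamma> = "{(x, m). (pair_seq x \<zero>\<^bsub>P'\<^esub>, m) \<in> \<Gamma>}"])
    show "{(x, m). (pair_seq x \<zero>\<^bsub>P'\<^esub>, m) \<in> \<Gamma>} \<subseteq> carrier P \<times> carrier M" using \<Gamma> by force
    show "(x \<oplus>\<^bsub>P\<^esub> x', y \<oplus>\<^bsub>M\<^esub> y') \<in> {(x, m). (pair_seq x \<zero>\<^bsub>P'\<^esub>, m) \<in> \<Gamma>}"
      if "(x, y) \<in> {(x, m). (pair_seq x \<zero>\<^bsub>P'\<^esub>, m) \<in> \<Gamma>}"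
        "(x', y') \<in> {(x, m). (pair_seq x \<zero>\<^bsub>P'\<^esub>, m) \<in> \<Gamma>}" for x y x' y'
      using add'[of "pair_seq x \<zero>\<^bsub>P'\<^esub>" y "pair_seq x' \<zero>\<^bsub>P'\<^esub>" y'] that by simp
    show "(r \<odot>\<^bsub>P\<^esub> x, r \<odot>\<^bsub>M\<^esub> y) \<in> {(x, m). (pair_seq x \<zero>\<^bsub>P'\<^esub>, m) \<in> \<Gamma>}"
      if "r \<in> carrier R" "(x, y) \<in> {(x, m). (pair_seq x \<zero>\<^bsub>P'\<^esub>, m) \<in> \<Gamma>}" for r x y
      using smult'[of r "pair_seq x \<zero>\<^bsub>P'\<^esub>" y] that by simp
    show "\<exists>y. (x, y) \<in> {(x, m). (pair_seq x \<zero>\<^bsub>P'\<^esub>, m) \<in> \<Gamma>}" if "x \<in> carrier P" for x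
      using total[rule_format, of "pair_seq x \<zero>\<^bsub>P'\<^esub>"] that by simp
  qed (rule that, auto)
  obtain f' where f': "lin_map R P' M f'" "\<And>x. x \<in> carrier P' \<Longrightarrow> (pair_seq \<zero>\<^bsub>P\<^esub> x, f' x) \<in> \<Gamma>"
  proof (rule projectiveD[OF P' M, where \<Gamma> = "{(x, m). (pair_seq \<zero>\<^bsub>P\<^esub> x, m) \<in> \<Gamma>}"])
    show "{(x, m). (pair_seq \<zero>\<^bsub>P\<^esub> x, m) \<in> \<Gamma>} \<subseteq> carrier P' \<times> carrier M" using \<Gamma> by force
    show "(x \<oplus>\<^bsub>P'\<^esub> x', y \<oplus>\<^bsub>M\<^esub> y') \<in> {(x, m). (pair_seq \<zero>\<^bsub>P\<^esub> x, m) \<in> \<Gamma>}"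
      if "(x, y) \<in> {(x, m). (pair_seq \<zero>\<^bsub>P\<^esub> x, m) \<in> \<Gamma>}"
        "(x', y') \<in> {(x, m). (pair_seq \<zero>\<^bsub>P\<^esub> x, m) \<in> \<Gamma>}" for x y x' y'
      using add'[of "pair_seq \<zero>\<^bsub>P\<^esub> x" y "pair_seq \<zero>\<^bsub>P\<^esub> x'" y'] that by simp
    show "(r \<odot>\<^bsub>P'\<^esub> x, r \<odot>\<^bsub>M\<^esub> y) \<in> {(x, m). (pair_seq \<zero>\<^bsub>P\<^esub> x, m) \<in> \<Gamma>}"
      if "r \<in> carrier R" "(x, y) \<in> {(x, m). (pair_seq \<zero>\<^bsub>P\<^esub> x, m) \<in> \<Gamma>}" for r x y
      using smult'[of r "pair_seq \<zero>\<^bsub>P\<^esub> x" y] that by simp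
    show "\<exists>y. (x, y) \<in> {(x, m). (pair_seq \<zero>\<^bsub>P\<^esub> x, m) \<in> \<Gamma>}" if "x \<in> carrier P'" for x
      using total[rule_format, of "pair_seq \<zero>\<^bsub>P\<^esub> x"] that by simp
  qed (rule that, auto)
  have "lin_map R (seq_dsum P P') M (\<lambda>c. f (fst_seq c) \<oplus>\<^bsub>M\<^esub> f' (snd_seq c))"
    using lin_plus[OF M lin_comp[OF seq_dsum_lin(1)[OF mod] f(1)] lin_comp[OF seq_dsum_lin(2)[OF
        mod] f'(1)]]
    by (simp add: comp_def)
  moreover have "(c, f (fst_seq c) \<oplus>\<^bsub>M\<^esub> f' (snd_seq c)) \<in> \<Gamma>" if c: "c \<in> carrier (seq_dsum P P')" for c
    using add'[OF f(2)[of "fst_seq c"] f'(2)[of "snd_seq c"]] c by simp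
  ultimately show "\<exists>f. lin_map R (seq_dsum P P') M f \<and> (\<forall>x\<in>carrier (seq_dsum P P'). (x, f x) \<in> \<Gamma>)"
    by blast
qed

lemma ideal_smult_seq_dsum:
  assumes mod: "module R M" "module R N" and I: "I \<subseteq> carrier R"
    and a: "a \<in> ideal_smult R I M" and b: "b \<in> ideal_smult R I N"
  shows "pair_seq a b \<in> ideal_smult R I (seq_dsum M N)"
proof -
  interpret M: module R M by fact
  interpret N: module R N by fact
  have "pair_seq a \<zero>\<^bsub>N\<^esub> \<oplus>\<^bsub>seq_dsum M N\<^esub> pair_seq \<zero>\<^bsub>M\<^esub> b \<in> ideal_smult R I (seq_dsum M N)"
    by (rule ideal_smult.sum)
      (rule ideal_smult_lin[OF mod(1) I seq_dsum_lin(3)[OF mod] a]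
        ideal_smult_lin[OF mod(2) I seq_dsum_lin(4)[OF mod] b])+
  then show ?thesis
    using ideal_smult_closed[OF mod(1) I a] ideal_smult_closed[OF mod(2) I b] by simp
qed

lemma induced_seq_dsum:
  assumes mod: "module R M" "module R N" and G: "graph_mod R I G"
    and a: "(a, a') \<in> induced R G M" and b: "(b, b') \<in> induced R G N"
  shows "(pair_seq a b, pair_seq a' b') \<in> induced R G (seq_dsum M N)"
proof -
  interpret M: module R M by fact
  interpret N: module R N by fact
  have "(pair_seq a \<zero>\<^bsub>N\<^esub> \<oplus>\<^bsub>seq_dsum M N\<^esub> pair_seq \<zero>\<^bsub>M\<^esub> b, pair_seq a' \<zero>\<^bsub>N\<^esub> \<oplus>\<^bsub>seq_dsum M N\<^esub> pair_seq \<zero>\<^bsub>M\<^esub> b')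
      \<in> induced R G (seq_dsum M N)"
    by (rule induced.sum)
      (rule induced_lin[OF mod(1) G seq_dsum_lin(3)[OF mod] a]
        induced_lin[OF mod(2) G seq_dsum_lin(4)[OF mod] b])+
  then show ?thesis
    using induced_closed[OF mod(1) G a] induced_closed[OF mod(2) G b] by simp
qed

text \<open>The projections are linear, hence preserve induced pairs, and each component can be
  judged in its own summand.\<close>

lemma seq_dsum_graph_flat:
  assumes mod: "module R M" "module R N" and I: "I \<subseteq> carrier R"
    and M: "graph_flat R I M" and N: "graph_flat R I N"
  shows "graph_flat R I (seq_dsum M N)"
  unfolding graph_flat_def
proof (intro allI impI)
  fix G p assume G: "graph_mod R I G" and p: "(\<zero>\<^bsub>seq_dsum M N\<^esub>, p) \<in> induced R G (seq_dsum M N)"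
  note md = seq_dsum_module[OF mod]
  have "fst_seq p \<in> ideal_smult R I M" "snd_seq p \<in> ideal_smult R I N"
    using induced_lin[OF md G seq_dsum_lin(1)[OF mod] p] induced_lin[OF md G seq_dsum_lin(2)[OF mod]
        p]
      M N G by (auto simp: graph_flat_def)
  from ideal_smult_seq_dsum[OF mod I this] show "p \<in> ideal_smult R I (seq_dsum M N)" by simp
qed

text \<open>A degreewise split extension: \<open>P'\<close> is a subcomplex with quotient
  \<open>P\<close>. The differential squares to zero if \<tau> anticommutes with the differentials,
  that is, if \<tau> is a chain map from \<open>P\<close> to \<open>shift P'\<close>. Fibers, cones
  of multiplications and the factorizing complexes are all of this form.\<close>

definition extension ::
  "('r, nat \<Rightarrow> 's) cpx \<Rightarrow> ('r, nat \<Rightarrow> 's) cpx \<Rightarrow> (int \<Rightarrow> (nat \<Rightarrow> 's) \<Rightarrow> nat \<Rightarrow> 's) \<Rightarrow> ('r, nat \<Rightarrow> 's) cpx"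
      where
  "extension P P' \<tau> =
     \<lparr>grade = (\<lambda>i. seq_dsum (grade P i) (grade P' i)),
      bdry = (\<lambda>i c. pair_seq (bdry P i (fst_seq c))
        (\<tau> i (fst_seq c) \<oplus>\<^bsub>grade P' (i - 1)\<^esub> bdry P' i (snd_seq c)))\<rparr>"

lemma extension_simps [simp]:
  "grade (extension P P' \<tau>) i = seq_dsum (grade P i) (grade P' i)"
  "bdry (extension P P' \<tau>) i c = pair_seq (bdry P i (fst_seq c))
     (\<tau> i (fst_seq c) \<oplus>\<^bsub>grade P' (i - 1)\<^esub> bdry P' i (snd_seq c))"
  by (simp_all add: extension_def)

lemma extension_cpx:
  assumes P: "chain_complex R P" and P': "chain_complex R P'"
    and \<tau>: "\<And>i. lin_map R (grade P i) (grade P' (i - 1)) (\<tau> i)"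
    and anti: "\<And>i x. x \<in> carrier (grade P i) \<Longrightarrow>
      \<tau> (i - 1) (bdry P i x) \<oplus>\<^bsub>grade P' (i - 1 - 1)\<^esub> bdry P' (i - 1) (\<tau> i x) = \<zero>\<^bsub>grade P' (i - 1 - 1)\<^esub>"
  shows "chain_complex R (extension P P' \<tau>)"
  unfolding chain_complex_def
proof (intro conjI allI ballI)
  show "module R (grade (extension P P' \<tau>) i)" for i
    by (simp add: seq_dsum_module cpx_module[OF P] cpx_module[OF P'])
  note mod = cpx_module[OF P] cpx_module[OF P']
  show "lin_map R (grade (extension P P' \<tau>) i) (grade (extension P P' \<tau>) (i - 1)) (bdry (extension P
      P' \<tau>) i)" for i
    using lin_pair_seq[OF lin_comp[OF seq_dsum_lin(1)[OF mod, of i i] cpx_lin[OF P]]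
       lin_plus[OF mod(2) lin_comp[OF seq_dsum_lin(1)[OF mod, of i i] \<tau>]
         lin_comp[OF seq_dsum_lin(2)[OF mod, of i i] cpx_lin[OF P']]]]
    by (simp add: extension_def comp_def)
  fix i c assume c: "c \<in> carrier (grade (extension P P' \<tau>) i)"
  interpret M: module R "grade P' (i - 1 - 1)" by (rule mod(2))
  have x: "fst_seq c \<in> carrier (grade P i)" "snd_seq c \<in> carrier (grade P' i)" using c by auto
  have y: "\<tau> i (fst_seq c) \<in> carrier (grade P' (i - 1))" "bdry P' i (snd_seq c) \<in> carrier (grade P'
      (i - 1))"
    "bdry P i (fst_seq c) \<in> carrier (grade P (i - 1))"
    by (rule lin_closed[OF \<tau> x(1)] lin_closed[OF cpx_lin[OF P'] x(2)] lin_closed[OF cpx_lin[OF P]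
        x(1)])+
  have w: "bdry P' (i - 1) (\<tau> i (fst_seq c)) \<in> carrier (grade P' (i - 1 - 1))"
    by (rule lin_closed[OF cpx_lin[OF P'] y(1)])
  have "bdry P' (i - 1) (\<tau> i (fst_seq c) \<oplus>\<^bsub>grade P' (i - 1)\<^esub> bdry P' i (snd_seq c)) = bdry P' (i - 1)
      (\<tau> i (fst_seq c))"
    unfolding lin_add[OF cpx_lin[OF P'] y(1,2)] cpx_sq[OF P' x(2)] using w by (rule M.r_zero)
  then show "bdry (extension P P' \<tau>) (i - 1) (bdry (extension P P' \<tau>) i c) =
      \<zero>\<^bsub>grade (extension P P' \<tau>) (i - 1 - 1)\<^esub>"
    using anti[OF x(1)] cpx_sq[OF P x(1)] by simp
qed

lemma extension_test_complex:
  assumes I: "ideal I R" and P: "test_complex TYPE('m) R I P" and P': "test_complex TYPE('m) R I P'"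
    and \<tau>: "\<And>i. lin_map R (grade P i) (grade P' (i - 1)) (\<tau> i)"
    and anti: "\<And>i x. x \<in> carrier (grade P i) \<Longrightarrow>
      \<tau> (i - 1) (bdry P i x) \<oplus>\<^bsub>grade P' (i - 1 - 1)\<^esub> bdry P' (i - 1) (\<tau> i x) = \<zero>\<^bsub>grade P' (i - 1 - 1)\<^esub>"
  shows "test_complex TYPE('m) R I (extension P P' \<tau>)"
proof -
  note Pc = test_complexD(2)[OF P] and P'c = test_complexD(2)[OF P']
  note mod = cpx_module[OF Pc] cpx_module[OF P'c]
  interpret ideal I R by fact
  obtain b where b: "\<And>i. i < b \<Longrightarrow> carrier (grade P i) = {\<zero>\<^bsub>grade P i\<^esub>}"
    using P by (auto simp: test_complex_def bounded_projective_def)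
  obtain b' where b': "\<And>i. i < b' \<Longrightarrow> carrier (grade P' i) = {\<zero>\<^bsub>grade P' i\<^esub>}"
    using P' by (auto simp: test_complex_def bounded_projective_def)
  show ?thesis
  proof (rule test_complexI[OF extension_cpx[OF Pc P'c \<tau> anti]])
    fix i
    show "carrier (grade (extension P P' \<tau>) i) = {\<zero>\<^bsub>grade (extension P P' \<tau>) i\<^esub>}" if "i < min b b'"
    proof (intro equalityI subsetI)
      fix c assume "c \<in> carrier (grade (extension P P' \<tau>) i)"
      then have "fst_seq c = \<zero>\<^bsub>grade P i\<^esub>" "snd_seq c = \<zero>\<^bsub>grade P' i\<^esub>" using b[of i] b'[of i] that by
          auto
      then show "c \<in> {\<zero>\<^bsub>grade (extension P P' \<tau>) i\<^esub>}" using pair_seq_simps(3)[of c] by simp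
    qed (use b[of i] b'[of i] that in auto)
    show "projective TYPE('m) R (grade (extension P P' \<tau>) i)"
      unfolding extension_simps
      by (rule seq_dsum_projective[OF mod]) (use P P' in \<open>auto simp: test_complex_def
          bounded_projective_def\<close>)
    show "graph_flat R I (grade (extension P P' \<tau>) i)"
      unfolding extension_simps
      by (rule seq_dsum_graph_flat[OF mod a_subset]) (use P P' in \<open>auto simp: test_complex_def\<close>)
  qed
qed

lemma shift_test_complex: "test_complex U R I Q \<Longrightarrow> test_complex U R I (shift Q)"
  by (simp add: test_complex_def shift_bounded_projective)

text \<open>Inverse to \<open>shift\<close>; the sign of the differential is again reversed.\<close>

definition desuspend :: "('r, 'a) cpx \<Rightarrow> ('r, 'a) cpx" where
  "desuspend X = \<lparr>grade = (\<lambda>i. grade X (i + 1)), bdry = (\<lambda>i x. \<ominus>\<^bsub>grade X i\<^esub> bdry X (i + 1) x)\<rparr>"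

lemma desuspend_cpx:
  assumes X: "chain_complex R X" shows "chain_complex R (desuspend X)"
  unfolding chain_complex_def
proof (intro conjI allI ballI)
  show "module R (grade (desuspend X) i)" for i using cpx_module[OF X] by (simp add: desuspend_def)
  show "lin_map R (grade (desuspend X) i) (grade (desuspend X) (i - 1)) (bdry (desuspend X) i)" for
      i
    using lin_uminus[OF cpx_module[OF X] cpx_lin1[OF X, of i]] by (simp add: desuspend_def)
  fix i x assume "x \<in> carrier (grade (desuspend X) i)"
  then have x: "x \<in> carrier (grade X (i + 1))" by (simp add: desuspend_def)
  interpret M: abelian_group "grade X (i - 1)" by (rule module.axioms(2)[OF cpx_module[OF X]])
  note b = lin_closed[OF cpx_lin1[OF X] x]
  have "\<ominus>\<^bsub>grade X (i - 1)\<^esub> bdry X i (\<ominus>\<^bsub>grade X i\<^esub> bdry X (i + 1) x) = \<zero>\<^bsub>grade X (i - 1)\<^esub>"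
    unfolding lin_neg[OF cpx_module[OF X] cpx_module[OF X] cpx_lin[OF X] b] cpx_sq1[OF X x]
    by (simp only: M.neg_zero)
  then show "bdry (desuspend X) (i - 1) (bdry (desuspend X) i x) = \<zero>\<^bsub>grade (desuspend X) (i - 1 - 1)\<^esub>"
    by (simp add: desuspend_def)
qed

lemma desuspend_test_complex:
  assumes "test_complex U R I Q" shows "test_complex U R I (desuspend Q)"
proof -
  obtain b where b: "\<And>i. i < b \<Longrightarrow> carrier (grade Q i) = {\<zero>\<^bsub>grade Q i\<^esub>}"
    using assms by (auto simp: test_complex_def bounded_projective_def)
  then have "\<And>i. i < b - 1 \<Longrightarrow> carrier (grade (desuspend Q) i) = {\<zero>\<^bsub>grade (desuspend Q) i\<^esub>}"
    by (auto simp: desuspend_def)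
  moreover have "projective U R (grade (desuspend Q) i)" "graph_flat R I (grade (desuspend Q) i)"
      for i
    using assms by (auto simp: test_complex_def bounded_projective_def desuspend_def)
  ultimately show ?thesis
    using test_complexI[OF desuspend_cpx[OF test_complexD(2)[OF assms]]] by blast
qed

lemma desuspend_simps [simp]:
  "grade (desuspend X) i = grade X (i + 1)"
  "bdry (desuspend X) i x = \<ominus>\<^bsub>grade X i\<^esub> bdry X (i + 1) x"
  by (simp_all add: desuspend_def)

text \<open>The homotopy fiber of \<open>q\<close>: a cycle is a cycle of \<open>P\<close> together
  with a primitive of its image in \<open>P'\<close>.\<close>

definition fiber ::
  "('r, nat \<Rightarrow> 's) cpx \<Rightarrow> ('r, nat \<Rightarrow> 's) cpx \<Rightarrow> (int \<Rightarrow> (nat \<Rightarrow> 's) \<Rightarrow> nat \<Rightarrow> 's) \<Rightarrow> ('r, nat \<Rightarrow> 's) cpx"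
      where
  "fiber P P' q = extension P (desuspend P') q"

lemma fiber_simps [simp]:
  "grade (fiber P P' q) i = seq_dsum (grade P i) (grade P' (i + 1))"
  "bdry (fiber P P' q) i c = pair_seq (bdry P i (fst_seq c))
     (q i (fst_seq c) \<oplus>\<^bsub>grade P' i\<^esub> \<ominus>\<^bsub>grade P' i\<^esub> bdry P' (i + 1) (snd_seq c))"
  by (simp_all add: fiber_def)

lemma fiber_test_complex:
  assumes I: "ideal I R" and P: "test_complex TYPE('m) R I P" and P': "test_complex TYPE('m) R I P'"
    and q: "chain_map R P P' q"
  shows "test_complex TYPE('m) R I (fiber P P' q)"
  unfolding fiber_def
proof (rule extension_test_complex[OF I P desuspend_test_complex[OF P']])
  fix i
  show "lin_map R (grade P i) (grade (desuspend P') (i - 1)) (q i)"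
    using cmap_lin[OF q, of i] by simp
  fix x assume x: "x \<in> carrier (grade P i)"
  interpret abelian_group "grade P' (i - 1)"
    by (rule module.axioms(2)[OF cpx_module[OF test_complexD(2)[OF P']]])
  have "bdry P' i (q i x) \<in> carrier (grade P' (i - 1))"
    by (rule lin_closed[OF cpx_lin[OF test_complexD(2)[OF P']] lin_closed[OF cmap_lin[OF q] x]])
  then show "q (i - 1) (bdry P i x) \<oplus>\<^bsub>grade (desuspend P') (i - 1 - 1)\<^esub>
      bdry (desuspend P') (i - 1) (q i x) = \<zero>\<^bsub>grade (desuspend P') (i - 1 - 1)\<^esub>"
    using cmap_bdry[OF q x] by (simp add: r_neg)
qed

section \<open>The thick filtration\<close>

lemma dies_lin:
  assumes Q: "chain_complex R Q" and I: "I \<subseteq> carrier R" and f: "chain_map R Q Q' f" and z: "dies R I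
      Q i z"
  shows "dies R I Q' i (f i z)"
proof -
  obtain y e where y: "y \<in> carrier (grade Q (i + 1))" "e \<in> ideal_smult R I (grade Q i)"
    "z = bdry Q (i + 1) y \<oplus>\<^bsub>grade Q i\<^esub> e"
    using z by (auto simp: dies_def)
  have "f i z = bdry Q' (i + 1) (f (i + 1) y) \<oplus>\<^bsub>grade Q' i\<^esub> f i e"
    unfolding y(3) lin_add[OF cmap_lin[OF f] lin_closed[OF cpx_lin1[OF Q] y(1)]
        ideal_smult_closed[OF cpx_module[OF Q] I y(2)]] cmap_bdry1[OF f y(1)] ..
  then show ?thesis
    unfolding dies_def
    using lin_closed[OF cmap_lin[OF f] y(1)] ideal_smult_lin[OF cpx_module[OF Q] I cmap_lin[OF f]
        y(2)]
    by blast
qed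

text \<open>The ghost property of the generators. The sum of shifts itself serves as
  \<open>Q'\<close>: its differential is zero, so the given relation maps to a pair (0, p) with p
  the image of \<open>z d\<close>, and graph flatness puts p in the multiple by
  \<open>I\<close>.\<close>

lemma kills_sum_of_shifts:
  fixes F :: "('r, 'u) cpx"
  assumes R: "cring R" and I: "ideal I R" and F: "chain_isomorphic R F (sum_of_shifts R js)"
  shows "kills R I (Suc 0) F"
  unfolding kills_def
proof (intro allI impI, elim conjE)
  fix Q :: "('r, nat \<Rightarrow> 'r) cpx" and g d z G
  assume Q: "test_complex TYPE('u \<times> 'u) R I Q" and g: "chain_map R Q F g"
    and z: "z (d + int (Suc 0)) \<in> carrier (grade Q (d + int (Suc 0)))"
    and G: "\<forall>i. d \<le> i \<and> i < d + int (Suc 0) \<longrightarrow> graph_mod R I (G i) \<and>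
        (bdry Q (i + 1) (z (i + 1)), z i) \<in> induced R (G i) (grade Q i)"
  let ?S = "sum_of_shifts R js"
  note Qc = test_complexD(2)[OF Q] and Sc = sum_of_shifts_cpx[OF R, of js]
  obtain f where f: "chain_iso R F ?S f" using F by (auto simp: chain_isomorphic_def)
  have fm: "chain_map R F ?S f" and Fc: "chain_complex R F"
    and bij: "\<And>i. bij_betw (f i) (carrier (grade F i)) (carrier (grade ?S i))"
    using f by (auto simp: chain_iso_def)
  let ?g = "\<lambda>i. inv_into (carrier (grade F i)) (f i)"
  have gm: "chain_map R ?S F ?g" using chain_iso_inverse[OF f] by (auto simp: chain_iso_def)
  let ?q = "\<lambda>i. f i \<circ> g i"
  have q: "chain_map R Q ?S ?q" by (rule cmap_comp[OF g fm])
  have hom: "homotopic R Q F (\<lambda>i. ?g i \<circ> ?q i) g"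
    by (rule homotopic_refl[OF Fc cmap_lin[OF cmap_comp[OF q gm]]])
      (simp add: bij_betw_inv_into_left[OF bij] lin_closed[OF cmap_lin[OF g]])
  have Gd: "graph_mod R I (G d)" "(bdry Q (d + 1) (z (d + 1)), z d) \<in> induced R (G d) (grade Q d)"
    using G by auto
  interpret S: module R "grade ?S d" by (rule cpx_module[OF Sc])
  interpret S1: module R "grade ?S (d + 1)" by (rule cpx_module[OF Sc])
  \<comment> \<open>The zero element is the constant zero sequence in every degree, so the degrees
    on the two sides may differ.\<close>
  have zero: "bdry ?S i c = \<zero>\<^bsub>grade ?S d\<^esub>" for i c by (simp add: sum_of_shifts_def free_module_def)
  have "?q d (bdry Q (d + 1) (z (d + 1))) = \<zero>\<^bsub>grade ?S d\<^esub>"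
    using cmap_bdry1[OF q, of "z (d + 1)" d] z zero by simp
  then have "(\<zero>\<^bsub>grade ?S d\<^esub>, ?q d (z d)) \<in> induced R (G d) (grade ?S d)"
    using induced_lin[OF cpx_module[OF Qc] Gd(1) cmap_lin[OF q] Gd(2)] by simp
  then have e: "?q d (z d) \<in> ideal_smult R I (grade ?S d)"
    using sum_of_shifts_test_complex[OF R I, of "TYPE('u \<times> 'u)" js] Gd(1)
    by (auto simp: test_complex_def graph_flat_def)
  have "?q d (z d) \<in> carrier (grade ?S d)"
    by (rule lin_closed[OF cmap_lin[OF q] induced_closed(2)[OF cpx_module[OF Qc] Gd]])
  then have "dies R I ?S d (?q d (z d))"
    unfolding dies_def using e zero S1.zero_closed S.l_zero by metis
  then show "killed R I Q F g d (z d)"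
    unfolding killed_def using sum_of_shifts_test_complex[OF R I] q gm hom by blast
qed

text \<open>A sum of shifts of R is replaced by an isomorphic object of D(R) and then by a direct
  summand; \<open>kills\<close> survives both.\<close>

lemma kills_thick_1:
  fixes M :: "('r, 'u) cpx"
  assumes R: "cring R" and I: "ideal I R" and M: "thick R (Suc 0) M"
  shows "kills R I (Suc 0) M"
proof -
  from M obtain M' E F :: "('r, 'u) cpx" and js where
    *: "chain_complex R M" "chain_complex R M'" "chain_isomorphic R E (dsum M M')"
    "chain_isomorphic R F (sum_of_shifts R js)" "D_isomorphic R E F"
    by auto
  obtain \<rho> where "D_iso R F E \<rho>" using *(5) D_iso_sym unfolding D_isomorphic_def by metis
  then have E: "kills R I (Suc 0) E" using kills_D_iso[OF kills_sum_of_shifts[OF R I *(4)]] by blast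
  obtain \<theta> where th: "chain_iso R E (dsum M M') \<theta>" using *(3) by (auto simp: chain_isomorphic_def)
  obtain \<iota> \<pi> where "chain_map R M E \<iota>" "chain_map R E M \<pi>"
    "\<forall>i. \<forall>x\<in>carrier (grade M i). \<pi> i (\<iota> i x) = x"
    using dsum_retract(2)[OF th *(1,2)] by blast
  moreover have "chain_complex R E" using th by (simp add: chain_iso_def)
  ultimately show ?thesis using kills_retract[OF E *(1)] by blast
qed

text \<open>
  Let \<open>g : Q \<rightarrow> Y\<close>, and suppose that \<open>Q \<rightarrow> Y \<rightarrow> cone f\<close> factors up to homotopy as \<open>(S, T) \<circ> q\<close>
  through \<open>Q'\<close>. The homotopy and \<open>S\<close> give a map from the fiber of \<open>q\<close> to \<open>X\<close>. If it factors
  through \<open>v\<close> and \<open>W'\<close>, then \<open>g\<close> factors through an extension of \<open>Q'\<close> by \<open>W'\<close>.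
\<close>

lemma factor_through_extension:
  fixes Q Q' W' :: "('r, nat \<Rightarrow> 's) cpx" and X Y :: "('r, 'u) cpx"
  assumes Q: "chain_complex R Q" and Q': "chain_complex R Q'" and W': "chain_complex R W'"
    and X: "chain_complex R X" and Y: "chain_complex R Y"
    and f: "chain_map R X Y f" and q: "chain_map R Q Q' q"
    and v: "chain_map R (fiber Q Q' q) W' v" and u: "chain_map R W' X u"
    and S: "\<And>i. lin_map R (grade Q' i) (grade X (i - 1)) (S i)"
    and T: "\<And>i. lin_map R (grade Q' i) (grade Y i) (T i)"
    and H1: "\<And>i. lin_map R (grade Q i) (grade X i) (H1 i)"
    and H2: "\<And>i. lin_map R (grade Q i) (grade Y (i + 1)) (H2 i)"
    and g: "\<And>i. lin_map R (grade Q i) (grade Y i) (g i)"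
    and bT: "\<And>i y. y \<in> carrier (grade Q' i) \<Longrightarrow>
      T (i - 1) (bdry Q' i y) = f (i - 1) (S i y) \<oplus>\<^bsub>grade Y (i - 1)\<^esub> bdry Y i (T i y)"
    and gH: "\<And>i x. x \<in> carrier (grade Q i) \<Longrightarrow> g i x = T i (q i x) \<oplus>\<^bsub>grade Y i\<^esub>
      ((f i (H1 i x) \<oplus>\<^bsub>grade Y i\<^esub> bdry Y (i + 1) (H2 i x)) \<oplus>\<^bsub>grade Y i\<^esub> H2 (i - 1) (bdry Q i x))"
    and uv: "homotopic R (fiber Q Q' q) X (\<lambda>i. u i \<circ> v i)
      (\<lambda>i c. H1 i (fst_seq c) \<oplus>\<^bsub>grade X i\<^esub> S (i + 1) (snd_seq c))"
    and \<tau>_def: "\<tau> = (\<lambda>i y. v (i - 1) (pair_seq \<zero>\<^bsub>grade Q (i - 1)\<^esub> y))"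
    and j_def: "j = (\<lambda>i x. pair_seq (q i x) (\<ominus>\<^bsub>grade W' i\<^esub> v i (pair_seq x \<zero>\<^bsub>grade Q' (i + 1)\<^esub>)))"
  shows "\<And>i. lin_map R (grade Q' i) (grade W' (i - 1)) (\<tau> i)"
    and "\<And>i y. y \<in> carrier (grade Q' i) \<Longrightarrow> \<tau> (i - 1) (bdry Q' i y) \<oplus>\<^bsub>grade W' (i - 1 - 1)\<^esub>
      bdry W' (i - 1) (\<tau> i y) = \<zero>\<^bsub>grade W' (i - 1 - 1)\<^esub>"
    and "chain_map R Q (extension Q' W' \<tau>) j"
    and "\<exists>g'. chain_map R (extension Q' W' \<tau>) Y g' \<and> homotopic R Q Y (\<lambda>i. g' i \<circ> j i) g"
proof -
  note mQ = cpx_module[OF Q] and mQ' = cpx_module[OF Q'] and mW = cpx_module[OF W']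
    and mX = cpx_module[OF X] and mY = cpx_module[OF Y]
  have ag: "abelian_group (grade Q i)" "abelian_group (grade Q' i)" "abelian_group (grade W' i)"
    "abelian_group (grade X i)" "abelian_group (grade Y i)" for i
    by (rule mQ[THEN module.axioms(2)] mQ'[THEN module.axioms(2)] mW[THEN module.axioms(2)]
        mX[THEN module.axioms(2)] mY[THEN module.axioms(2)])+
  \<comment> \<open>The map \<open>v\<close> on the fiber splits into \<open>v1\<close> on
    \<open>Q\<close> and \<tau> on the desuspension of \<open>Q'\<close>.\<close>
  define v1 where "v1 i x = v i (pair_seq x \<zero>\<^bsub>grade Q' (i + 1)\<^esub>)" for i x
  have fl: "lin_map R (grade Q i) (seq_dsum (grade Q i) (grade Q' (i + 1))) (\<lambda>x. pair_seq x \<zero>\<^bsub>grade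
      Q' (i + 1)\<^esub>)"
    "lin_map R (grade Q' i) (seq_dsum (grade Q (i - 1)) (grade Q' i)) (\<lambda>y. pair_seq \<zero>\<^bsub>grade Q (i - 1)\<^esub>
        y)" for i
    by (rule seq_dsum_lin(3)[OF mQ mQ'], rule seq_dsum_lin(4)[OF mQ mQ'])
  have vl: "lin_map R (seq_dsum (grade Q i) (grade Q' (i + 1))) (grade W' i) (v i)"
    "lin_map R (seq_dsum (grade Q (i - 1)) (grade Q' i)) (grade W' (i - 1)) (v (i - 1))" for i
    using cmap_lin[OF v, of i] cmap_lin[OF v, of "i - 1"] by simp_all
  have v1: "lin_map R (grade Q i) (grade W' i) (v1 i)" for i
    using lin_comp[OF fl(1) vl(1)] by (simp add: v1_def[abs_def] comp_def)
  show tau: "lin_map R (grade Q' i) (grade W' (i - 1)) (\<tau> i)" for i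
    using lin_comp[OF fl(2) vl(2)] by (simp add: \<tau>_def comp_def)
  have fib1: "pair_seq x \<zero>\<^bsub>grade Q' (i + 1)\<^esub> \<in> carrier (grade (fiber Q Q' q) i)"
    if "x \<in> carrier (grade Q i)" for i x
    using that abelian_group.axioms(1)[OF ag(2), THEN abelian_monoid.zero_closed, of "i + 1"] by
        simp
  have fib2: "pair_seq \<zero>\<^bsub>grade Q (i - 1)\<^esub> y \<in> carrier (grade (fiber Q Q' q) (i - 1))"
    if "y \<in> carrier (grade Q' i)" for i y
    using that abelian_group.axioms(1)[OF ag(1), THEN abelian_monoid.zero_closed, of "i - 1"] by
        simp
  \<comment> \<open>The inclusion of \<open>Q'\<close> into the fiber lowers the degree by one and
    anticommutes with the differentials; \<tau> inherits the sign.\<close>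
  have bf2: "bdry (fiber Q Q' q) (i - 1) (pair_seq \<zero>\<^bsub>grade Q (i - 1)\<^esub> y) =
      \<ominus>\<^bsub>seq_dsum (grade Q (i - 1 - 1)) (grade Q' (i - 1))\<^esub> (pair_seq \<zero>\<^bsub>grade Q (i - 1 - 1)\<^esub> (bdry Q' i
          y))"
    if y: "y \<in> carrier (grade Q' i)" for i y
  proof -
    interpret N: abelian_group "grade Q' (i - 1)" by (rule ag)
    have b: "bdry Q' i y \<in> carrier (grade Q' (i - 1))" by (rule lin_closed[OF cpx_lin[OF Q'] y])
    have "bdry (fiber Q Q' q) (i - 1) (pair_seq \<zero>\<^bsub>grade Q (i - 1)\<^esub> y) =
        pair_seq \<zero>\<^bsub>grade Q (i - 1 - 1)\<^esub> (\<ominus>\<^bsub>grade Q' (i - 1)\<^esub> bdry Q' i y)"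
      using b by (simp add: lin_zero[OF mQ mQ cpx_lin[OF Q]] lin_zero[OF mQ mQ' cmap_lin[OF q]])
    also have "\<dots> = \<ominus>\<^bsub>seq_dsum (grade Q (i - 1 - 1)) (grade Q' (i - 1))\<^esub> (pair_seq \<zero>\<^bsub>grade Q (i - 1 - 1)\<^esub>
        (bdry Q' i y))"
      by (rule lin_neg[OF mQ' seq_dsum_module[OF mQ mQ'] seq_dsum_lin(4)[OF mQ mQ'] b])
    finally show ?thesis .
  qed
  have bf1: "bdry (fiber Q Q' q) i (pair_seq x \<zero>\<^bsub>grade Q' (i + 1)\<^esub>) = pair_seq (bdry Q i x) (q i x)"
    "pair_seq (bdry Q i x) (q i x) = pair_seq (bdry Q i x) \<zero>\<^bsub>grade Q' i\<^esub>
       \<oplus>\<^bsub>seq_dsum (grade Q (i - 1)) (grade Q' i)\<^esub> pair_seq \<zero>\<^bsub>grade Q (i - 1)\<^esub> (q i x)"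
    if x: "x \<in> carrier (grade Q i)" for i x
  proof -
    interpret N: abelian_group "grade Q' i" by (rule ag)
    interpret M: abelian_group "grade Q (i - 1)" by (rule ag)
    have b: "bdry Q i x \<in> carrier (grade Q (i - 1))" "q i x \<in> carrier (grade Q' i)"
      by (rule lin_closed[OF cpx_lin[OF Q] x], rule lin_closed[OF cmap_lin[OF q] x])
    show "bdry (fiber Q Q' q) i (pair_seq x \<zero>\<^bsub>grade Q' (i + 1)\<^esub>) = pair_seq (bdry Q i x) (q i x)"
      using b by (simp add: lin_zero[OF mQ' mQ' cpx_lin1[OF Q']] N.neg_zero)
    show "pair_seq (bdry Q i x) (q i x) = pair_seq (bdry Q i x) \<zero>\<^bsub>grade Q' i\<^esub>
       \<oplus>\<^bsub>seq_dsum (grade Q (i - 1)) (grade Q' i)\<^esub> pair_seq \<zero>\<^bsub>grade Q (i - 1)\<^esub> (q i x)"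
      using b by simp
  qed
  have btau: "bdry W' (i - 1) (\<tau> i y) = \<ominus>\<^bsub>grade W' (i - 1 - 1)\<^esub> \<tau> (i - 1) (bdry Q' i y)"
    if y: "y \<in> carrier (grade Q' i)" for i y
  proof -
    have b: "bdry Q' i y \<in> carrier (grade Q' (i - 1))" by (rule lin_closed[OF cpx_lin[OF Q'] y])
    show ?thesis
      unfolding \<tau>_def cmap_bdry[OF v fib2[OF y], symmetric] bf2[OF y]
      by (rule lin_neg[OF seq_dsum_module[OF mQ mQ'] mW vl(2)])
        (rule lin_closed[OF seq_dsum_lin(4)[OF mQ mQ'] b])
  qed
  show anti: "\<tau> (i - 1) (bdry Q' i y) \<oplus>\<^bsub>grade W' (i - 1 - 1)\<^esub>
      bdry W' (i - 1) (\<tau> i y) = \<zero>\<^bsub>grade W' (i - 1 - 1)\<^esub>" if y: "y \<in> carrier (grade Q' i)" for i y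
    unfolding btau[OF y]
    by (rule abelian_group.r_neg[OF ag(3) lin_closed[OF tau lin_closed[OF cpx_lin[OF Q'] y]]])
  \<comment> \<open>The failure of \<open>v1\<close> to be a chain map is exactly \<tau> q. This is
    why \<open>j\<close>, with -v1 as second component, commutes with the differential of the
    extension.\<close>
  have bv1: "bdry W' i (v1 i x) = v1 (i - 1) (bdry Q i x) \<oplus>\<^bsub>grade W' (i - 1)\<^esub> \<tau> i (q i x)"
    if x: "x \<in> carrier (grade Q i)" for i x
  proof -
    have b: "bdry Q i x \<in> carrier (grade Q (i - 1))" "q i x \<in> carrier (grade Q' i)"
      by (rule lin_closed[OF cpx_lin[OF Q] x], rule lin_closed[OF cmap_lin[OF q] x])
    have "bdry W' i (v1 i x) = v (i - 1) (pair_seq (bdry Q i x) (q i x))"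
      unfolding v1_def cmap_bdry[OF v fib1[OF x], symmetric] bf1(1)[OF x] ..
    also have "\<dots> = v (i - 1) (pair_seq (bdry Q i x) \<zero>\<^bsub>grade Q' i\<^esub>)
       \<oplus>\<^bsub>grade W' (i - 1)\<^esub> v (i - 1) (pair_seq \<zero>\<^bsub>grade Q (i - 1)\<^esub> (q i x))"
      unfolding bf1(2)[OF x]
      by (rule lin_add[OF vl(2)])
        (rule lin_closed[OF seq_dsum_lin(3)[OF mQ mQ'] b(1)] lin_closed[OF seq_dsum_lin(4)[OF mQ
            mQ'] b(2)])+
    finally show ?thesis by (simp add: v1_def \<tau>_def)
  qed
  show jm: "chain_map R Q (extension Q' W' \<tau>) j"
    unfolding chain_map_def
  proof (intro conjI allI ballI)
    show "lin_map R (grade Q i) (grade (extension Q' W' \<tau>) i) (j i)" for i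
      using lin_pair_seq[OF cmap_lin[OF q] lin_uminus[OF mW v1]] by (simp add: j_def v1_def)
    fix i x assume x: "x \<in> carrier (grade Q i)"
    interpret W: abelian_group "grade W' (i - 1)" by (rule ag)
    have c: "\<tau> i (q i x) \<in> carrier (grade W' (i - 1))" "v1 i x \<in> carrier (grade W' i)"
      "v1 (i - 1) (bdry Q i x) \<in> carrier (grade W' (i - 1))"
      by (rule lin_closed[OF tau lin_closed[OF cmap_lin[OF q] x]] lin_closed[OF v1 x]
          lin_closed[OF v1 lin_closed[OF cpx_lin[OF Q] x]])+
    have "\<ominus>\<^bsub>grade W' (i - 1)\<^esub> v1 (i - 1) (bdry Q i x) =
      \<tau> i (q i x) \<oplus>\<^bsub>grade W' (i - 1)\<^esub> bdry W' i (\<ominus>\<^bsub>grade W' i\<^esub> v1 i x)"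
      unfolding lin_neg[OF mW mW cpx_lin[OF W'] c(2)] bv1[OF x] using c by (simp add: W.group_simps)
    then show "j (i - 1) (bdry Q i x) = bdry (extension Q' W' \<tau>) i (j i x)"
      using cmap_bdry[OF q x] by (simp add: j_def v1_def)
  qed
  from uv obtain k where "homotopy R (fiber Q Q' q) X (\<lambda>i. u i \<circ> v i)
      (\<lambda>i c. H1 i (fst_seq c) \<oplus>\<^bsub>grade X i\<^esub> S (i + 1) (snd_seq c)) k" by (rule homotopicE)
  note k = homotopyD[OF this]
  \<comment> \<open>The two components of the homotopy \<open>k\<close>, split like
    \<open>v\<close>.\<close>
  define k1 where "k1 i x = k i (pair_seq x \<zero>\<^bsub>grade Q' (i + 1)\<^esub>)" for i x
  define k2 where "k2 i y = k (i - 1) (pair_seq \<zero>\<^bsub>grade Q (i - 1)\<^esub> y)" for i y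
  have kl: "lin_map R (seq_dsum (grade Q i) (grade Q' (i + 1))) (grade X (i + 1)) (k i)"
    "lin_map R (seq_dsum (grade Q (i - 1)) (grade Q' i)) (grade X i) (k (i - 1))" for i
    using k(1)[of i] k(1)[of "i - 1"] by simp_all
  have k1: "lin_map R (grade Q i) (grade X (i + 1)) (k1 i)" for i
    using lin_comp[OF fl(1) kl(1)] by (simp add: k1_def[abs_def] comp_def)
  have k2: "lin_map R (grade Q' i) (grade X i) (k2 i)" for i
    using lin_comp[OF fl(2) kl(2)] by (simp add: k2_def[abs_def] comp_def)
  \<comment> \<open>Thus u \<tau> agrees with \<open>S\<close> up to the homotopy \<open>k2\<close>;
    the minus sign is again that of the desuspension.\<close>
  have utau: "u (i - 1) (\<tau> i y) = S i y \<oplus>\<^bsub>grade X (i - 1)\<^esub>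
      (bdry X i (k2 i y) \<oplus>\<^bsub>grade X (i - 1)\<^esub> \<ominus>\<^bsub>grade X (i - 1)\<^esub> k2 (i - 1) (bdry Q' i y))"
    if y: "y \<in> carrier (grade Q' i)" for i y
  proof -
    interpret M: abelian_group "grade X (i - 1)" by (rule ag)
    have b: "bdry Q' i y \<in> carrier (grade Q' (i - 1))" by (rule lin_closed[OF cpx_lin[OF Q'] y])
    have "k (i - 1 - 1) (bdry (fiber Q Q' q) (i - 1) (pair_seq \<zero>\<^bsub>grade Q (i - 1)\<^esub> y)) =
        \<ominus>\<^bsub>grade X (i - 1)\<^esub> k2 (i - 1) (bdry Q' i y)"
      unfolding bf2[OF y] k2_def
      by (rule lin_neg[OF seq_dsum_module[OF mQ mQ'] mX kl(2)])
        (rule lin_closed[OF seq_dsum_lin(4)[OF mQ mQ'] b])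
    moreover have "S i y \<in> carrier (grade X (i - 1))" by (rule lin_closed[OF S y])
    ultimately show ?thesis
      using k(2)[OF fib2[OF y]] by (simp add: \<tau>_def k2_def lin_zero[OF mQ mX H1])
  qed
  have uv1: "u i (v1 i x) = H1 i x \<oplus>\<^bsub>grade X i\<^esub> (bdry X (i + 1) (k1 i x) \<oplus>\<^bsub>grade X i\<^esub>
      (k1 (i - 1) (bdry Q i x) \<oplus>\<^bsub>grade X i\<^esub> k2 i (q i x)))"
    if x: "x \<in> carrier (grade Q i)" for i x
  proof -
    interpret M: abelian_group "grade X i" by (rule ag)
    have b: "bdry Q i x \<in> carrier (grade Q (i - 1))" "q i x \<in> carrier (grade Q' i)"
      by (rule lin_closed[OF cpx_lin[OF Q] x], rule lin_closed[OF cmap_lin[OF q] x])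
    have "k (i - 1) (bdry (fiber Q Q' q) i (pair_seq x \<zero>\<^bsub>grade Q' (i + 1)\<^esub>)) =
        k (i - 1) (pair_seq (bdry Q i x) \<zero>\<^bsub>grade Q' i\<^esub>) \<oplus>\<^bsub>grade X i\<^esub> k2 i (q i x)"
      unfolding bf1(1)[OF x] unfolding bf1(2)[OF x] k2_def
      by (rule lin_add[OF kl(2)])
        (rule lin_closed[OF seq_dsum_lin(3)[OF mQ mQ'] b(1)] lin_closed[OF seq_dsum_lin(4)[OF mQ
            mQ'] b(2)])+
    moreover have "H1 i x \<in> carrier (grade X i)" by (rule lin_closed[OF H1 x])
    moreover have "S (i + 1) \<zero>\<^bsub>grade Q' (i + 1)\<^esub> = \<zero>\<^bsub>grade X i\<^esub>"
      using lin_zero[OF mQ' mX S, of "i + 1"] by simp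
    ultimately show ?thesis
      using k(2)[OF fib1[OF x]] by (simp add: v1_def k1_def del: fiber_simps)
  qed
  \<comment> \<open>\<open>T\<close> alone is not a chain map: its defect is f S. On the extension,
    -f u contributes -f u \<tau>, which cancels f S up to terms in \<open>k2\<close>, and -f k2
    removes those.\<close>
  define g' where "g' i c = (T i (fst_seq c) \<oplus>\<^bsub>grade Y i\<^esub> \<ominus>\<^bsub>grade Y i\<^esub> f i (k2 i (fst_seq c)))
      \<oplus>\<^bsub>grade Y i\<^esub> \<ominus>\<^bsub>grade Y i\<^esub> f i (u i (snd_seq c))" for i c
  have g'm: "chain_map R (extension Q' W' \<tau>) Y g'"
    unfolding chain_map_def
  proof (intro conjI allI ballI)
    note p = seq_dsum_lin(1)[OF mQ' mW] seq_dsum_lin(2)[OF mQ' mW]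
    show "lin_map R (grade (extension Q' W' \<tau>) i) (grade Y i) (g' i)" for i
      using lin_plus[OF mY lin_plus[OF mY lin_comp[OF p(1) T]
          lin_uminus[OF mY lin_comp[OF lin_comp[OF p(1) k2] cmap_lin[OF f]]]]
          lin_uminus[OF mY lin_comp[OF lin_comp[OF p(2) cmap_lin[OF u]] cmap_lin[OF f]]]]
      by (simp add: g'_def[abs_def] comp_def)
    fix i c assume "c \<in> carrier (grade (extension Q' W' \<tau>) i)"
    then obtain y w where c: "c = pair_seq y w" and y: "y \<in> carrier (grade Q' i)" and w: "w \<in>
        carrier (grade W' i)"
      using pair_seq_simps(3)[of c] by force
    interpret Xj: abelian_group "grade X (i - 1)" by (rule ag)
    interpret Yj: abelian_group "grade Y (i - 1)" by (rule ag)
    interpret Yi: abelian_group "grade Y i" by (rule ag)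
    have bdy: "bdry Q' i y \<in> carrier (grade Q' (i - 1))" by (rule lin_closed[OF cpx_lin[OF Q'] y])
    have bw: "bdry W' i w \<in> carrier (grade W' (i - 1))" by (rule lin_closed[OF cpx_lin[OF W'] w])
    have t: "\<tau> i y \<in> carrier (grade W' (i - 1))" by (rule lin_closed[OF tau y])
    have cX: "S i y \<in> carrier (grade X (i - 1))" "k2 i y \<in> carrier (grade X i)"
      "bdry X i (k2 i y) \<in> carrier (grade X (i - 1))" "k2 (i - 1) (bdry Q' i y) \<in> carrier (grade X
          (i - 1))"
      "u (i - 1) (\<tau> i y) \<in> carrier (grade X (i - 1))" "u (i - 1) (bdry W' i w) \<in> carrier (grade X (i
          - 1))"
      "u i w \<in> carrier (grade X i)"
      by (rule lin_closed[OF S y] lin_closed[OF k2 y] lin_closed[OF cpx_lin[OF X] lin_closed[OF k2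
          y]]
          lin_closed[OF k2 bdy] lin_closed[OF cmap_lin[OF u] t] lin_closed[OF cmap_lin[OF u] bw]
          lin_closed[OF cmap_lin[OF u] w])+
    note fX = lin_closed[OF cmap_lin[OF f]]
    have Ti: "T i y \<in> carrier (grade Y i)" "bdry Y i (T i y) \<in> carrier (grade Y (i - 1))"
      by (rule lin_closed[OF T y] lin_closed[OF cpx_lin[OF Y] lin_closed[OF T y]])+
    have 1: "f (i - 1) (u (i - 1) (\<tau> i y \<oplus>\<^bsub>grade W' (i - 1)\<^esub> bdry W' i w)) =
        (f (i - 1) (S i y) \<oplus>\<^bsub>grade Y (i - 1)\<^esub> (f (i - 1) (bdry X i (k2 i y)) \<oplus>\<^bsub>grade Y (i - 1)\<^esub>
          \<ominus>\<^bsub>grade Y (i - 1)\<^esub> f (i - 1) (k2 (i - 1) (bdry Q' i y)))) \<oplus>\<^bsub>grade Y (i - 1)\<^esub> f (i - 1) (u (i -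
              1) (bdry W' i w))"
      unfolding lin_add[OF cmap_lin[OF u] t bw] lin_add[OF cmap_lin[OF f] cX(5,6)]
      unfolding utau[OF y] using cX
      by (simp add: lin_add[OF cmap_lin[OF f]] lin_neg[OF mX mY cmap_lin[OF f]])
    have 2: "bdry Y i (g' i c) = (bdry Y i (T i y) \<oplus>\<^bsub>grade Y (i - 1)\<^esub> \<ominus>\<^bsub>grade Y (i - 1)\<^esub> f (i - 1) (bdry
        X i (k2 i y)))
      \<oplus>\<^bsub>grade Y (i - 1)\<^esub> \<ominus>\<^bsub>grade Y (i - 1)\<^esub> f (i - 1) (u (i - 1) (bdry W' i w))"
      unfolding g'_def c using cX(2,7) Ti fX
      by (simp add: lin_add[OF cpx_lin[OF Y]] lin_neg[OF mY mY cpx_lin[OF Y]]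
          cmap_bdry[OF f, symmetric] cmap_bdry[OF u w])
    show "g' (i - 1) (bdry (extension Q' W' \<tau>) i c) = bdry Y i (g' i c)"
      unfolding 2 unfolding g'_def c extension_simps pair_seq_simps 1 bT[OF y]
      using cX fX[OF cX(1)] fX[OF cX(3)] fX[OF cX(4)] fX[OF cX(6)] Ti(2) by (simp add:
          Yj.group_simps)
  qed
  \<comment> \<open>In g' j the two occurrences of f k2 q cancel, leaving T q + f H1 and the
    homotopy f k1. Compared with the formula for \<open>g\<close>, the difference is given by f k1 -
    H2.\<close>
  define h where "h i x = f (i + 1) (k1 i x) \<oplus>\<^bsub>grade Y (i + 1)\<^esub> \<ominus>\<^bsub>grade Y (i + 1)\<^esub> H2 i x" for i x
  have "homotopic R Q Y (\<lambda>i. g' i \<circ> j i) g"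
    unfolding homotopic_def
  proof (intro exI conjI allI ballI)
    show "lin_map R (grade Q i) (grade Y (i + 1)) (h i)" for i
      using lin_plus[OF mY lin_comp[OF k1 cmap_lin[OF f]] lin_uminus[OF mY H2]]
      by (simp add: h_def[abs_def] comp_def)
    fix i x assume x: "x \<in> carrier (grade Q i)"
    interpret Yi: abelian_group "grade Y i" by (rule ag)
    interpret Yk: abelian_group "grade Y (i + 1)" by (rule ag)
    have b: "bdry Q i x \<in> carrier (grade Q (i - 1))" and qx: "q i x \<in> carrier (grade Q' i)"
      by (rule lin_closed[OF cpx_lin[OF Q] x], rule lin_closed[OF cmap_lin[OF q] x])
    have k1b: "k1 (i - 1) (bdry Q i x) \<in> carrier (grade X i)" using lin_closed[OF k1 b] by simp
    have H2b: "H2 (i - 1) (bdry Q i x) \<in> carrier (grade Y i)" using lin_closed[OF H2 b] by simp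
    have c: "H1 i x \<in> carrier (grade X i)" "k1 i x \<in> carrier (grade X (i + 1))"
      "bdry X (i + 1) (k1 i x) \<in> carrier (grade X i)" "k2 i (q i x) \<in> carrier (grade X i)"
      "T i (q i x) \<in> carrier (grade Y i)" "H2 i x \<in> carrier (grade Y (i + 1))"
      "bdry Y (i + 1) (H2 i x) \<in> carrier (grade Y i)" "v1 i x \<in> carrier (grade W' i)"
      "u i (v1 i x) \<in> carrier (grade X i)"
      by (rule lin_closed[OF H1 x] lin_closed[OF k1 x] lin_closed[OF cpx_lin1[OF X] lin_closed[OF k1
          x]]
          lin_closed[OF k2 qx] lin_closed[OF T qx] lin_closed[OF H2 x] lin_closed[OF v1 x]
          lin_closed[OF cpx_lin1[OF Y] lin_closed[OF H2 x]]
          lin_closed[OF cmap_lin[OF u] lin_closed[OF v1 x]])+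
    note fX = lin_closed[OF cmap_lin[OF f]]
    interpret Xi: abelian_group "grade X i" by (rule ag)
    have 1: "f i (u i (v1 i x)) = f i (H1 i x) \<oplus>\<^bsub>grade Y i\<^esub> (f i (bdry X (i + 1) (k1 i x)) \<oplus>\<^bsub>grade Y i\<^esub>
      (f i (k1 (i - 1) (bdry Q i x)) \<oplus>\<^bsub>grade Y i\<^esub> f i (k2 i (q i x))))"
      unfolding uv1[OF x] using c k1b by (simp add: lin_add[OF cmap_lin[OF f]])
    have 2: "g' i (j i x) = (T i (q i x) \<oplus>\<^bsub>grade Y i\<^esub> \<ominus>\<^bsub>grade Y i\<^esub> f i (k2 i (q i x)))
      \<oplus>\<^bsub>grade Y i\<^esub> f i (u i (v1 i x))"
      using c fX by (simp add: g'_def j_def v1_def[symmetric] lin_neg[OF mW mX cmap_lin[OF u]]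
        lin_neg[OF mX mY cmap_lin[OF f]])
    have 3: "bdry Y (i + 1) (h i x) = f i (bdry X (i + 1) (k1 i x)) \<oplus>\<^bsub>grade Y i\<^esub> \<ominus>\<^bsub>grade Y i\<^esub> bdry Y (i
        + 1) (H2 i x)"
      unfolding h_def using c fX
      by (simp add: lin_add[OF cpx_lin1[OF Y]] lin_neg[OF mY mY cpx_lin1[OF Y]] cmap_bdry1[OF f])
    have 4: "h (i - 1) (bdry Q i x) = f i (k1 (i - 1) (bdry Q i x)) \<oplus>\<^bsub>grade Y i\<^esub> \<ominus>\<^bsub>grade Y i\<^esub> H2 (i - 1)
        (bdry Q i x)"
      by (simp add: h_def)
    show "(g' i \<circ> j i) x = g i x \<oplus>\<^bsub>grade Y i\<^esub> (bdry Y (i + 1) (h i x) \<oplus>\<^bsub>grade Y i\<^esub> h (i - 1) (bdry Q i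
        x))"
      unfolding comp_def 2 1 3 4 gH[OF x]
      using c fX[OF c(1)] fX[OF c(3)] fX[OF c(4)] fX[OF k1b] H2b by (simp add: Yi.group_simps)
  qed
  with g'm show "\<exists>g'. chain_map R (extension Q' W' \<tau>) Y g' \<and> homotopic R Q Y (\<lambda>i. g' i \<circ> j i) g" by
      blast
qed

text \<open>The induction step of the ghost lemma. The object \<open>C\<close> absorbs all but the
  last of the maps \<chi>: after passing to \<open>Q'\<close>, the element \<open>z (d + 1)\<close>
  becomes a boundary modulo \<open>I\<close>. Together with a primitive it gives an element
  \<open>w\<close> of the fiber of \<open>q\<close>, whose image under the last \<chi> is absorbed
  by \<open>X\<close>.\<close>

lemma kills_cone:
  fixes X Y C :: "('r, 'u) cpx"
  assumes I: "ideal I R"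
    and X: "chain_complex R X" and Y: "chain_complex R Y" and C: "chain_complex R C"
    and f: "chain_map R X Y f" and \<gamma>: "chain_map R Y C \<gamma>"
    and \<theta>: "chain_map R C (cone X Y f) \<theta>"
    and \<theta>\<gamma>: "\<And>i y. y \<in> carrier (grade Y i) \<Longrightarrow> \<theta> i (\<gamma> i y) = (\<zero>\<^bsub>grade X (i - 1)\<^esub>, y)"
    and kC: "kills R I n C" and kX: "kills R I (Suc 0) X"
  shows "kills R I (Suc n) Y"
  unfolding kills_def
proof (intro allI impI, elim conjE)
  fix Q :: "('r, nat \<Rightarrow> 'r) cpx" and g d z G
  assume Q: "test_complex TYPE('u \<times> 'u) R I Q" and g: "chain_map R Q Y g"
    and z: "z (d + int (Suc n)) \<in> carrier (grade Q (d + int (Suc n)))"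
    and G: "\<forall>i. d \<le> i \<and> i < d + int (Suc n) \<longrightarrow> graph_mod R I (G i) \<and>
        (bdry Q (i + 1) (z (i + 1)), z i) \<in> induced R (G i) (grade Q i)"
  interpret ideal I R by fact
  \<comment> \<open>Coordinates of the cone: \<open>s\<close> anticommutes with the differentials,
    and \<open>t\<close> commutes up to f s.\<close>
  define s where "s i c = fst (\<theta> i c)" for i c
  define t where "t i c = snd (\<theta> i c)" for i c
  have \<theta>l: "lin_map R (grade C i) (dsum_module (grade X (i - 1)) (grade Y i)) (\<theta> i)" for i
    using cmap_lin[OF \<theta>, of i] by (simp add: cone_def)
  have sl: "lin_map R (grade C i) (grade X (i - 1)) (s i)" for i
    using lin_dsum_fst[OF \<theta>l] by (simp add: s_def[abs_def])
  have tl: "lin_map R (grade C i) (grade Y i) (t i)" for i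
    using lin_dsum_snd[OF \<theta>l] by (simp add: t_def[abs_def])
  have sb: "s (i - 1) (bdry C i c) = \<ominus>\<^bsub>grade X (i - 1 - 1)\<^esub> bdry X (i - 1) (s i c)"
    and tb: "t (i - 1) (bdry C i c) = f (i - 1) (s i c) \<oplus>\<^bsub>grade Y (i - 1)\<^esub> bdry Y i (t i c)"
    if "c \<in> carrier (grade C i)" for i c
    using cmap_bdry[OF \<theta> that] by (auto simp: s_def t_def cone_def split: prod.splits)
  note Qc = test_complexD(2)[OF Q]
  \<comment> \<open>\<open>C\<close> is tested in degree \<open>d + 1\<close>, which spends the n
    relations above degree \<open>d\<close>; the relation in degree \<open>d\<close> is kept for
    \<open>X\<close>.\<close>
  obtain Q' :: "('r, nat \<Rightarrow> 'r) cpx" and q q' where Q': "test_complex TYPE('u \<times> 'u) R I Q'"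
    "chain_map R Q Q' q" "chain_map R Q' C q'" "homotopic R Q C (\<lambda>j. q' j \<circ> q j) (\<lambda>j. \<gamma> j \<circ> g j)"
    "dies R I Q' (d + 1) (q (d + 1) (z (d + 1)))"
    by (rule killsD[OF kC Q cmap_comp[OF g \<gamma>], where z = z and d = "d + 1" and G = G])
      (use z G in \<open>auto simp: algebra_simps\<close>)
  note Q'c = test_complexD(2)[OF Q'(1)] and q = Q'(2)
  note ag = module.axioms(2)[OF cpx_module]
  have "homotopic R Q C (\<lambda>j. \<gamma> j \<circ> g j) (\<lambda>j. q' j \<circ> q j)"
    by (rule homotopic_sym[OF Qc C cmap_lin[OF cmap_comp[OF g \<gamma>]] Q'(4)])
  then obtain H where "homotopy R Q C (\<lambda>j. \<gamma> j \<circ> g j) (\<lambda>j. q' j \<circ> q j) H" by (rule homotopicE)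
  note H = homotopyD[OF this]
  define H1 where "H1 i x = s (i + 1) (H i x)" for i x
  define H2 where "H2 i x = t (i + 1) (H i x)" for i x
  define S where "S i y = s i (q' i y)" for i y
  define T where "T i y = t i (q' i y)" for i y
  have H1: "lin_map R (grade Q i) (grade X i) (H1 i)" for i
    using lin_comp[OF H(1) sl, of i] by (simp add: H1_def[abs_def] comp_def)
  have H2: "lin_map R (grade Q i) (grade Y (i + 1)) (H2 i)" for i
    using lin_comp[OF H(1) tl, of i] by (simp add: H2_def[abs_def] comp_def)
  have S: "lin_map R (grade Q' i) (grade X (i - 1)) (S i)" for i
    using lin_comp[OF cmap_lin[OF Q'(3)] sl, of i] by (simp add: S_def[abs_def] comp_def)
  have T: "lin_map R (grade Q' i) (grade Y i) (T i)" for i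
    using lin_comp[OF cmap_lin[OF Q'(3)] tl, of i] by (simp add: T_def[abs_def] comp_def)
  have bS: "S (i - 1) (bdry Q' i y) = \<ominus>\<^bsub>grade X (i - 1 - 1)\<^esub> bdry X (i - 1) (S i y)"
    and bT: "T (i - 1) (bdry Q' i y) = f (i - 1) (S i y) \<oplus>\<^bsub>grade Y (i - 1)\<^esub> bdry Y i (T i y)"
    if y: "y \<in> carrier (grade Q' i)" for i y
    unfolding S_def T_def cmap_bdry[OF Q'(3) y]
    by (rule sb[OF lin_closed[OF cmap_lin[OF Q'(3)] y]], rule tb[OF lin_closed[OF cmap_lin[OF Q'(3)]
        y]])
  have bS1: "S i (bdry Q' (i + 1) y) = \<ominus>\<^bsub>grade X (i - 1)\<^esub> bdry X i (S (i + 1) y)"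
    if y: "y \<in> carrier (grade Q' (i + 1))" for i y
    using bS[OF y] by simp
  \<comment> \<open>The homotopy equation in coordinates: \<gamma> g has first coordinate zero and
    second coordinate \<open>g\<close>.\<close>
  have hom_parts: "\<zero>\<^bsub>grade X (i - 1)\<^esub> = S i (q i x) \<oplus>\<^bsub>grade X (i - 1)\<^esub>
      (\<ominus>\<^bsub>grade X (i - 1)\<^esub> bdry X i (H1 i x) \<oplus>\<^bsub>grade X (i - 1)\<^esub> H1 (i - 1) (bdry Q i x))"
    "g i x = T i (q i x) \<oplus>\<^bsub>grade Y i\<^esub>
      ((f i (H1 i x) \<oplus>\<^bsub>grade Y i\<^esub> bdry Y (i + 1) (H2 i x)) \<oplus>\<^bsub>grade Y i\<^esub> H2 (i - 1) (bdry Q i x))"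
    if x: "x \<in> carrier (grade Q i)" for i x
  proof -
    interpret Ci: abelian_group "grade C i" by (rule ag[OF C])
    have c: "q' i (q i x) \<in> carrier (grade C i)" "H i x \<in> carrier (grade C (i + 1))"
      "bdry C (i + 1) (H i x) \<in> carrier (grade C i)" "H (i - 1) (bdry Q i x) \<in> carrier (grade C i)"
      by (rule lin_closed[OF cmap_lin[OF Q'(3)] lin_closed[OF cmap_lin[OF q] x]] lin_closed[OF H(1)
          x]
          lin_closed[OF cpx_lin1[OF C] lin_closed[OF H(1) x]] H(4)[OF lin_closed[OF cpx_lin[OF Qc]
              x]])+
    have \<gamma>g: "\<theta> i (\<gamma> i (g i x)) = (\<zero>\<^bsub>grade X (i - 1)\<^esub>, g i x)"
      by (rule \<theta>\<gamma>[OF lin_closed[OF cmap_lin[OF g] x]])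
    have "s i (\<gamma> i (g i x)) = S i (q i x) \<oplus>\<^bsub>grade X (i - 1)\<^esub>
        (s i (bdry C (i + 1) (H i x)) \<oplus>\<^bsub>grade X (i - 1)\<^esub> s i (H (i - 1) (bdry Q i x)))"
      using H(2)[OF x] c by (simp add: lin_add[OF sl] S_def)
    then show "\<zero>\<^bsub>grade X (i - 1)\<^esub> = S i (q i x) \<oplus>\<^bsub>grade X (i - 1)\<^esub>
      (\<ominus>\<^bsub>grade X (i - 1)\<^esub> bdry X i (H1 i x) \<oplus>\<^bsub>grade X (i - 1)\<^esub> H1 (i - 1) (bdry Q i x))"
      using sb[OF c(2)] \<gamma>g by (simp add: H1_def s_def)
    have "t i (\<gamma> i (g i x)) = T i (q i x) \<oplus>\<^bsub>grade Y i\<^esub>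
        (t i (bdry C (i + 1) (H i x)) \<oplus>\<^bsub>grade Y i\<^esub> t i (H (i - 1) (bdry Q i x)))"
      using H(2)[OF x] c by (simp add: lin_add[OF tl] T_def)
    then show "g i x = T i (q i x) \<oplus>\<^bsub>grade Y i\<^esub>
      ((f i (H1 i x) \<oplus>\<^bsub>grade Y i\<^esub> bdry Y (i + 1) (H2 i x)) \<oplus>\<^bsub>grade Y i\<^esub> H2 (i - 1) (bdry Q i x))"
      using tb[OF c(2)] \<gamma>g by (simp add: H1_def H2_def s_def t_def)
  qed
  let ?W = "fiber Q Q' q"
  have W: "test_complex TYPE('u \<times> 'u) R I ?W" by (rule fiber_test_complex[OF I Q Q'(1) q])
  note Wc = test_complexD(2)[OF W]
  \<comment> \<open>That \<open>H1\<close> and \<open>S\<close> form a chain map on the fiber is the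
    first equation of \<open>hom_parts\<close>, together with the anticommutation of
    \<open>S\<close>.\<close>
  let ?m = "\<lambda>i c. H1 i (fst_seq c) \<oplus>\<^bsub>grade X i\<^esub> S (i + 1) (snd_seq c)"
  have m: "chain_map R ?W X ?m"
    unfolding chain_map_def
  proof (intro conjI allI ballI)
    fix i
    note p = seq_dsum_lin[OF cpx_module[OF Qc, of i] cpx_module[OF Q'c, of "i + 1"]]
    have "lin_map R (grade Q' (i + 1)) (grade X i) (S (i + 1))" using S[of "i + 1"] by simp
    then show "lin_map R (grade ?W i) (grade X i) (?m i)"
      using lin_plus[OF cpx_module[OF X, of i] lin_comp[OF p(1) H1] lin_comp[OF p(2)]] by (simp add:
          comp_def)
    fix c assume c: "c \<in> carrier (grade ?W i)"
    define x where "x = fst_seq c"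
    define y where "y = snd_seq c"
    have x: "x \<in> carrier (grade Q i)" and y: "y \<in> carrier (grade Q' (i + 1))" using c by (auto simp:
        x_def y_def)
    interpret Xj: abelian_group "grade X (i - 1)" by (rule ag[OF X])
    interpret Q'i: abelian_group "grade Q' i" by (rule ag[OF Q'c])
    have b: "q i x \<in> carrier (grade Q' i)" "bdry Q' (i + 1) y \<in> carrier (grade Q' i)"
      "H1 i x \<in> carrier (grade X i)" "bdry X i (H1 i x) \<in> carrier (grade X (i - 1))"
      "H1 (i - 1) (bdry Q i x) \<in> carrier (grade X (i - 1))"
      by (rule lin_closed[OF cmap_lin[OF q] x] lin_closed[OF cpx_lin1[OF Q'c] y] lin_closed[OF H1 x]
          lin_closed[OF cpx_lin[OF X] lin_closed[OF H1 x]] lin_closed[OF H1 lin_closed[OF cpx_lin[OF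
              Qc] x]])+
    have Sy: "S (i + 1) y \<in> carrier (grade X i)" using lin_closed[OF S y] by simp
    have bSy: "bdry X i (S (i + 1) y) \<in> carrier (grade X (i - 1))" by (rule lin_closed[OF cpx_lin[OF
        X] Sy])
    have Sq: "S i (q i x) \<in> carrier (grade X (i - 1))" by (rule lin_closed[OF S b(1)])
    have "H1 (i - 1) (bdry Q i x) \<oplus>\<^bsub>grade X (i - 1)\<^esub> S i (q i x \<oplus>\<^bsub>grade Q' i\<^esub> \<ominus>\<^bsub>grade Q' i\<^esub> bdry Q' (i +
        1) y) =
        H1 (i - 1) (bdry Q i x) \<oplus>\<^bsub>grade X (i - 1)\<^esub> (S i (q i x) \<oplus>\<^bsub>grade X (i - 1)\<^esub> bdry X i (S (i + 1)
            y))"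
      using b by (simp add: lin_add[OF S] lin_neg[OF cpx_module[OF Q'c] cpx_module[OF X] S] bS1[OF
          y] bSy)
    also have "\<dots> = (S i (q i x) \<oplus>\<^bsub>grade X (i - 1)\<^esub> (\<ominus>\<^bsub>grade X (i - 1)\<^esub> bdry X i (H1 i x)
        \<oplus>\<^bsub>grade X (i - 1)\<^esub> H1 (i - 1) (bdry Q i x)))
        \<oplus>\<^bsub>grade X (i - 1)\<^esub> (bdry X i (H1 i x) \<oplus>\<^bsub>grade X (i - 1)\<^esub> bdry X i (S (i + 1) y))"
      using b Sq bSy by (simp add: Xj.group_simps)
    also have "\<dots> = bdry X i (H1 i x \<oplus>\<^bsub>grade X i\<^esub> S (i + 1) y)"
      unfolding hom_parts(1)[OF x, symmetric] lin_add[OF cpx_lin[OF X] b(3) Sy]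
      by (rule Xj.l_zero) (use b bSy in simp)
    finally show "?m (i - 1) (bdry ?W i c) = bdry X i (?m i c)"
      by (simp add: x_def[symmetric] y_def[symmetric])
  qed
  obtain y' e where y': "y' \<in> carrier (grade Q' (d + 1 + 1))" "e \<in> ideal_smult R I (grade Q' (d +
      1))"
    "q (d + 1) (z (d + 1)) = bdry Q' (d + 1 + 1) y' \<oplus>\<^bsub>grade Q' (d + 1)\<^esub> e"
    using Q'(5) unfolding dies_def by blast
  have Gd: "graph_mod R I (G d)" "(bdry Q (d + 1) (z (d + 1)), z d) \<in> induced R (G d) (grade Q d)"
    using G by auto
  \<comment> \<open>A value at \<open>e\<close> of the map belonging to \<open>G d\<close>; it will
    be the \<open>Q'\<close> coordinate of \<open>w0\<close>.\<close>
  obtain y'' where y'': "(e, y'') \<in> induced R (G d) (grade Q' (d + 1))"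
    using induced_total[OF Gd(1) y'(2)] by blast
  have zd: "z d \<in> carrier (grade Q d)" by (rule induced_closed(2)[OF cpx_module[OF Qc] Gd])
  have zd1: "z (d + 1) \<in> carrier (grade Q (d + 1))"
  \<comment> \<open>For \<open>n = 0\<close> this is the starting element; otherwise
    \<open>z (d + 1)\<close> occurs as a value of the relation in degree
    \<open>d + 1\<close>.\<close>
  proof (cases n)
    case 0
    then show ?thesis using z by simp
  next
    case (Suc k)
    then have "graph_mod R I (G (d + 1))" "(bdry Q (d + 1 + 1) (z (d + 1 + 1)), z (d + 1)) \<in> induced
        R (G (d + 1)) (grade Q (d + 1))"
      using G[rule_format, of "d + 1"] Suc by simp_all
    then show ?thesis by (rule induced_closed(2)[OF cpx_module[OF Qc]])
  qed
  have y''c: "y'' \<in> carrier (grade Q' (d + 1))" and ec: "e \<in> carrier (grade Q' (d + 1))"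
    using induced_closed[OF cpx_module[OF Q'c] Gd(1) y''] by auto
  \<comment> \<open>The boundary of \<open>w\<close> is the pair of the boundary of
    \<open>z (d + 1)\<close> and \<open>e\<close>. The graph \<open>G d\<close> relates the former
    to \<open>z d\<close> and the latter to \<open>y''\<close>, hence the boundary of
    \<open>w\<close> to \<open>w0\<close>.\<close>
  define w where "w = pair_seq (z (d + 1)) y'"
  define w0 where "w0 = pair_seq (z d) y''"
  have wc: "w \<in> carrier (grade ?W (d + 1))" using zd1 y' by (simp add: w_def)
  have bw: "bdry ?W (d + 1) w = pair_seq (bdry Q (d + 1) (z (d + 1))) e"
  proof -
    interpret N: abelian_group "grade Q' (d + 1)" by (rule ag[OF Q'c])
    have "bdry Q' (d + 1 + 1) y' \<in> carrier (grade Q' (d + 1))" by (rule lin_closed[OF cpx_lin1[OF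
        Q'c] y'(1)])
    then have "q (d + 1) (z (d + 1)) \<oplus>\<^bsub>grade Q' (d + 1)\<^esub> \<ominus>\<^bsub>grade Q' (d + 1)\<^esub> bdry Q' (d + 1 + 1) y' = e"
      unfolding y'(3) using ec by (simp only: N.group_simps N.a_inv_closed N.a_closed N.r_zero)
    then show ?thesis by (simp only: w_def fiber_simps pair_seq_simps)
  qed
  have wG: "(bdry ?W (d + 1) w, w0) \<in> induced R (G d) (grade ?W d)"
    unfolding bw w0_def fiber_simps(1)
    by (rule induced_seq_dsum[OF cpx_module[OF Qc] cpx_module[OF Q'c] Gd(1) Gd(2) y''])
  \<comment> \<open>Applying the differential to this relation gives (0, boundary of
    \<open>w0\<close>), and graph flatness of the fiber makes the second entry a multiple by
    \<open>I\<close>.\<close>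
  have w0I: "bdry ?W d w0 \<in> ideal_smult R I (grade ?W (d - 1))"
  proof -
    have "(bdry ?W d (bdry ?W (d + 1) w), bdry ?W d w0) \<in> induced R (G d) (grade ?W (d - 1))"
      by (rule induced_lin[OF cpx_module[OF Wc] Gd(1) cpx_lin[OF Wc] wG])
    then show ?thesis
      using W Gd(1) unfolding cpx_sq1[OF Wc wc] test_complex_def graph_flat_def by blast
  qed
  obtain W' :: "('r, nat \<Rightarrow> 'r) cpx" and v u where W': "test_complex TYPE('u \<times> 'u) R I W'"
    "chain_map R ?W W' v" "chain_map R W' X u" "homotopic R ?W X (\<lambda>j. u j \<circ> v j) ?m"
    "dies R I W' d (v d w0)"
  \<comment> \<open>A chain of length one: the value in degree \<open>d\<close> is
    \<open>w0\<close>, the one above it is \<open>w\<close>.\<close>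
  proof (rule killsD[OF kX W m, where z = "\<lambda>i. if i = d then w0 else w" and d = d and G = G])
    fix i assume "d \<le> i" "i < d + int (Suc 0)"
    then have i: "i = d" by simp
    show "graph_mod R I (G i)" using Gd i by simp
    show "(bdry ?W (i + 1) (if i + 1 = d then w0 else w), if i = d then w0 else w) \<in> induced R (G i)
        (grade ?W i)"
      using wG i by (simp del: fiber_simps)
  qed (use wc in \<open>simp_all del: fiber_simps\<close>)
  note W'c = test_complexD(2)[OF W'(1)]
  define \<tau> where "\<tau> = (\<lambda>i y. v (i - 1) (pair_seq \<zero>\<^bsub>grade Q (i - 1)\<^esub> y))"
  define j where "j = (\<lambda>i x. pair_seq (q i x) (\<ominus>\<^bsub>grade W' i\<^esub> v i (pair_seq x \<zero>\<^bsub>grade Q' (i + 1)\<^esub>)))"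
  note fac = factor_through_extension[OF Qc Q'c W'c X Y f q W'(2,3) S T H1 H2 cmap_lin[OF g] bT
      hom_parts(2) W'(4) \<tau>_def j_def]
  let ?E = "extension Q' W' \<tau>"
  have E: "test_complex TYPE('u \<times> 'u) R I ?E" by (rule extension_test_complex[OF I Q'(1) W'(1)
      fac(1,2)])
  obtain w' e' where w': "w' \<in> carrier (grade W' (d + 1))" "e' \<in> ideal_smult R I (grade W' d)"
    "v d w0 = bdry W' (d + 1) w' \<oplus>\<^bsub>grade W' d\<^esub> e'"
    using W'(5) unfolding dies_def by blast
  \<comment> \<open>The \<open>Q'\<close> coordinate of \<open>w0I\<close>: modulo \<open>I\<close>,
    the element \<open>q (z d)\<close> is already the boundary of \<open>y''\<close>.\<close>
  have qb: "q d (z d) \<oplus>\<^bsub>grade Q' d\<^esub> \<ominus>\<^bsub>grade Q' d\<^esub> bdry Q' (d + 1) y'' \<in> ideal_smult R I (grade Q' d)"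
    (is "?e1 \<in> _")
    using ideal_smult_lin[OF cpx_module[OF Wc] a_subset _ w0I, of "grade Q' d" snd_seq]
      seq_dsum_lin(2)[OF cpx_module[OF Qc] cpx_module[OF Q'c], of "d - 1" d]
    by (simp add: w0_def)
  have "dies R I ?E d (j d (z d))"
  proof -
    interpret N: abelian_group "grade Q' d" by (rule ag[OF Q'c])
    interpret N1: abelian_group "grade Q' (d + 1)" by (rule ag[OF Q'c])
    interpret M: abelian_group "grade Q d" by (rule ag[OF Qc])
    interpret V: abelian_group "grade W' d" by (rule ag[OF W'c])
    interpret V1: abelian_group "grade W' (d + 1)" by (rule ag[OF W'c])
    have c: "q d (z d) \<in> carrier (grade Q' d)" "bdry Q' (d + 1) y'' \<in> carrier (grade Q' d)"
      "bdry W' (d + 1) w' \<in> carrier (grade W' d)" "e' \<in> carrier (grade W' d)"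
      by (rule lin_closed[OF cmap_lin[OF q] zd] lin_closed[OF cpx_lin1[OF Q'c] y''c]
          lin_closed[OF cpx_lin1[OF W'c] w'(1)] ideal_smult_closed[OF cpx_module[OF W'c] a_subset
              w'(2)])+
    have vl: "lin_map R (seq_dsum (grade Q d) (grade Q' (d + 1))) (grade W' d) (v d)"
      using cmap_lin[OF W'(2), of d] by simp
    let ?a = "v d (pair_seq (z d) \<zero>\<^bsub>grade Q' (d + 1)\<^esub>)" and ?b = "v d (pair_seq \<zero>\<^bsub>grade Q d\<^esub> y'')"
    have ab: "?a \<in> carrier (grade W' d)" "?b \<in> carrier (grade W' d)"
      by (rule lin_closed[OF vl]; use zd y''c in simp)+
    have "v d (pair_seq (z d) \<zero>\<^bsub>grade Q' (d + 1)\<^esub> \<oplus>\<^bsub>seq_dsum (grade Q d) (grade Q' (d + 1))\<^esub>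
        pair_seq \<zero>\<^bsub>grade Q d\<^esub> y'') = ?a \<oplus>\<^bsub>grade W' d\<^esub> ?b"
      by (rule lin_add[OF vl]) (use zd y''c in simp_all)
    then have vab: "?a \<oplus>\<^bsub>grade W' d\<^esub> ?b = bdry W' (d + 1) w' \<oplus>\<^bsub>grade W' d\<^esub> e'"
      using w'(3) zd y''c by (simp add: w0_def)
    have "?a = (?a \<oplus>\<^bsub>grade W' d\<^esub> ?b) \<ominus>\<^bsub>grade W' d\<^esub> ?b" using ab by (simp add: V.group_simps)
    then have "\<ominus>\<^bsub>grade W' d\<^esub> ?a = \<ominus>\<^bsub>grade W' d\<^esub> ((bdry W' (d + 1) w' \<oplus>\<^bsub>grade W' d\<^esub> e') \<ominus>\<^bsub>grade W' d\<^esub> ?b)"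
      unfolding vab by (rule arg_cong)
    also have "\<dots> = (?b \<oplus>\<^bsub>grade W' d\<^esub> \<ominus>\<^bsub>grade W' d\<^esub> bdry W' (d + 1) w') \<oplus>\<^bsub>grade W' d\<^esub> \<ominus>\<^bsub>grade W' d\<^esub> e'"
      using ab c by (simp add: V.group_simps)
    finally have na: "\<ominus>\<^bsub>grade W' d\<^esub> ?a = (?b \<oplus>\<^bsub>grade W' d\<^esub> \<ominus>\<^bsub>grade W' d\<^esub> bdry W' (d + 1) w')
        \<oplus>\<^bsub>grade W' d\<^esub> \<ominus>\<^bsub>grade W' d\<^esub> e'" .
    have nw: "bdry W' (d + 1) (\<ominus>\<^bsub>grade W' (d + 1)\<^esub> w') = \<ominus>\<^bsub>grade W' d\<^esub> bdry W' (d + 1) w'"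
      by (rule lin_neg[OF cpx_module[OF W'c] cpx_module[OF W'c] cpx_lin1[OF W'c] w'(1)])
    have e1: "q d (z d) = bdry Q' (d + 1) y'' \<oplus>\<^bsub>grade Q' d\<^esub> ?e1"
      using c by (simp add: N.group_simps)
    have e1c: "?e1 \<in> carrier (grade Q' d)" using c by simp
    \<comment> \<open>The primitive is (y'', -w') and the remainder is (e1, -e'). In the second
      coordinate \<tau> y'' is the contribution of \<open>y''\<close> to \<open>v w0\<close>, which
      \<open>na\<close> has separated from that of \<open>z d\<close>.\<close>
    have "j d (z d) = bdry ?E (d + 1) (pair_seq y'' (\<ominus>\<^bsub>grade W' (d + 1)\<^esub> w')) \<oplus>\<^bsub>grade ?E d\<^esub>
        pair_seq ?e1 (\<ominus>\<^bsub>grade W' d\<^esub> e')"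
      unfolding j_def na using e1 by (simp add: \<tau>_def nw)
    moreover have "pair_seq ?e1 (\<ominus>\<^bsub>grade W' d\<^esub> e') \<in> ideal_smult R I (grade ?E d)"
      unfolding extension_simps
      by (rule ideal_smult_seq_dsum[OF cpx_module[OF Q'c] cpx_module[OF W'c] a_subset qb
            ideal_smult_neg[OF cpx_module[OF W'c] I w'(2)]])
    moreover have "pair_seq y'' (\<ominus>\<^bsub>grade W' (d + 1)\<^esub> w') \<in> carrier (grade ?E (d + 1))"
      using y''c w'(1) by simp
    ultimately show ?thesis unfolding dies_def by blast
  qed
  then show "killed R I Q Y g d (z d)"
    unfolding killed_def using E fac(3,4) by blast
qed

text \<open>Invariance under isomorphism in D(R) allows the exact triangle to be replaced by a
  strict cone triangle, to which \<open>kills_cone\<close> applies; the result passes from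
  \<open>Y\<close> to \<open>E\<close> and from there to the summand \<open>M\<close>.\<close>

lemma kills_thick:
  fixes M :: "('r, 'u) cpx"
  assumes R: "cring R" and I: "ideal I R"
  shows "thick R (Suc n) M \<Longrightarrow> kills R I (Suc n) M"
proof (induction n arbitrary: M)
  case 0
  then show ?case by (rule kills_thick_1[OF R I])
next
  case (Suc n)
  then obtain K L E N :: "('r, 'u) cpx" and \<alpha> \<beta> \<gamma>
    where *: "chain_complex R L" "chain_complex R M" "chain_isomorphic R E (dsum L M)"
      "thick R (Suc 0) K" "thick R (Suc n) N" "exact_triangle R K E N \<alpha> \<beta> \<gamma>"
    unfolding thick.simps(3) by blast
  from *(6) obtain X Y C :: "('r, 'u) cpx" and f g h a b c where tri: "cone_triangle R X Y C f g h"
    and isos: "D_iso R K X a" "D_iso R E Y b" "D_iso R N C c"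
    unfolding exact_triangle_def by blast
  obtain \<theta> where \<theta>: "chain_iso R C (cone X Y f) \<theta>"
    "\<forall>i. \<forall>y \<in> carrier (grade Y i). \<theta> i (g i y) = (\<zero>\<^bsub>grade X (i - 1)\<^esub>, y)"
    using tri by (auto simp: cone_triangle_def)
  have t: "chain_complex R X" "chain_complex R Y" "chain_map R X Y f" "chain_map R Y C g"
    using tri by (auto simp: cone_triangle_def)
  have C: "chain_complex R C" "chain_map R C (cone X Y f) \<theta>" using \<theta>(1) by (auto simp:
      chain_iso_def)
  have "kills R I (Suc (Suc n)) Y"
    by (rule kills_cone[OF I t(1,2) C(1) t(3,4) C(2) _ kills_D_iso[OF Suc.IH[OF *(5)] isos(3)]
          kills_D_iso[OF kills_thick_1[OF R I *(4)] isos(1)]]) (use \<theta>(2) in blast)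
  moreover obtain b' where "D_iso R Y E b'" using D_iso_sym[OF isos(2)] by blast
  ultimately have E: "kills R I (Suc (Suc n)) E" by (rule kills_D_iso)
  obtain \<theta>' where th: "chain_iso R E (dsum L M) \<theta>'" using *(3) by (auto simp: chain_isomorphic_def)
  obtain \<iota> \<pi> where "chain_map R M E \<iota>" "chain_map R E M \<pi>"
    "\<forall>i. \<forall>x\<in>carrier (grade M i). \<pi> i (\<iota> i x) = x"
    using dsum_retract(1)[OF th *(1,2)] by blast
  moreover have "chain_complex R E" using th by (simp add: chain_iso_def)
  ultimately show ?case using kills_retract[OF E *(2)] by blast
qed

section \<open>The lower bound for null-homotopic ideals\<close>

definition null_homotopic :: "('r, 'x) ring_scheme \<Rightarrow> ('r, 'a) cpx \<Rightarrow> 'r \<Rightarrow> bool" where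
  "null_homotopic R A y \<longleftrightarrow> (\<exists>h. (\<forall>i. lin_map R (grade A i) (grade A (i + 1)) (h i)) \<and>
     (\<forall>i. \<forall>x \<in> carrier (grade A i).
        y \<odot>\<^bsub>grade A i\<^esub> x = bdry A (i + 1) (h i x) \<oplus>\<^bsub>grade A i\<^esub> h (i - 1) (bdry A i x)))"

text \<open>The cone of multiplication by \<open>y\<close> on \<open>Q\<close>, that is, the tensor
  product of \<open>Q\<close> with the Koszul complex on \<open>y\<close>. Written as an
  \<open>extension\<close>, it stays over the type of \<open>Q\<close>.\<close>

definition mult_cone ::
  "('r, nat \<Rightarrow> 's) cpx \<Rightarrow> 'r \<Rightarrow> ('r, nat \<Rightarrow> 's) cpx" where
  "mult_cone Q y = extension (shift Q) Q (\<lambda>i x. y \<odot>\<^bsub>grade Q (i - 1)\<^esub> x)"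

lemma mult_cone_simps [simp]:
  "grade (mult_cone Q y) i = seq_dsum (grade Q (i - 1)) (grade Q i)"
  "bdry (mult_cone Q y) i c = pair_seq (\<ominus>\<^bsub>grade Q (i - 1 - 1)\<^esub> bdry Q (i - 1) (fst_seq c))
     (y \<odot>\<^bsub>grade Q (i - 1)\<^esub> fst_seq c \<oplus>\<^bsub>grade Q (i - 1)\<^esub> bdry Q i (snd_seq c))"
  by (simp_all add: mult_cone_def)

lemma mult_cone_test_complex:
  assumes I: "ideal I R" and Q: "test_complex TYPE('m) R I Q" and y: "y \<in> carrier R"
  shows "test_complex TYPE('m) R I (mult_cone Q y)"
  unfolding mult_cone_def
proof (rule extension_test_complex[OF I shift_test_complex[OF Q] Q])
  note Qc = test_complexD(2)[OF Q]
  fix i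
  show "lin_map R (grade (shift Q) i) (grade Q (i - 1)) (\<lambda>x. y \<odot>\<^bsub>grade Q (i - 1)\<^esub> x)"
    using lin_scale[OF cpx_module[OF Qc] lin_id y] by simp
  fix x assume "x \<in> carrier (grade (shift Q) i)"
  then have x: "x \<in> carrier (grade Q (i - 1))" by simp
  interpret M: module R "grade Q (i - 1 - 1)" by (rule cpx_module[OF Qc])
  have b: "bdry Q (i - 1) x \<in> carrier (grade Q (i - 1 - 1))" by (rule lin_closed[OF cpx_lin[OF Qc]
      x])
  have "y \<odot>\<^bsub>grade Q (i - 1 - 1)\<^esub> (\<ominus>\<^bsub>grade Q (i - 1 - 1)\<^esub> bdry Q (i - 1) x) \<oplus>\<^bsub>grade Q (i - 1 - 1)\<^esub>
      bdry Q (i - 1) (y \<odot>\<^bsub>grade Q (i - 1)\<^esub> x) = \<zero>\<^bsub>grade Q (i - 1 - 1)\<^esub>"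
    unfolding lin_smult[OF cpx_lin[OF Qc] y x] M.smult_r_minus[OF y b]
    by (rule M.M.l_neg[OF M.smult_closed[OF y b]])
  then show "y \<odot>\<^bsub>grade Q (i - 1 - 1)\<^esub> bdry (shift Q) i x \<oplus>\<^bsub>grade Q (i - 1 - 1)\<^esub>
      bdry Q (i - 1) (y \<odot>\<^bsub>grade Q (i - 1)\<^esub> x) = \<zero>\<^bsub>grade Q (i - 1 - 1)\<^esub>"
    by simp
qed

text \<open>A map out of the cone of multiplication by \<open>y\<close> is a map on \<open>Q\<close>
  with a null-homotopy of its multiple by \<open>y\<close>; here h g is such a
  null-homotopy.\<close>

lemma mult_cone_map:
  assumes Q: "chain_complex R Q" and A: "chain_complex R A" and g: "chain_map R Q A g" and y: "y \<in>
      carrier R"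
    and h: "\<And>i. lin_map R (grade A i) (grade A (i + 1)) (h i)"
    and hb: "\<And>i x. x \<in> carrier (grade A i) \<Longrightarrow>
      y \<odot>\<^bsub>grade A i\<^esub> x = bdry A (i + 1) (h i x) \<oplus>\<^bsub>grade A i\<^esub> h (i - 1) (bdry A i x)"
  shows "chain_map R (mult_cone Q y) A
    (\<lambda>i c. h (i - 1) (g (i - 1) (fst_seq c)) \<oplus>\<^bsub>grade A i\<^esub> g i (snd_seq c))" (is "chain_map R _ A ?g")
  unfolding chain_map_def
proof (intro conjI allI ballI)
  note mQ = cpx_module[OF Q] and mA = cpx_module[OF A]
  fix i
  have h': "lin_map R (grade A (i - 1)) (grade A i) (h (i - 1))" using h[of "i - 1"] by simp
  show "lin_map R (grade (mult_cone Q y) i) (grade A i) (?g i)"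
    using lin_plus[OF mA lin_comp[OF lin_comp[OF seq_dsum_lin(1)[OF mQ mQ] cmap_lin[OF g]] h']
        lin_comp[OF seq_dsum_lin(2)[OF mQ mQ] cmap_lin[OF g]]]
    by (simp add: comp_def)
  fix c assume c: "c \<in> carrier (grade (mult_cone Q y) i)"
  define x where "x = fst_seq c"
  define v where "v = snd_seq c"
  have x: "x \<in> carrier (grade Q (i - 1))" and v: "v \<in> carrier (grade Q i)" using c by (auto simp:
      x_def v_def)
  have h'': "lin_map R (grade A (i - 1 - 1)) (grade A (i - 1)) (h (i - 1 - 1))" using h[of "i - 1 -
      1"] by simp
  interpret Qj: module R "grade Q (i - 1)" by (rule mQ)
  interpret Aj: abelian_group "grade A (i - 1)" by (rule module.axioms(2)[OF mA])
  have c1: "bdry Q (i - 1) x \<in> carrier (grade Q (i - 1 - 1))" "bdry Q i v \<in> carrier (grade Q (i -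
      1))"
    "g (i - 1) x \<in> carrier (grade A (i - 1))" "g i v \<in> carrier (grade A i)"
    by (rule lin_closed[OF cpx_lin[OF Q] x] lin_closed[OF cpx_lin[OF Q] v] lin_closed[OF cmap_lin[OF
        g] x]
        lin_closed[OF cmap_lin[OF g] v])+
  have c2: "bdry A (i - 1) (g (i - 1) x) \<in> carrier (grade A (i - 1 - 1))" "h (i - 1) (g (i - 1) x) \<in>
      carrier (grade A i)"
    "bdry A i (g i v) \<in> carrier (grade A (i - 1))"
    by (rule lin_closed[OF cpx_lin[OF A] c1(3)] lin_closed[OF h' c1(3)] lin_closed[OF cpx_lin[OF A]
        c1(4)])+
  have c3: "h (i - 1 - 1) (bdry A (i - 1) (g (i - 1) x)) \<in> carrier (grade A (i - 1))"
    "bdry A i (h (i - 1) (g (i - 1) x)) \<in> carrier (grade A (i - 1))"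
    by (rule lin_closed[OF h'' c2(1)] lin_closed[OF cpx_lin[OF A] c2(2)])+
  have 1: "h (i - 1 - 1) (g (i - 1 - 1) (\<ominus>\<^bsub>grade Q (i - 1 - 1)\<^esub> bdry Q (i - 1) x)) =
      \<ominus>\<^bsub>grade A (i - 1)\<^esub> h (i - 1 - 1) (bdry A (i - 1) (g (i - 1) x))"
    unfolding lin_neg[OF mQ mA cmap_lin[OF g] c1(1)] cmap_bdry[OF g x] by (rule lin_neg[OF mA mA h''
        c2(1)])
  have 2: "g (i - 1) (y \<odot>\<^bsub>grade Q (i - 1)\<^esub> x \<oplus>\<^bsub>grade Q (i - 1)\<^esub> bdry Q i v) =
      (bdry A i (h (i - 1) (g (i - 1) x)) \<oplus>\<^bsub>grade A (i - 1)\<^esub> h (i - 1 - 1) (bdry A (i - 1) (g (i - 1)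
          x)))
      \<oplus>\<^bsub>grade A (i - 1)\<^esub> bdry A i (g i v)"
    using hb[OF c1(3)] unfolding lin_add[OF cmap_lin[OF g] Qj.smult_closed[OF y x] c1(2)]
        lin_smult[OF cmap_lin[OF g] y x]
      cmap_bdry[OF g v] by simp
  have "?g (i - 1) (bdry (mult_cone Q y) i c) =
      h (i - 1 - 1) (g (i - 1 - 1) (\<ominus>\<^bsub>grade Q (i - 1 - 1)\<^esub> bdry Q (i - 1) x)) \<oplus>\<^bsub>grade A (i - 1)\<^esub>
      g (i - 1) (y \<odot>\<^bsub>grade Q (i - 1)\<^esub> x \<oplus>\<^bsub>grade Q (i - 1)\<^esub> bdry Q i v)"
    by (simp only: mult_cone_simps pair_seq_simps x_def v_def)
  also have "\<dots> = bdry A i (h (i - 1) (g (i - 1) x)) \<oplus>\<^bsub>grade A (i - 1)\<^esub> bdry A i (g i v)"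
    unfolding 1 2 using c3 c2(3) by (simp only: Aj.group_simps Aj.a_closed Aj.a_inv_closed
        Aj.r_zero)
  also have "\<dots> = bdry A i (?g i c)"
    unfolding lin_add[OF cpx_lin[OF A] c2(2) c1(4), symmetric] by (simp only: x_def v_def)
  finally show "?g (i - 1) (bdry (mult_cone Q y) i c) = bdry A i (?g i c)" .
qed

text \<open>\<open>induced\<close> has no rule for zero, so some pair of \<open>G\<close> is applied
  to the zero vector.\<close>

lemma induced_zero:
  assumes "module R M" "graph_mod R I G" "(a, b) \<in> G"
  shows "(\<zero>\<^bsub>M\<^esub>, \<zero>\<^bsub>M\<^esub>) \<in> induced R G M"
proof -
  interpret M: module R M by fact
  have "a \<in> carrier R" "b \<in> carrier R" using assms by (auto simp: graph_mod_def)
  then show ?thesis using induced.prod[OF assms(3) M.zero_closed, of R] by simp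
qed

text \<open>
  Iterated cones build the Koszul complex on \<open>y\<^sub>0, \<dots>, y\<^bsub>k-1\<^esub>\<close>; there \<open>z i\<close> stands, up to sign, for
  \<open>e\<^sub>0 \<and> \<dots> \<and> e\<^bsub>i-1\<^esub>\<close>.
\<close>

definition koszul_chain ::
  "('r, 'x) ring_scheme \<Rightarrow> ('r, 'a) cpx \<Rightarrow> 'a \<Rightarrow> (nat \<Rightarrow> ('r \<times> 'r) set) \<Rightarrow> nat \<Rightarrow> nat \<Rightarrow>
    ('r, 'q) cpx \<Rightarrow> (int \<Rightarrow> 'q \<Rightarrow> 'a) \<Rightarrow> (int \<Rightarrow> 'q) \<Rightarrow> bool" where
  "koszul_chain R A u G n k Q g z \<longleftrightarrow> chain_map R Q A g \<and>
     g 0 (z 0) = u \<and> z 0 \<in> carrier (grade Q 0) \<and> bdry Q 0 (z 0) = \<zero>\<^bsub>grade Q (- 1)\<^esub> \<and>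
     z (int k) \<in> carrier (grade Q (int k)) \<and>
     (\<forall>i. 0 \<le> i \<and> i < int k \<longrightarrow> (bdry Q (i + 1) (z (i + 1)), z i) \<in> induced R (G (nat i)) (grade Q i))
         \<and>
     (\<forall>m. k \<le> m \<and> m < n \<longrightarrow>
       (bdry Q (int k) (z (int k)), \<zero>\<^bsub>grade Q (int k - 1)\<^esub>) \<in> induced R (G m) (grade Q (int k - 1)))"

text \<open>In the cone of \<open>y k\<close> the new top element (z k, 0) has boundary
  (-\<partial>(z k), y k z k). The graph \<open>G k\<close> sends this to (0, z k), because it sends
  \<open>y k\<close> to 1 and \<partial>(z k) to 0; a later graph \<open>G m\<close> sends both
  coordinates to zero. The last clause of \<open>koszul_chain\<close> records this vanishing for the
  steps still to come.\<close>

lemma koszul_tower: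
  fixes A :: "('r, 'a) cpx" and G :: "nat \<Rightarrow> ('r \<times> 'r) set"
  assumes R: "cring R" and I: "ideal I R" and A: "chain_complex R A"
    and u: "u \<in> carrier (grade A 0)" "bdry A 0 u = \<zero>\<^bsub>grade A (- 1)\<^esub>"
    and null: "\<And>k. k < n \<Longrightarrow> y k \<in> carrier R \<and> null_homotopic R A (y k)"
    and G: "\<And>k. k < n \<Longrightarrow> graph_mod R I (G k)"
    and one: "\<And>k. k < n \<Longrightarrow> (y k, \<one>\<^bsub>R\<^esub>) \<in> G k"
    and zero: "\<And>k m. k < m \<Longrightarrow> m < n \<Longrightarrow> (y k, \<zero>\<^bsub>R\<^esub>) \<in> G m"
  shows "k \<le> n \<Longrightarrow> \<exists>(Q :: ('r, nat \<Rightarrow> 'r) cpx) g z. test_complex TYPE('m) R I Q \<and> koszul_chain R A u G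
      n k Q g z"
proof (induction k)
  case 0
  interpret cring R by fact
  \<comment> \<open>The start is R in degree 0, with its unit vector as \<open>z 0\<close>; the map
    to \<open>A\<close> sends it to \<open>u\<close>.\<close>
  let ?Q = "sum_of_shifts R [0]"
  let ?z = "\<lambda>k. if k = 0 then \<one>\<^bsub>R\<^esub> else \<zero>\<^bsub>R\<^esub>"
  let ?g = "\<lambda>i (c :: nat \<Rightarrow> 'r). if i = 0 then c 0 \<odot>\<^bsub>grade A 0\<^esub> u else \<zero>\<^bsub>grade A i\<^esub>"
  interpret A0: module R "grade A 0" by (rule cpx_module[OF A])
  interpret A1: module R "grade A (- 1)" by (rule cpx_module[OF A])
  have T: "test_complex TYPE('m) R I ?Q" by (rule sum_of_shifts_test_complex[OF R I])
  have c0: "c 0 \<in> carrier R" if "c \<in> carrier (grade ?Q i)" for i and c :: "nat \<Rightarrow> 'r"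
    using free_module_coordinate[OF R] that by (auto simp: sum_of_shifts_def)
  have bQ: "bdry ?Q i c = \<zero>\<^bsub>grade ?Q j\<^esub>" for i j c by (simp add: sum_of_shifts_def free_module_def)
  have l: "lin_map R (grade ?Q i) (grade A i) (?g i)" for i
  proof (cases "i = 0")
    case True
    show ?thesis unfolding True
    proof (rule lin_mapI)
      fix c d assume c: "c \<in> carrier (grade ?Q 0)" and d: "d \<in> carrier (grade ?Q 0)"
      show "?g 0 (c \<oplus>\<^bsub>grade ?Q 0\<^esub> d) = ?g 0 c \<oplus>\<^bsub>grade A 0\<^esub> ?g 0 d"
        using A0.smult_l_distr[OF c0[OF c] c0[OF d] u(1)] by (simp add: sum_of_shifts_def
            free_module_def)
    next
      fix r c assume r: "r \<in> carrier R" and c: "c \<in> carrier (grade ?Q 0)"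
      show "?g 0 (r \<odot>\<^bsub>grade ?Q 0\<^esub> c) = r \<odot>\<^bsub>grade A 0\<^esub> ?g 0 c"
        using A0.smult_assoc1[OF r c0[OF c] u(1)] by (simp add: sum_of_shifts_def free_module_def)
    next
      show "?g 0 c \<in> carrier (grade A 0)" if "c \<in> carrier (grade ?Q 0)" for c
        using c0[OF that] u(1) by simp
    qed
  qed (simp add: lin_const_zero[OF cpx_module[OF A]])
  have g: "chain_map R ?Q A ?g"
    unfolding chain_map_def
  proof (intro conjI allI ballI l)
    fix i c assume c: "c \<in> carrier (grade ?Q i)"
    have "?g (i - 1) (bdry ?Q i c) = \<zero>\<^bsub>grade A (i - 1)\<^esub>"
      unfolding bQ[of i c "i - 1"]
      by (rule lin_zero[OF cpx_module[OF sum_of_shifts_cpx[OF R]] cpx_module[OF A] l])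
    moreover have "bdry A i (?g i c) = \<zero>\<^bsub>grade A (i - 1)\<^esub>"
    proof (cases "i = 0")
      case True
      then show ?thesis using lin_smult[OF cpx_lin[OF A] c0[OF c] u(1)] u(2) c0[OF c] by simp
    qed (simp add: lin_zero[OF cpx_module[OF A] cpx_module[OF A] cpx_lin[OF A]])
    ultimately show "?g (i - 1) (bdry ?Q i c) = bdry A i (?g i c)" by simp
  qed
  have z: "?z \<in> carrier (grade ?Q 0)" by (auto simp: sum_of_shifts_def free_module_def)
  have "(bdry ?Q 0 ?z, \<zero>\<^bsub>grade ?Q (0 - 1)\<^esub>) \<in> induced R (G m) (grade ?Q (0 - 1))" if "m < n" for m
    unfolding bQ[of 0 _ "0 - 1"]
    by (rule induced_zero[OF cpx_module[OF sum_of_shifts_cpx[OF R]] G[OF that] one[OF that]])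
  then have zm: "\<forall>m. 0 \<le> m \<and> m < n \<longrightarrow>
      (bdry ?Q (int 0) ?z, \<zero>\<^bsub>grade ?Q (int 0 - 1)\<^esub>) \<in> induced R (G m) (grade ?Q (int 0 - 1))"
    by simp
  have "koszul_chain R A u G n 0 ?Q ?g (\<lambda>_. ?z)"
    unfolding koszul_chain_def using g z zm bQ[of 0 ?z "- 1"] u(1) by auto
  with T show ?case by blast
next
  case (Suc k)
  then obtain Q :: "('r, nat \<Rightarrow> 'r) cpx" and g z where Q: "test_complex TYPE('m) R I Q"
    and kc: "koszul_chain R A u G n k Q g z"
    using Suc_leD by blast
  have g: "chain_map R Q A g"
    and z0: "g 0 (z 0) = u" "z 0 \<in> carrier (grade Q 0)" "bdry Q 0 (z 0) = \<zero>\<^bsub>grade Q (- 1)\<^esub>"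
    and zk: "z (int k) \<in> carrier (grade Q (int k))"
    and zi: "\<And>i. 0 \<le> i \<Longrightarrow> i < int k \<Longrightarrow> (bdry Q (i + 1) (z (i + 1)), z i) \<in> induced R (G (nat i))
        (grade Q i)"
    and zm: "\<And>m. k \<le> m \<Longrightarrow> m < n \<Longrightarrow>
      (bdry Q (int k) (z (int k)), \<zero>\<^bsub>grade Q (int k - 1)\<^esub>) \<in> induced R (G m) (grade Q (int k - 1))"
    using kc by (simp_all add: koszul_chain_def)
  have k: "k < n" using Suc.prems by simp
  have y: "y k \<in> carrier R" using null[OF k] by simp
  obtain h where h: "\<And>i. lin_map R (grade A i) (grade A (i + 1)) (h i)"
    "\<And>i x. x \<in> carrier (grade A i) \<Longrightarrow>
      y k \<odot>\<^bsub>grade A i\<^esub> x = bdry A (i + 1) (h i x) \<oplus>\<^bsub>grade A i\<^esub> h (i - 1) (bdry A i x)"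
    using null[OF k] by (auto simp: null_homotopic_def)
  note Qc = test_complexD(2)[OF Q]
  note mQ = cpx_module[OF Qc] and mA = cpx_module[OF A]
  let ?Q = "mult_cone Q (y k)"
  let ?g = "\<lambda>i c. h (i - 1) (g (i - 1) (fst_seq c)) \<oplus>\<^bsub>grade A i\<^esub> g i (snd_seq c)"
  \<comment> \<open>A new top element from the suspended copy of \<open>Q\<close>; all lower
    elements are carried along in the subcomplex \<open>Q\<close>.\<close>
  let ?z = "\<lambda>i. if i = int (Suc k) then pair_seq (z (int k)) \<zero>\<^bsub>grade Q (int k + 1)\<^esub>
      else pair_seq \<zero>\<^bsub>grade Q (i - 1)\<^esub> (z i)"
  have T: "test_complex TYPE('m) R I ?Q" by (rule mult_cone_test_complex[OF I Q y])
  have gm: "chain_map R ?Q A ?g" by (rule mult_cone_map[OF Qc A g y h])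
  have zero_closed: "\<zero>\<^bsub>grade Q i\<^esub> \<in> carrier (grade Q i)" for i
  proof -
    interpret module R "grade Q i" by (rule mQ)
    show ?thesis by simp
  qed
  have incl: "bdry ?Q i (pair_seq \<zero>\<^bsub>grade Q (i - 1)\<^esub> w) = pair_seq \<zero>\<^bsub>grade Q (i - 1 - 1)\<^esub> (bdry Q i w)"
    if w: "w \<in> carrier (grade Q i)" for i w
  proof -
    interpret M: module R "grade Q (i - 1)" by (rule mQ)
    interpret N: abelian_group "grade Q (i - 1 - 1)" by (rule module.axioms(2)[OF mQ])
    have "bdry Q i w \<in> carrier (grade Q (i - 1))" by (rule lin_closed[OF cpx_lin[OF Qc] w])
    then show ?thesis
      unfolding mult_cone_simps pair_seq_simps lin_zero[OF mQ mQ cpx_lin[OF Qc]] M.smult_r_null[OF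
          y] N.neg_zero
      by simp
  qed
  have top: "bdry ?Q (int k + 1) (pair_seq (z (int k)) \<zero>\<^bsub>grade Q (int k + 1)\<^esub>) =
      pair_seq (\<ominus>\<^bsub>grade Q (int k - 1)\<^esub> bdry Q (int k) (z (int k))) (y k \<odot>\<^bsub>grade Q (int k)\<^esub> z (int k))"
  proof -
    interpret M: module R "grade Q (int k)" by (rule mQ)
    have "bdry Q (int k + 1) \<zero>\<^bsub>grade Q (int k + 1)\<^esub> = \<zero>\<^bsub>grade Q (int k)\<^esub>"
      by (rule lin_zero[OF mQ mQ cpx_lin1[OF Qc]])
    then show ?thesis using y zk by simp
  qed
  \<comment> \<open>The sign from the suspension is harmless, since negation is linear and preserves
    induced pairs.\<close>
  have neg: "(\<ominus>\<^bsub>grade Q (int k - 1)\<^esub> bdry Q (int k) (z (int k)), \<zero>\<^bsub>grade Q (int k - 1)\<^esub>)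
      \<in> induced R (G m) (grade Q (int k - 1))" if m: "k \<le> m" "m < n" for m
  proof -
    interpret N: abelian_group "grade Q (int k - 1)" by (rule module.axioms(2)[OF mQ])
    show ?thesis
      using induced_lin[OF mQ G[OF m(2)] lin_uminus[OF mQ lin_id] zm[OF m]] unfolding N.neg_zero .
  qed
  have f1: "?g 0 (?z 0) = u"
  proof -
    interpret M: module R "grade A 0" by (rule mA)
    have "h (- 1) (g (- 1) \<zero>\<^bsub>grade Q (- 1)\<^esub>) = \<zero>\<^bsub>grade A 0\<^esub>"
      using lin_zero[OF mA mA h(1), of "- 1"] by (simp add: lin_zero[OF mQ mA cmap_lin[OF g]])
    then show ?thesis using z0(1) u(1) by simp
  qed
  have f2: "?z 0 \<in> carrier (grade ?Q 0)" using z0(2) zero_closed by simp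
  have f3: "bdry ?Q 0 (?z 0) = \<zero>\<^bsub>grade ?Q (- 1)\<^esub>"
    using incl[OF z0(2)] z0(3) by (simp del: mult_cone_simps(2))
  have f4: "?z (int (Suc k)) \<in> carrier (grade ?Q (int (Suc k)))"
    using zk zero_closed[of "int k + 1"] by (simp add: add.commute)
  \<comment> \<open>For \<open>i = k\<close> this is the computation at the new top element; below
    it, the old relation is transported along the inclusion of \<open>Q\<close>.\<close>
  have f5: "(bdry ?Q (i + 1) (?z (i + 1)), ?z i) \<in> induced R (G (nat i)) (grade ?Q i)"
    if i: "0 \<le> i" "i < int (Suc k)" for i
  proof (cases "i = int k")
    case True
    have "(pair_seq (\<ominus>\<^bsub>grade Q (int k - 1)\<^esub> bdry Q (int k) (z (int k))) (y k \<odot>\<^bsub>grade Q (int k)\<^esub> z (int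
        k)),
        pair_seq \<zero>\<^bsub>grade Q (int k - 1)\<^esub> (\<one>\<^bsub>R\<^esub> \<odot>\<^bsub>grade Q (int k)\<^esub> z (int k)))
        \<in> induced R (G k) (seq_dsum (grade Q (int k - 1)) (grade Q (int k)))"
      by (rule induced_seq_dsum[OF mQ mQ G[OF k] neg[OF le_refl k] induced.prod[OF one[OF k] zk]])
    moreover have "\<one>\<^bsub>R\<^esub> \<odot>\<^bsub>grade Q (int k)\<^esub> z (int k) = z (int k)" by (rule module.smult_one[OF mQ zk])
    ultimately show ?thesis using True top by (simp add: add.commute del: mult_cone_simps(2))
  next
    case False
    then have ik: "i < int k" using i by simp
    then have m: "nat i < n" using i k by simp
    have c: "z (i + 1) \<in> carrier (grade Q (i + 1))"
    proof (cases "i + 1 = int k")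
      case False
      then have "0 \<le> i + 1" "i + 1 < int k" using i ik by auto
      moreover from this have "nat (i + 1) < n" using k by simp
      ultimately show ?thesis using induced_closed(2)[OF mQ G zi] by blast
    qed (use zk in simp)
    have "(pair_seq \<zero>\<^bsub>grade Q (i - 1)\<^esub> (bdry Q (i + 1) (z (i + 1))), pair_seq \<zero>\<^bsub>grade Q (i - 1)\<^esub> (z i))
        \<in> induced R (G (nat i)) (seq_dsum (grade Q (i - 1)) (grade Q i))"
      by (rule induced_lin[OF mQ G[OF m] seq_dsum_lin(4)[OF mQ mQ] zi[OF i(1) ik]])
    then show ?thesis using incl[OF c] False i ik by (simp del: mult_cone_simps(2))
  qed
  \<comment> \<open>Here the zero entries of the dual basis enter: \<open>G m\<close> relates
    \<open>y k\<close> to 0 for k < m.\<close>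
  have f6: "(bdry ?Q (int (Suc k)) (?z (int (Suc k))), \<zero>\<^bsub>grade ?Q (int (Suc k) - 1)\<^esub>)
      \<in> induced R (G m) (grade ?Q (int (Suc k) - 1))" if m: "Suc k \<le> m" "m < n" for m
  proof -
    have "(pair_seq (\<ominus>\<^bsub>grade Q (int k - 1)\<^esub> bdry Q (int k) (z (int k))) (y k \<odot>\<^bsub>grade Q (int k)\<^esub> z (int
        k)),
        pair_seq \<zero>\<^bsub>grade Q (int k - 1)\<^esub> (\<zero>\<^bsub>R\<^esub> \<odot>\<^bsub>grade Q (int k)\<^esub> z (int k)))
        \<in> induced R (G m) (seq_dsum (grade Q (int k - 1)) (grade Q (int k)))"
      by (rule induced_seq_dsum[OF mQ mQ G[OF m(2)] neg induced.prod[OF zero zk]]) (use m in auto)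
    moreover have "\<zero>\<^bsub>R\<^esub> \<odot>\<^bsub>grade Q (int k)\<^esub> z (int k) = \<zero>\<^bsub>grade Q (int k)\<^esub>"
      by (rule module.smult_l_null[OF mQ zk])
    ultimately show ?thesis using top by (simp add: add.commute del: mult_cone_simps(2))
  qed
  have "koszul_chain R A u G n (Suc k) ?Q ?g ?z"
    unfolding koszul_chain_def
    by (intro conjI allI impI gm f1 f2 f3 f4; elim conjE) (rule f5 f6; assumption)+
  with T show ?case by blast
qed

lemma dies_add_boundary:
  assumes Q: "chain_complex R Q" and I: "I \<subseteq> carrier R" and z: "dies R I Q i z" and y: "y \<in> carrier
      (grade Q (i + 1))"
  shows "dies R I Q i (z \<oplus>\<^bsub>grade Q i\<^esub> bdry Q (i + 1) y)"
proof -
  interpret M: module R "grade Q i" by (rule cpx_module[OF Q])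
  interpret N: module R "grade Q (i + 1)" by (rule cpx_module[OF Q])
  obtain w e where w: "w \<in> carrier (grade Q (i + 1))" "e \<in> ideal_smult R I (grade Q i)"
    "z = bdry Q (i + 1) w \<oplus>\<^bsub>grade Q i\<^esub> e"
    using z by (auto simp: dies_def)
  have "e \<in> carrier (grade Q i)" by (rule ideal_smult_closed[OF cpx_module[OF Q] I w(2)])
  then have "z \<oplus>\<^bsub>grade Q i\<^esub> bdry Q (i + 1) y = bdry Q (i + 1) (w \<oplus>\<^bsub>grade Q (i + 1)\<^esub> y) \<oplus>\<^bsub>grade Q i\<^esub> e"
    using w(1,3) y lin_closed[OF cpx_lin1[OF Q]] by (simp add: lin_add[OF cpx_lin1[OF Q]] M.a_ac)
  then show ?thesis unfolding dies_def using w(1,2) y by (metis N.a_closed)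
qed

text \<open>If m \<le> n, the Koszul complex on the first m elements carries an m-fold composite
  that ends in an element mapped to \<open>u\<close>. As \<open>M\<close> kills such composites,
  \<open>u\<close> would die, against the assumption.\<close>

lemma thick_lower_bound:
  fixes A :: "('r, 'a) cpx" and M :: "('r, 'u) cpx" and G :: "nat \<Rightarrow> ('r \<times> 'r) set"
  assumes R: "cring R" and I: "ideal I R" and iso: "chain_isomorphic R A M" and M: "thick R m M"
    and u: "u \<in> carrier (grade A 0)" "bdry A 0 u = \<zero>\<^bsub>grade A (- 1)\<^esub>" and ndies: "\<not> dies R I A 0 u"
    and null: "\<And>k. k < n \<Longrightarrow> y k \<in> carrier R \<and> null_homotopic R A (y k)"
    and G: "\<And>k. k < n \<Longrightarrow> graph_mod R I (G k)"
    and one: "\<And>k. k < n \<Longrightarrow> (y k, \<one>\<^bsub>R\<^esub>) \<in> G k"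
    and zero: "\<And>k m. k < m \<Longrightarrow> m < n \<Longrightarrow> (y k, \<zero>\<^bsub>R\<^esub>) \<in> G m"
  shows "n < m"
proof (rule ccontr)
  assume "\<not> n < m"
  then have mn: "m \<le> n" by simp
  interpret ideal I R by fact
  obtain \<phi> where \<phi>: "chain_iso R A M \<phi>" using iso by (auto simp: chain_isomorphic_def)
  have Ac: "chain_complex R A" and Mc: "chain_complex R M" and \<phi>m: "chain_map R A M \<phi>"
    and bij: "\<And>i. bij_betw (\<phi> i) (carrier (grade A i)) (carrier (grade M i))"
    using \<phi> by (auto simp: chain_iso_def)
  have inv: "chain_map R M A (\<lambda>i. inv_into (carrier (grade A i)) (\<phi> i))"
    using chain_iso_inverse[OF \<phi>] by (simp add: chain_iso_def)
  interpret M0: module R "grade M 0" by (rule cpx_module[OF Mc])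
  have u': "\<phi> 0 u \<in> carrier (grade M 0)" by (rule lin_closed[OF cmap_lin[OF \<phi>m] u(1)])
  have u'b: "bdry M 0 (\<phi> 0 u) = \<zero>\<^bsub>grade M (- 1)\<^esub>"
    using cmap_bdry[OF \<phi>m u(1)] u(2) lin_zero[OF cpx_module[OF Ac] cpx_module[OF Mc] cmap_lin[OF
        \<phi>m], of "- 1"]
    by simp
  have ndies': "\<not> dies R I M 0 (\<phi> 0 u)"
    using dies_lin[OF Mc a_subset inv, of 0 "\<phi> 0 u"] ndies unfolding bij_betw_inv_into_left[OF bij
        u(1)] by blast
  show False
  proof (cases m)
    \<comment> \<open>\<open>kills_thick\<close> starts at level 1. At level 0 the complex is
      acyclic, so the cycle \<phi> u is itself a boundary.\<close>
    case 0
    then have "carrier (homology M 0) = {\<zero>\<^bsub>homology M 0\<^esub>}" using M by simp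
    then have "\<phi> 0 u \<in> boundaries M 0"
      by (rule acyclic_cycles[OF Mc]) (use u' u'b in \<open>simp add: cycles_iff\<close>)
    then obtain w where "w \<in> carrier (grade M (0 + 1))" "\<phi> 0 u = bdry M (0 + 1) w" by (auto simp:
        boundaries_def)
    moreover have "\<phi> 0 u \<oplus>\<^bsub>grade M 0\<^esub> \<zero>\<^bsub>grade M 0\<^esub> = \<phi> 0 u" using u' by simp
    ultimately have "dies R I M 0 (\<phi> 0 u)"
      unfolding dies_def using ideal_smult_zero[OF cpx_module[OF Mc] I, of 0] by metis
    with ndies' show False by blast
  next
    case (Suc m')
    have kills: "kills R I m M" using kills_thick[OF R I] M Suc by blast
    \<comment> \<open>The tower has height \<open>m\<close>, not \<open>n\<close>: its length must
      match the level of \<open>M\<close>.\<close>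
    have "\<exists>(Q :: ('r, nat \<Rightarrow> 'r) cpx) g z. test_complex TYPE('u \<times> 'u) R I Q \<and> koszul_chain R A u G n
        m Q g z"
      by (rule koszul_tower[OF R I Ac u null G one zero mn])
    then obtain Q :: "('r, nat \<Rightarrow> 'r) cpx" and g z where Q1: "test_complex TYPE('u \<times> 'u) R I Q"
      and kc: "koszul_chain R A u G n m Q g z"
      by blast
    then have Q: "test_complex TYPE('u \<times> 'u) R I Q" "chain_map R Q A g"
      and z: "g 0 (z 0) = u" "z 0 \<in> carrier (grade Q 0)" "bdry Q 0 (z 0) = \<zero>\<^bsub>grade Q (- 1)\<^esub>"
        "z (int m) \<in> carrier (grade Q (int m))"
        "\<And>i. 0 \<le> i \<Longrightarrow> i < int m \<Longrightarrow> (bdry Q (i + 1) (z (i + 1)), z i) \<in> induced R (G (nat i)) (grade Q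
            i)"
      by (simp_all add: koszul_chain_def)
    obtain Q' :: "('r, nat \<Rightarrow> 'r) cpx" and q g' where Q': "test_complex TYPE('u \<times> 'u) R I Q'"
      "chain_map R Q Q' q" "chain_map R Q' M g'" "homotopic R Q M (\<lambda>i. g' i \<circ> q i) (\<lambda>i. \<phi> i \<circ> g i)"
      "dies R I Q' 0 (q 0 (z 0))"
      by (rule killsD[OF kills Q(1) cmap_comp[OF Q(2) \<phi>m], where z = z and d = 0 and G = "\<lambda>i. G (nat
          i)"])
        (use z mn G in auto)
    have "homotopic R Q M (\<lambda>i. \<phi> i \<circ> g i) (\<lambda>i. g' i \<circ> q i)"
      by (rule homotopic_sym[OF test_complexD(2)[OF Q(1)] Mc cmap_lin[OF cmap_comp[OF Q(2) \<phi>m]]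
          Q'(4)])
    then obtain h where "homotopy R Q M (\<lambda>i. \<phi> i \<circ> g i) (\<lambda>i. g' i \<circ> q i) h" by (rule homotopicE)
    note h = homotopyD[OF this]
    have hz: "h 0 (z 0) \<in> carrier (grade M (0 + 1))" by (rule lin_closed[OF h(1) z(2)])
    have "h (- 1) \<zero>\<^bsub>grade Q (- 1)\<^esub> = \<zero>\<^bsub>grade M 0\<^esub>"
      using lin_zero[OF cpx_module[OF test_complexD(2)[OF Q(1)]] cpx_module[OF Mc] h(1), of "- 1"]
          by simp
    \<comment> \<open>As \<open>z 0\<close> is a cycle, the homotopy changes its image in
      \<open>M\<close> only by a boundary.\<close>
    then have "\<phi> 0 u = g' 0 (q 0 (z 0)) \<oplus>\<^bsub>grade M 0\<^esub> bdry M (0 + 1) (h 0 (z 0))"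
      using h(2)[OF z(2)] z(1,3) lin_closed[OF cpx_lin1[OF Mc] hz] by simp
    moreover have "dies R I M 0 (g' 0 (q 0 (z 0)) \<oplus>\<^bsub>grade M 0\<^esub> bdry M (0 + 1) (h 0 (z 0)))"
      by (rule dies_add_boundary[OF Mc a_subset dies_lin[OF test_complexD(2)[OF Q'(1)] a_subset
          Q'(3,5)] hz])
    ultimately show False using ndies' by simp
  qed
qed

section \<open>Free summands of the conormal module\<close>

text \<open>The union over representatives is a single coset: replacing r by i + r with i in I
  changes the product by i x, and replacing x by j + x with j in the square of I changes it by a
  multiple of j. Both lie in the square of I.\<close>

lemma conormal_smult:
  assumes R: "cring R" and I: "ideal I R" and r: "r \<in> carrier R" and x: "x \<in> I"
  shows "(I +>\<^bsub>R\<^esub> r) \<odot>\<^bsub>conormal R I\<^esub> ((I \<cdot>\<^bsub>R\<^esub> I) +>\<^bsub>R\<^esub> x) = (I \<cdot>\<^bsub>R\<^esub> I) +>\<^bsub>R\<^esub> (r \<otimes>\<^bsub>R\<^esub> x)"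
proof -
  interpret cring R by fact
  interpret I: ideal I R by fact
  interpret J: ideal "I \<cdot>\<^bsub>R\<^esub> I" R by (rule ideal_prod_is_ideal[OF I I])
  have xc: "x \<in> carrier R" using x by simp
  have "(I \<cdot>\<^bsub>R\<^esub> I) +>\<^bsub>R\<^esub> (r' \<otimes>\<^bsub>R\<^esub> x') = (I \<cdot>\<^bsub>R\<^esub> I) +>\<^bsub>R\<^esub> (r \<otimes>\<^bsub>R\<^esub> x)"
    if r': "r' \<in> I +>\<^bsub>R\<^esub> r" and x': "x' \<in> (I \<cdot>\<^bsub>R\<^esub> I) +>\<^bsub>R\<^esub> x" for r' x'
  proof -
    obtain i where i: "i \<in> I" "r' = i \<oplus>\<^bsub>R\<^esub> r" using r' by (auto simp: mem_rcoset)
    obtain j where j: "j \<in> I \<cdot>\<^bsub>R\<^esub> I" "x' = j \<oplus>\<^bsub>R\<^esub> x" using x' by (auto simp: mem_rcoset)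
    have c: "i \<in> carrier R" "j \<in> carrier R" using i j by auto
    have "i \<otimes>\<^bsub>R\<^esub> x \<in> I \<cdot>\<^bsub>R\<^esub> I" by (rule ideal_prod.prod[OF i(1) x])
    then have "(i \<oplus>\<^bsub>R\<^esub> r) \<otimes>\<^bsub>R\<^esub> j \<oplus>\<^bsub>R\<^esub> i \<otimes>\<^bsub>R\<^esub> x \<in> I \<cdot>\<^bsub>R\<^esub> I" (is "?e \<in> _")
      using J.I_l_closed[OF j(1), of "i \<oplus>\<^bsub>R\<^esub> r"] c r by simp
    moreover have "r' \<otimes>\<^bsub>R\<^esub> x' = ?e \<oplus>\<^bsub>R\<^esub> r \<otimes>\<^bsub>R\<^esub> x"
      using c r xc by (simp add: i(2) j(2) l_distr r_distr a_ac)
    ultimately show ?thesis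
      using rcoset_eq_iff[OF abelian_group_axioms J.is_additive_subgroup] c r xc i(2) j(2) by auto
  qed
  then have "(\<Union>r' \<in> I +>\<^bsub>R\<^esub> r. \<Union>x' \<in> (I \<cdot>\<^bsub>R\<^esub> I) +>\<^bsub>R\<^esub> x. (I \<cdot>\<^bsub>R\<^esub> I) +>\<^bsub>R\<^esub> (r' \<otimes>\<^bsub>R\<^esub> x')) =
      (\<Union>r' \<in> I +>\<^bsub>R\<^esub> r. \<Union>x' \<in> (I \<cdot>\<^bsub>R\<^esub> I) +>\<^bsub>R\<^esub> x. (I \<cdot>\<^bsub>R\<^esub> I) +>\<^bsub>R\<^esub> (r \<otimes>\<^bsub>R\<^esub> x))"
    by (intro SUP_cong refl)
  moreover have "r \<in> I +>\<^bsub>R\<^esub> r" "x \<in> (I \<cdot>\<^bsub>R\<^esub> I) +>\<^bsub>R\<^esub> x"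
    using r xc by (auto simp: mem_rcoset intro!: bexI[of _ "\<zero>\<^bsub>R\<^esub>"])
  then have "I +>\<^bsub>R\<^esub> r \<noteq> {}" "(I \<cdot>\<^bsub>R\<^esub> I) +>\<^bsub>R\<^esub> x \<noteq> {}" by blast+
  ultimately show ?thesis by (simp add: conormal_def)
qed

lemma conormal_carrier: "c \<in> carrier (conormal R I) \<longleftrightarrow> (\<exists>x\<in>I. c = (I \<cdot>\<^bsub>R\<^esub> I) +>\<^bsub>R\<^esub> x)"
  by (auto simp: conormal_def)

lemma conormal_add:
  assumes R: "cring R" and I: "ideal I R" and x: "x \<in> I" "y \<in> I"
  shows "((I \<cdot>\<^bsub>R\<^esub> I) +>\<^bsub>R\<^esub> x) \<oplus>\<^bsub>conormal R I\<^esub> ((I \<cdot>\<^bsub>R\<^esub> I) +>\<^bsub>R\<^esub> y) = (I \<cdot>\<^bsub>R\<^esub> I) +>\<^bsub>R\<^esub> (x \<oplus>\<^bsub>R\<^esub> y)"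
proof -
  interpret cring R by fact
  interpret I: ideal I R by fact
  interpret J: ideal "I \<cdot>\<^bsub>R\<^esub> I" R by (rule ideal_prod_is_ideal[OF I I])
  show ?thesis using x J.a_rcos_sum[of x y] by (simp add: conormal_def)
qed

lemma conormal_zero:
  assumes R: "cring R" and I: "ideal I R"
  shows "\<zero>\<^bsub>conormal R I\<^esub> = (I \<cdot>\<^bsub>R\<^esub> I) +>\<^bsub>R\<^esub> \<zero>\<^bsub>R\<^esub>"
proof -
  interpret cring R by fact
  interpret J: ideal "I \<cdot>\<^bsub>R\<^esub> I" R by (rule ideal_prod_is_ideal[OF I I])
  show ?thesis using a_coset_add_zero[OF J.a_subset] by (simp add: conormal_def)
qed

lemma Quot_carrier: "c \<in> carrier (R Quot I) \<longleftrightarrow> (\<exists>r\<in>carrier R. c = I +>\<^bsub>R\<^esub> r)"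
  by (auto simp: FactRing_def A_RCOSETS_def RCOSETS_def a_r_coset_def r_coset_def)

lemma conormal_module:
  assumes R: "cring R" and I: "ideal I R"
  shows "module (R Quot I) (conormal R I)"
proof -
  interpret cring R by fact
  interpret I: ideal I R by fact
  note simps = conormal_add[OF R I] conormal_zero[OF R I] conormal_smult[OF R I]
  have S: "cring (R Quot I)" by (rule I.quotient_is_cring[OF R])
  have Sadd: "(I +>\<^bsub>R\<^esub> r) \<oplus>\<^bsub>R Quot I\<^esub> (I +>\<^bsub>R\<^esub> s) = I +>\<^bsub>R\<^esub> (r \<oplus>\<^bsub>R\<^esub> s)"
    and Smult: "(I +>\<^bsub>R\<^esub> r) \<otimes>\<^bsub>R Quot I\<^esub> (I +>\<^bsub>R\<^esub> s) = I +>\<^bsub>R\<^esub> (r \<otimes>\<^bsub>R\<^esub> s)"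
    if "r \<in> carrier R" "s \<in> carrier R" for r s
    using ring_hom_add[OF I.rcos_ring_hom that] ring_hom_mult[OF I.rcos_ring_hom that] by simp_all
  show ?thesis
  proof (rule moduleI[OF S])
    show "abelian_group (conormal R I)"
    proof (rule abelian_groupI)
      fix c assume "c \<in> carrier (conormal R I)"
      then obtain x where x: "x \<in> I" "c = (I \<cdot>\<^bsub>R\<^esub> I) +>\<^bsub>R\<^esub> x" by (auto simp: conormal_carrier)
      then show "\<exists>d\<in>carrier (conormal R I). d \<oplus>\<^bsub>conormal R I\<^esub> c = \<zero>\<^bsub>conormal R I\<^esub>"
        by (intro bexI[of _ "(I \<cdot>\<^bsub>R\<^esub> I) +>\<^bsub>R\<^esub> (\<ominus>\<^bsub>R\<^esub> x)"])
          (auto simp: simps conormal_carrier l_neg)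
    next
      show "\<zero>\<^bsub>conormal R I\<^esub> \<in> carrier (conormal R I)"
        unfolding conormal_carrier simps using I.zero_closed by blast
    next
      fix c d assume "c \<in> carrier (conormal R I)" "d \<in> carrier (conormal R I)"
      then obtain x y where "x \<in> I" "c = (I \<cdot>\<^bsub>R\<^esub> I) +>\<^bsub>R\<^esub> x" "y \<in> I" "d = (I \<cdot>\<^bsub>R\<^esub> I) +>\<^bsub>R\<^esub> y"
        by (auto simp: conormal_carrier)
      then show "c \<oplus>\<^bsub>conormal R I\<^esub> d \<in> carrier (conormal R I)"
        unfolding conormal_carrier by (intro bexI[of _ "x \<oplus>\<^bsub>R\<^esub> y"]) (simp_all add: simps)
    qed (auto simp: conormal_carrier simps a_ac)
  next
    fix a b c assume "a \<in> carrier (R Quot I)" "b \<in> carrier (R Quot I)" "c \<in> carrier (conormal R I)"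
    then obtain r s x where *: "r \<in> carrier R" "a = I +>\<^bsub>R\<^esub> r" "s \<in> carrier R" "b = I +>\<^bsub>R\<^esub> s"
      "x \<in> I" "c = (I \<cdot>\<^bsub>R\<^esub> I) +>\<^bsub>R\<^esub> x" by (auto simp: conormal_carrier Quot_carrier)
    show "(a \<oplus>\<^bsub>R Quot I\<^esub> b) \<odot>\<^bsub>conormal R I\<^esub> c = a \<odot>\<^bsub>conormal R I\<^esub> c \<oplus>\<^bsub>conormal R I\<^esub> b \<odot>\<^bsub>conormal R I\<^esub> c"
      "(a \<otimes>\<^bsub>R Quot I\<^esub> b) \<odot>\<^bsub>conormal R I\<^esub> c = a \<odot>\<^bsub>conormal R I\<^esub> (b \<odot>\<^bsub>conormal R I\<^esub> c)"
      using * by (simp_all add: Sadd Smult simps I.I_l_closed l_distr m_assoc)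
  next
    fix a c d assume "a \<in> carrier (R Quot I)" "c \<in> carrier (conormal R I)" "d \<in> carrier (conormal R
        I)"
    then obtain r x y where *: "r \<in> carrier R" "a = I +>\<^bsub>R\<^esub> r"
      "x \<in> I" "c = (I \<cdot>\<^bsub>R\<^esub> I) +>\<^bsub>R\<^esub> x" "y \<in> I" "d = (I \<cdot>\<^bsub>R\<^esub> I) +>\<^bsub>R\<^esub> y"
      by (auto simp: conormal_carrier Quot_carrier)
    show "a \<odot>\<^bsub>conormal R I\<^esub> (c \<oplus>\<^bsub>conormal R I\<^esub> d) = a \<odot>\<^bsub>conormal R I\<^esub> c \<oplus>\<^bsub>conormal R I\<^esub> a \<odot>\<^bsub>conormal R I\<^esub> d"
      using * by (simp add: simps I.I_l_closed r_distr)
  next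
    fix a c assume "a \<in> carrier (R Quot I)" "c \<in> carrier (conormal R I)"
    then show "a \<odot>\<^bsub>conormal R I\<^esub> c \<in> carrier (conormal R I)"
      by (auto simp: conormal_carrier Quot_carrier simps intro: I.I_l_closed)
  next
    fix c assume "c \<in> carrier (conormal R I)"
    then obtain x where x: "x \<in> I" "c = (I \<cdot>\<^bsub>R\<^esub> I) +>\<^bsub>R\<^esub> x" by (auto simp: conormal_carrier)
    have "\<one>\<^bsub>R Quot I\<^esub> = I +>\<^bsub>R\<^esub> \<one>\<^bsub>R\<^esub>" by (simp add: FactRing_def)
    then show "\<one>\<^bsub>R Quot I\<^esub> \<odot>\<^bsub>conormal R I\<^esub> c = c" using x by (simp add: simps)
  qed
qed

lemma ex1_implies_unique: "\<exists>!x. P x \<Longrightarrow> P x \<Longrightarrow> P y \<Longrightarrow> x = y"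
  by blast

lemma (in module) submodule_finsum:
  assumes "submodule F R M" "finite A" "f \<in> A \<rightarrow> F"
  shows "(\<Oplus>\<^bsub>M\<^esub>i\<in>A. f i) \<in> F"
  using assms(2,3)
proof induction
  case empty
  have "\<zero>\<^bsub>M\<^esub> \<in> F" using submoduleE[OF assms(1)] by (metis M.l_neg ex_in_conv subsetD)
  then show ?case by simp
next
  case (insert a A)
  then have "f \<in> A \<rightarrow> carrier M" "f a \<in> carrier M" using submoduleE(1)[OF assms(1)] by auto
  with insert show ?case using submoduleE(5)[OF assms(1)] by simp
qed

text \<open>\<open>G k\<close> is the graph of the \<open>k\<close>-th coordinate function of the summand, as a map \<open>I \<rightarrow> R/I\<close>.\<close>

lemma conormal_coordinates:
  assumes R: "cring R" and I: "ideal I R"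
    and F: "direct_summand (R Quot I) (conormal R I) F" and free: "free_of_rank (R Quot I) (conormal
        R I) F n"
  shows "\<exists>y G. (\<forall>k<n. y k \<in> I \<and> graph_mod R I (G k) \<and> (y k, \<one>\<^bsub>R\<^esub>) \<in> G k) \<and>
    (\<forall>k<n. \<forall>m<n. k \<noteq> m \<longrightarrow> (y k, \<zero>\<^bsub>R\<^esub>) \<in> G m)"
proof -
  let ?S = "R Quot I" and ?N = "conormal R I"
  interpret R: cring R by fact
  interpret I: ideal I R by fact
  interpret N: module ?S ?N by (rule conormal_module[OF R I])
  interpret S: cring ?S by (rule I.quotient_is_cring[OF R])
  note q_hom = I.rcos_ring_hom
  obtain N' where F_sub: "submodule F ?S ?N" and N': "submodule N' ?S ?N" "F \<inter> N' = {\<zero>\<^bsub>?N\<^esub>}"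
    "F <+>\<^bsub>?N\<^esub> N' = carrier ?N"
    using F by (auto simp: direct_summand_def)
  note Fe = N.submoduleE[OF F_sub] and Ne = N.submoduleE[OF N'(1)]
  obtain e where e: "e \<in> {..<n} \<rightarrow> F"
    and uniq: "\<And>x. x \<in> F \<Longrightarrow> \<exists>!c. c \<in> {..<n} \<rightarrow>\<^sub>E carrier ?S \<and> x = (\<Oplus>\<^bsub>?N\<^esub>i\<in>{..<n}. c i \<odot>\<^bsub>?N\<^esub> e i)"
    using free by (auto simp: free_of_rank_def)
  have eN: "e i \<in> carrier ?N" if "i < n" for i using e that Fe(1) by auto
  define comb where "comb c = (\<Oplus>\<^bsub>?N\<^esub>i\<in>{..<n}. c i \<odot>\<^bsub>?N\<^esub> e i)" for c
  have combF: "comb c \<in> F" if "c \<in> {..<n} \<rightarrow> carrier ?S" for c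
    unfolding comb_def
    by (rule N.submodule_finsum[OF F_sub]) (use that e Fe(4) in auto)
  have combN: "comb c \<in> carrier ?N" if "c \<in> {..<n} \<rightarrow> carrier ?S" for c using combF[OF that] Fe(1) by
      blast
  \<comment> \<open>The uniqueness clause of \<open>free_of_rank\<close> concerns extensional
    families, so sums and multiples of coefficients are restricted to the index set.\<close>
  have comb_add: "comb (\<lambda>i\<in>{..<n}. c i \<oplus>\<^bsub>?S\<^esub> d i) = comb c \<oplus>\<^bsub>?N\<^esub> comb d"
    if c: "c \<in> {..<n} \<rightarrow> carrier ?S" and d: "d \<in> {..<n} \<rightarrow> carrier ?S" for c d
  proof -
    have "comb (\<lambda>i\<in>{..<n}. c i \<oplus>\<^bsub>?S\<^esub> d i) = (\<Oplus>\<^bsub>?N\<^esub>i\<in>{..<n}. c i \<odot>\<^bsub>?N\<^esub> e i \<oplus>\<^bsub>?N\<^esub> d i \<odot>\<^bsub>?N\<^esub> e i)"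
      unfolding comb_def
    proof (rule N.M.finsum_cong'[OF refl])
      show "(\<lambda>i. c i \<odot>\<^bsub>?N\<^esub> e i \<oplus>\<^bsub>?N\<^esub> d i \<odot>\<^bsub>?N\<^esub> e i) \<in> {..<n} \<rightarrow> carrier ?N"
        using funcset_mem[OF c] funcset_mem[OF d] eN by simp
      show "(\<lambda>i\<in>{..<n}. c i \<oplus>\<^bsub>?S\<^esub> d i) i \<odot>\<^bsub>?N\<^esub> e i = c i \<odot>\<^bsub>?N\<^esub> e i \<oplus>\<^bsub>?N\<^esub> d i \<odot>\<^bsub>?N\<^esub> e i"
        if i: "i \<in> {..<n}" for i
        using N.smult_l_distr[OF funcset_mem[OF c i] funcset_mem[OF d i] eN] i by simp
    qed
    also have "\<dots> = comb c \<oplus>\<^bsub>?N\<^esub> comb d"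
      unfolding comb_def
      by (rule N.M.finsum_addf) (use funcset_mem[OF c] funcset_mem[OF d] eN in auto)
    finally show ?thesis .
  qed
  have comb_smult: "comb (\<lambda>i\<in>{..<n}. s \<otimes>\<^bsub>?S\<^esub> c i) = s \<odot>\<^bsub>?N\<^esub> comb c"
    if c: "c \<in> {..<n} \<rightarrow> carrier ?S" and s: "s \<in> carrier ?S" for c s
  proof -
    have "comb (\<lambda>i\<in>{..<n}. s \<otimes>\<^bsub>?S\<^esub> c i) = (\<Oplus>\<^bsub>?N\<^esub>i\<in>{..<n}. s \<odot>\<^bsub>?N\<^esub> (c i \<odot>\<^bsub>?N\<^esub> e i))"
      unfolding comb_def
    proof (rule N.M.finsum_cong'[OF refl])
      show "(\<lambda>i. s \<odot>\<^bsub>?N\<^esub> (c i \<odot>\<^bsub>?N\<^esub> e i)) \<in> {..<n} \<rightarrow> carrier ?N"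
        using funcset_mem[OF c] s eN by simp
      show "(\<lambda>i\<in>{..<n}. s \<otimes>\<^bsub>?S\<^esub> c i) i \<odot>\<^bsub>?N\<^esub> e i = s \<odot>\<^bsub>?N\<^esub> (c i \<odot>\<^bsub>?N\<^esub> e i)"
        if i: "i \<in> {..<n}" for i
        using N.smult_assoc1[OF s funcset_mem[OF c i] eN] i by simp
    qed
    also have "\<dots> = s \<odot>\<^bsub>?N\<^esub> comb c"
      unfolding comb_def
      by (rule N.finsum_smult_ldistr[symmetric]) (use funcset_mem[OF c] s eN in auto)
    finally show ?thesis .
  qed
  have comb_delta: "comb (\<lambda>i\<in>{..<n}. if i = k then \<one>\<^bsub>?S\<^esub> else \<zero>\<^bsub>?S\<^esub>) = e k" if k: "k < n" for k
  proof -
    have "comb (\<lambda>i\<in>{..<n}. if i = k then \<one>\<^bsub>?S\<^esub> else \<zero>\<^bsub>?S\<^esub>) = (\<Oplus>\<^bsub>?N\<^esub>i\<in>{..<n}. if k = i then e i else \<zero>\<^bsub>?N\<^esub>)"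
      unfolding comb_def by (rule N.M.finsum_cong'[OF refl]) (use eN in auto)
    also have "\<dots> = e k"
      by (rule N.M.add.finprod_singleton) (use k eN in auto)
    finally show ?thesis .
  qed
  have comb_zero: "c i = \<zero>\<^bsub>?S\<^esub>" if c: "c \<in> {..<n} \<rightarrow>\<^sub>E carrier ?S" "comb c = \<zero>\<^bsub>?N\<^esub>" and i: "i < n" for c i
  proof -
    have "comb (\<lambda>i\<in>{..<n}. \<zero>\<^bsub>?S\<^esub>) = (\<Oplus>\<^bsub>?N\<^esub>i\<in>{..<n}. \<zero>\<^bsub>?N\<^esub>)"
      unfolding comb_def by (rule N.M.finsum_cong'[OF refl]) (use eN in auto)
    then have 0: "comb (\<lambda>i\<in>{..<n}. \<zero>\<^bsub>?S\<^esub>) = \<zero>\<^bsub>?N\<^esub>" by simp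
    have 1: "(\<lambda>i\<in>{..<n}. \<zero>\<^bsub>?S\<^esub>) \<in> {..<n} \<rightarrow>\<^sub>E carrier ?S" by simp
    have "\<zero>\<^bsub>?N\<^esub> \<in> F" using N'(2) by blast
    then have "\<exists>!c. c \<in> {..<n} \<rightarrow>\<^sub>E carrier ?S \<and> \<zero>\<^bsub>?N\<^esub> = comb c" unfolding comb_def by (rule uniq)
    then have "c = (\<lambda>i\<in>{..<n}. \<zero>\<^bsub>?S\<^esub>)"
      by (rule ex1_implies_unique[where P = "\<lambda>c. c \<in> {..<n} \<rightarrow>\<^sub>E carrier ?S \<and> \<zero>\<^bsub>?N\<^esub> = comb c"])
        (use c 0 1 in \<open>simp_all only:\<close>)
    then show ?thesis using i by simp
  qed
  have zN': "\<zero>\<^bsub>?N\<^esub> \<in> N'" using N'(2) by blast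
  \<comment> \<open>The component \<nu> in the complement is ignored, and \<open>r\<close> ranges
    over all representatives of the coset \<open>c k\<close>, so no representatives have to be
    chosen linearly.\<close>
  define G where "G k = {(a, r). a \<in> I \<and> r \<in> carrier R \<and> (\<exists>c \<in> {..<n} \<rightarrow>\<^sub>E carrier ?S. \<exists>\<nu> \<in> N'.
    (I \<cdot>\<^bsub>R\<^esub> I) +>\<^bsub>R\<^esub> a = comb c \<oplus>\<^bsub>?N\<^esub> \<nu> \<and> c k = I +>\<^bsub>R\<^esub> r)}" for k
  have G: "graph_mod R I (G k)" if k: "k < n" for k
    unfolding graph_mod_def
  proof (intro conjI allI impI ballI)
    show "G k \<subseteq> carrier R \<times> carrier R" by (auto simp: G_def)
  next
    fix a b a' b' assume "(a, b) \<in> G k" "(a', b') \<in> G k"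
    then obtain c \<nu> c' \<nu>' where *: "a \<in> I" "b \<in> carrier R" "c \<in> {..<n} \<rightarrow>\<^sub>E carrier ?S" "\<nu> \<in> N'"
      "(I \<cdot>\<^bsub>R\<^esub> I) +>\<^bsub>R\<^esub> a = comb c \<oplus>\<^bsub>?N\<^esub> \<nu>" "c k = I +>\<^bsub>R\<^esub> b"
      "a' \<in> I" "b' \<in> carrier R" "c' \<in> {..<n} \<rightarrow>\<^sub>E carrier ?S" "\<nu>' \<in> N'"
      "(I \<cdot>\<^bsub>R\<^esub> I) +>\<^bsub>R\<^esub> a' = comb c' \<oplus>\<^bsub>?N\<^esub> \<nu>'" "c' k = I +>\<^bsub>R\<^esub> b'"
      by (auto simp: G_def)
    have cc: "c \<in> {..<n} \<rightarrow> carrier ?S" "c' \<in> {..<n} \<rightarrow> carrier ?S" using * by (auto simp: PiE_def)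
    have nc: "\<nu> \<in> carrier ?N" "\<nu>' \<in> carrier ?N" using * Ne(1) by auto
    let ?c = "\<lambda>i\<in>{..<n}. c i \<oplus>\<^bsub>?S\<^esub> c' i"
    have "(I \<cdot>\<^bsub>R\<^esub> I) +>\<^bsub>R\<^esub> (a \<oplus>\<^bsub>R\<^esub> a') = comb ?c \<oplus>\<^bsub>?N\<^esub> (\<nu> \<oplus>\<^bsub>?N\<^esub> \<nu>')"
      unfolding conormal_add[OF R I *(1,7), symmetric] *(5,11) comb_add[OF cc]
      using combN[OF cc(1)] combN[OF cc(2)] nc by (simp add: N.M.a_ac)
    moreover have "?c \<in> {..<n} \<rightarrow>\<^sub>E carrier ?S" using funcset_mem[OF cc(1)] funcset_mem[OF cc(2)] by
        auto
    moreover have "?c k = I +>\<^bsub>R\<^esub> (b \<oplus>\<^bsub>R\<^esub> b')"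
      using k *(6,12) ring_hom_add[OF q_hom *(2,8)] by simp
    ultimately show "(a \<oplus>\<^bsub>R\<^esub> a', b \<oplus>\<^bsub>R\<^esub> b') \<in> G k"
      unfolding G_def using *(1,2,7,8) Ne(5)[OF *(4,10)] by blast
  next
    fix r a b assume r: "r \<in> carrier R" and "(a, b) \<in> G k"
    then obtain c \<nu> where *: "a \<in> I" "b \<in> carrier R" "c \<in> {..<n} \<rightarrow>\<^sub>E carrier ?S" "\<nu> \<in> N'"
      "(I \<cdot>\<^bsub>R\<^esub> I) +>\<^bsub>R\<^esub> a = comb c \<oplus>\<^bsub>?N\<^esub> \<nu>" "c k = I +>\<^bsub>R\<^esub> b"
      by (auto simp: G_def)
    have cc: "c \<in> {..<n} \<rightarrow> carrier ?S" using * by (auto simp: PiE_def)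
    have nc: "\<nu> \<in> carrier ?N" using * Ne(1) by auto
    let ?s = "I +>\<^bsub>R\<^esub> r"
    have s: "?s \<in> carrier ?S" using r by (auto simp: Quot_carrier)
    let ?c = "\<lambda>i\<in>{..<n}. ?s \<otimes>\<^bsub>?S\<^esub> c i"
    have "(I \<cdot>\<^bsub>R\<^esub> I) +>\<^bsub>R\<^esub> (r \<otimes>\<^bsub>R\<^esub> a) = comb ?c \<oplus>\<^bsub>?N\<^esub> (?s \<odot>\<^bsub>?N\<^esub> \<nu>)"
      unfolding conormal_smult[OF R I r *(1), symmetric] *(5) comb_smult[OF cc s]
      by (rule N.smult_r_distr[OF s combN[OF cc] nc])
    moreover have "?c \<in> {..<n} \<rightarrow>\<^sub>E carrier ?S" using funcset_mem[OF cc] s by auto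
    moreover have "?c k = I +>\<^bsub>R\<^esub> (r \<otimes>\<^bsub>R\<^esub> b)"
      using k *(6) ring_hom_mult[OF q_hom r *(2)] by simp
    ultimately show "(r \<otimes>\<^bsub>R\<^esub> a, r \<otimes>\<^bsub>R\<^esub> b) \<in> G k"
      unfolding G_def using *(1,2) r Ne(4)[OF s *(4)] I.I_l_closed[OF *(1) r] by blast
  next
    fix a assume a: "a \<in> I"
    then have "(I \<cdot>\<^bsub>R\<^esub> I) +>\<^bsub>R\<^esub> a \<in> F <+>\<^bsub>?N\<^esub> N'" unfolding N'(3) by (auto simp: conormal_carrier)
    then obtain x \<nu> where x: "x \<in> F" "\<nu> \<in> N'" "(I \<cdot>\<^bsub>R\<^esub> I) +>\<^bsub>R\<^esub> a = x \<oplus>\<^bsub>?N\<^esub> \<nu>" by (auto simp: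
        set_add_def')
    obtain c where c: "c \<in> {..<n} \<rightarrow>\<^sub>E carrier ?S" "x = comb c" using uniq[OF x(1)] unfolding comb_def
        by blast
    have "c k \<in> carrier ?S" using c(1) k by auto
    then obtain r where "r \<in> carrier R" "c k = I +>\<^bsub>R\<^esub> r" by (auto simp: Quot_carrier)
    then show "\<exists>b. (a, b) \<in> G k" unfolding G_def using a c x by blast
  next
    fix b assume "(\<zero>\<^bsub>R\<^esub>, b) \<in> G k"
    then obtain c \<nu> where *: "b \<in> carrier R" "c \<in> {..<n} \<rightarrow>\<^sub>E carrier ?S" "\<nu> \<in> N'"
      "\<zero>\<^bsub>?N\<^esub> = comb c \<oplus>\<^bsub>?N\<^esub> \<nu>" "c k = I +>\<^bsub>R\<^esub> b"
      by (auto simp: G_def conormal_zero[OF R I])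
    have cc: "c \<in> {..<n} \<rightarrow> carrier ?S" using * by (auto simp: PiE_def)
    have nc: "\<nu> \<in> carrier ?N" using * Ne(1) by auto
    \<comment> \<open>If the class of \<open>a\<close> is zero, the part in \<open>F\<close> is the
      negative of the part in the complement. It lies in both submodules, so it vanishes, and by
      uniqueness all coordinates do.\<close>
    have "comb c = \<ominus>\<^bsub>?N\<^esub> \<nu>" using N.M.minus_equality[OF *(4)[symmetric] nc combN[OF cc]] by simp
    then have "comb c \<in> F \<inter> N'" using combF[OF cc] Ne(3)[OF *(3)] by simp
    then have "comb c = \<zero>\<^bsub>?N\<^esub>" using N'(2) by blast
    then have "I +>\<^bsub>R\<^esub> b = I" using comb_zero[OF *(2) _ k] *(5) by (simp add: FactRing_def)
    then show "b \<in> I" using R.a_coset_join1[OF _ *(1) I.a_subgroup] by simp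
  qed
  have "\<forall>k. \<exists>x. k < n \<longrightarrow> x \<in> I \<and> e k = (I \<cdot>\<^bsub>R\<^esub> I) +>\<^bsub>R\<^esub> x" using eN by (auto simp: conormal_carrier)
  then obtain y where y: "\<And>k. k < n \<Longrightarrow> y k \<in> I \<and> e k = (I \<cdot>\<^bsub>R\<^esub> I) +>\<^bsub>R\<^esub> y k" by metis
  have "(y k, if m = k then \<one>\<^bsub>R\<^esub> else \<zero>\<^bsub>R\<^esub>) \<in> G m" if k: "k < n" and m: "m < n" for k m
  proof -
    let ?c = "\<lambda>i\<in>{..<n}. if i = k then \<one>\<^bsub>?S\<^esub> else \<zero>\<^bsub>?S\<^esub>"
    have "(I \<cdot>\<^bsub>R\<^esub> I) +>\<^bsub>R\<^esub> y k = comb ?c \<oplus>\<^bsub>?N\<^esub> \<zero>\<^bsub>?N\<^esub>"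
      unfolding comb_delta[OF k] using y[OF k] eN[OF k] by simp
    moreover have "?c \<in> {..<n} \<rightarrow>\<^sub>E carrier ?S" by auto
    moreover have "?c m = I +>\<^bsub>R\<^esub> (if m = k then \<one>\<^bsub>R\<^esub> else \<zero>\<^bsub>R\<^esub>)"
      using m R.a_coset_add_zero[OF I.a_subset] by (simp add: FactRing_def)
    moreover have "(if m = k then \<one>\<^bsub>R\<^esub> else \<zero>\<^bsub>R\<^esub>) \<in> carrier R" by simp
    ultimately show ?thesis unfolding G_def using y[OF k] zN' by blast
  qed
  from this[of k k for k] this have "\<forall>k<n. (y k, \<one>\<^bsub>R\<^esub>) \<in> G k"
    "\<forall>k<n. \<forall>m<n. k \<noteq> m \<longrightarrow> (y k, \<zero>\<^bsub>R\<^esub>) \<in> G m"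
    by (metis, metis)
  then show ?thesis using y G by blast
qed

section \<open>Null-homotopic elements\<close>

text \<open>Null-homotopies can be added and scaled. This reduces null-homotopy for all elements of
  an ideal to its generators.\<close>

lemma null_homotopic_ideal:
  assumes R: "cring R" and A: "chain_complex R A"
  shows "ideal {y \<in> carrier R. null_homotopic R A y} R"
proof -
  interpret cring R by fact
  let ?N = "{y \<in> carrier R. null_homotopic R A y}"
  note mA = cpx_module[OF A]
  have add: "y \<oplus>\<^bsub>R\<^esub> z \<in> ?N" if y: "y \<in> ?N" and z: "z \<in> ?N" for y z
  proof -
    obtain h where h: "\<And>i. lin_map R (grade A i) (grade A (i + 1)) (h i)"
      "\<And>i x. x \<in> carrier (grade A i) \<Longrightarrow>
        y \<odot>\<^bsub>grade A i\<^esub> x = bdry A (i + 1) (h i x) \<oplus>\<^bsub>grade A i\<^esub> h (i - 1) (bdry A i x)"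
      using y by (auto simp: null_homotopic_def)
    obtain k where k: "\<And>i. lin_map R (grade A i) (grade A (i + 1)) (k i)"
      "\<And>i x. x \<in> carrier (grade A i) \<Longrightarrow>
        z \<odot>\<^bsub>grade A i\<^esub> x = bdry A (i + 1) (k i x) \<oplus>\<^bsub>grade A i\<^esub> k (i - 1) (bdry A i x)"
      using z by (auto simp: null_homotopic_def)
    have "null_homotopic R A (y \<oplus>\<^bsub>R\<^esub> z)"
      unfolding null_homotopic_def
    proof (intro exI conjI allI ballI)
      show "lin_map R (grade A i) (grade A (i + 1)) (\<lambda>x. h i x \<oplus>\<^bsub>grade A (i + 1)\<^esub> k i x)" for i
        by (rule lin_plus[OF mA h(1) k(1)])
      fix i x assume x: "x \<in> carrier (grade A i)"
      interpret M: module R "grade A i" by (rule mA)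
      note b = lin_closed[OF cpx_lin[OF A] x]
      have c: "bdry A (i + 1) (h i x) \<in> carrier (grade A i)" "bdry A (i + 1) (k i x) \<in> carrier
          (grade A i)"
        by (rule lin_closed[OF cpx_lin1[OF A] lin_closed[OF h(1) x]] lin_closed[OF cpx_lin1[OF A]
            lin_closed[OF k(1) x]])+
      have d: "h (i - 1) (bdry A i x) \<in> carrier (grade A i)" "k (i - 1) (bdry A i x) \<in> carrier
          (grade A i)"
        using lin_closed[OF h(1) b] lin_closed[OF k(1) b] by simp_all
      have "(y \<oplus>\<^bsub>R\<^esub> z) \<odot>\<^bsub>grade A i\<^esub> x = y \<odot>\<^bsub>grade A i\<^esub> x \<oplus>\<^bsub>grade A i\<^esub> z \<odot>\<^bsub>grade A i\<^esub> x"
        by (rule M.smult_l_distr) (use y z x in auto)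
      then show "(y \<oplus>\<^bsub>R\<^esub> z) \<odot>\<^bsub>grade A i\<^esub> x = bdry A (i + 1) (h i x \<oplus>\<^bsub>grade A (i + 1)\<^esub> k i x) \<oplus>\<^bsub>grade A i\<^esub>
          (h (i - 1) (bdry A i x) \<oplus>\<^bsub>grade A (i - 1 + 1)\<^esub> k (i - 1) (bdry A i x))"
        unfolding h(2)[OF x] k(2)[OF x] lin_add[OF cpx_lin1[OF A] lin_closed[OF h(1) x]
            lin_closed[OF k(1) x]]
        using c d by (simp add: M.M.a_ac)
    qed
    then show ?thesis using y z by simp
  qed
  have mult: "r \<otimes>\<^bsub>R\<^esub> y \<in> ?N" if r: "r \<in> carrier R" and y: "y \<in> ?N" for r y
  proof -
    obtain h where h: "\<And>i. lin_map R (grade A i) (grade A (i + 1)) (h i)"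
      "\<And>i x. x \<in> carrier (grade A i) \<Longrightarrow>
        y \<odot>\<^bsub>grade A i\<^esub> x = bdry A (i + 1) (h i x) \<oplus>\<^bsub>grade A i\<^esub> h (i - 1) (bdry A i x)"
      using y by (auto simp: null_homotopic_def)
    have "null_homotopic R A (r \<otimes>\<^bsub>R\<^esub> y)"
      unfolding null_homotopic_def
    proof (intro exI conjI allI ballI)
      show "lin_map R (grade A i) (grade A (i + 1)) (\<lambda>x. r \<odot>\<^bsub>grade A (i + 1)\<^esub> h i x)" for i
        by (rule lin_scale[OF mA h(1) r])
      fix i x assume x: "x \<in> carrier (grade A i)"
      interpret M: module R "grade A i" by (rule mA)
      note b = lin_closed[OF cpx_lin[OF A] x]
      have c: "bdry A (i + 1) (h i x) \<in> carrier (grade A i)"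
        by (rule lin_closed[OF cpx_lin1[OF A] lin_closed[OF h(1) x]])
      have d: "h (i - 1) (bdry A i x) \<in> carrier (grade A i)"
        using lin_closed[OF h(1) b] by simp
      have "(r \<otimes>\<^bsub>R\<^esub> y) \<odot>\<^bsub>grade A i\<^esub> x = r \<odot>\<^bsub>grade A i\<^esub> (y \<odot>\<^bsub>grade A i\<^esub> x)"
        by (rule M.smult_assoc1) (use y r x in auto)
      then show "(r \<otimes>\<^bsub>R\<^esub> y) \<odot>\<^bsub>grade A i\<^esub> x = bdry A (i + 1) (r \<odot>\<^bsub>grade A (i + 1)\<^esub> h i x) \<oplus>\<^bsub>grade A i\<^esub>
          (r \<odot>\<^bsub>grade A (i - 1 + 1)\<^esub> h (i - 1) (bdry A i x))"
        unfolding h(2)[OF x] lin_smult[OF cpx_lin1[OF A] r lin_closed[OF h(1) x]]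
        using c d r by (simp add: M.smult_r_distr)
    qed
    then show ?thesis using y r by simp
  qed
  have zero: "\<zero>\<^bsub>R\<^esub> \<in> ?N"
  proof -
    have "null_homotopic R A \<zero>\<^bsub>R\<^esub>"
      unfolding null_homotopic_def
    proof (intro exI conjI allI ballI)
      show "lin_map R (grade A i) (grade A (i + 1)) (\<lambda>x. \<zero>\<^bsub>grade A (i + 1)\<^esub>)" for i
        by (rule lin_const_zero[OF mA])
      fix i x assume x: "x \<in> carrier (grade A i)"
      interpret M: module R "grade A i" by (rule mA)
      show "\<zero>\<^bsub>R\<^esub> \<odot>\<^bsub>grade A i\<^esub> x = bdry A (i + 1) \<zero>\<^bsub>grade A (i + 1)\<^esub> \<oplus>\<^bsub>grade A i\<^esub> \<zero>\<^bsub>grade A (i - 1 + 1)\<^esub>"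
        unfolding lin_zero[OF mA mA cpx_lin1[OF A]] using x by simp
    qed
    then show ?thesis by simp
  qed
  \<comment> \<open>A negative is the multiple by -1.\<close>
  have neg: "\<ominus>\<^bsub>R\<^esub> y \<in> ?N" if y: "y \<in> ?N" for y
    using mult[OF _ y, of "\<ominus>\<^bsub>R\<^esub> \<one>\<^bsub>R\<^esub>"] y by (simp add: l_minus)
  show ?thesis
  proof (rule idealI)
    show "ring R" by (rule ring_axioms)
    show "subgroup ?N (add_monoid R)"
      using add zero neg by unfold_locales (auto simp: a_inv_def[symmetric])
    show "r \<otimes>\<^bsub>R\<^esub> y \<in> ?N" if "y \<in> ?N" "r \<in> carrier R" for y r by (rule mult[OF that(2,1)])
    show "y \<otimes>\<^bsub>R\<^esub> r \<in> ?N" if "y \<in> ?N" "r \<in> carrier R" for y r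
      using mult[OF that(2,1)] that by (simp add: m_comm)
  qed
qed

text \<open>The common core of both inequalities. The premise \<open>chain_complex R A\<close> is
  supplied by the isomorphic copy of \<open>A\<close> in the definition of \<open>level\<close>; if
  there is no copy in any stage, the infimum is infinite.\<close>

lemma level_lower_bound:
  fixes A :: "('r, 'a) cpx"
  assumes R: "cring R" and I: "ideal I R"
    and unit: "chain_complex R A \<Longrightarrow>
      \<exists>u \<in> carrier (grade A 0). bdry A 0 u = \<zero>\<^bsub>grade A (- 1)\<^esub> \<and> \<not> dies R I A 0 u"
    and null: "\<And>y. chain_complex R A \<Longrightarrow> y \<in> I \<Longrightarrow> null_homotopic R A y"
  shows "level TYPE('u) R A \<ge> free_rank (R Quot I) (conormal R I) + 1"
  unfolding level_def
proof (rule Inf_greatest)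
  fix l assume "l \<in> {enat n | n. \<exists>M :: ('r, 'u) cpx. chain_isomorphic R A M \<and> thick R n M}"
  then obtain m and M :: "('r, 'u) cpx" where l: "l = enat m" and iso: "chain_isomorphic R A M" and
      M: "thick R m M"
    by blast
  have A: "chain_complex R A" using iso by (auto simp: chain_isomorphic_def chain_iso_def)
  interpret ideal I R by fact
  obtain u where u: "u \<in> carrier (grade A 0)" "bdry A 0 u = \<zero>\<^bsub>grade A (- 1)\<^esub>" "\<not> dies R I A 0 u"
    using unit[OF A] by blast
  \<comment> \<open>The bound for an empty family, with dummy values; it makes \<open>m - 1\<close>
    a genuine predecessor.\<close>
  have pos: "0 < m"
    by (rule thick_lower_bound[OF R I iso M u, where y = "\<lambda>_. \<zero>\<^bsub>R\<^esub>" and G = "\<lambda>_. {}"]) auto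
  have "n < m" if F: "direct_summand (R Quot I) (conormal R I) F"
    and free: "free_of_rank (R Quot I) (conormal R I) F n" for F n
  proof -
    obtain y G where yG: "\<forall>k<n. y k \<in> I \<and> graph_mod R I (G k) \<and> (y k, \<one>\<^bsub>R\<^esub>) \<in> G k"
      "\<forall>k<n. \<forall>m<n. k \<noteq> m \<longrightarrow> (y k, \<zero>\<^bsub>R\<^esub>) \<in> G m"
      using conormal_coordinates[OF R I F free] by blast
    show ?thesis
      by (rule thick_lower_bound[OF R I iso M u, where y = y and G = G]) (use yG null[OF A] in auto)
  qed
  \<comment> \<open>Every rank is below \<open>m\<close>, so the supremum is at most
    \<open>m - 1\<close>, also when ranks were not known to be bounded.\<close>
  then have "free_rank (R Quot I) (conormal R I) \<le> enat (m - 1)"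
    unfolding free_rank_def by (intro Sup_least) fastforce
  then have "free_rank (R Quot I) (conormal R I) + 1 \<le> enat (m - 1) + 1" by (rule add_right_mono)
  also have "\<dots> = l" using pos by (simp add: l one_enat_def)
  finally show "free_rank (R Quot I) (conormal R I) + 1 \<le> l" .
qed

section \<open>Differential graded algebras\<close>

lemma boundaries_smult:
  assumes X: "chain_complex R X" and r: "r \<in> carrier R" and b: "b \<in> boundaries X i"
  shows "r \<odot>\<^bsub>grade X i\<^esub> b \<in> boundaries X i"
proof -
  interpret module R "grade X (i + 1)" by (rule cpx_module[OF X])
  obtain y where "y \<in> carrier (grade X (i + 1))" "b = bdry X (i + 1) y" using b by (auto simp:
      boundaries_def)
  then show ?thesis
    using lin_smult[OF cpx_lin1[OF X] r] r unfolding boundaries_def by (metis imageI smult_closed)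
qed

text \<open>The isomorphism \<phi> is R-linear and injective. A multiple by an element of
  \<open>I\<close> is sent to zero in R/I, so it is a boundary; the unit is sent to 1, which is
  nonzero when \<open>I\<close> is proper.\<close>

lemma dga_smult_boundary:
  assumes R: "cring R" and I: "ideal I R" and A: "dg_algebra R A" and H: "H0_is_quotient R A I"
  shows "\<And>r x. r \<in> I \<Longrightarrow> x \<in> carrier (grade (underlying A) 0) \<Longrightarrow>
      r \<odot>\<^bsub>grade (underlying A) 0\<^esub> x \<in> boundaries (underlying A) 0"
    and "I \<noteq> carrier R \<Longrightarrow> dgone A \<notin> boundaries (underlying A) 0"
proof -
  let ?X = "underlying A" and ?H = "H0_algebra A" and ?S = "R Quot I"
  let ?B = "boundaries ?X 0" and ?M = "grade ?X 0"
  have X: "chain_complex R ?X" and neg: "\<And>i. i < 0 \<Longrightarrow> carrier (grade ?X i) = {\<zero>\<^bsub>grade ?X i\<^esub>}"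
    and one: "dgone A \<in> carrier ?M"
    using A by (simp_all add: dg_algebra_def Let_def)
  interpret R: cring R by fact
  interpret I: ideal I R by fact
  interpret S: cring ?S by (rule I.quotient_is_cring[OF R])
  interpret M: module R ?M by (rule cpx_module[OF X])
  interpret B: additive_subgroup ?B ?M by (rule boundaries_additive_subgroup[OF X])
  obtain \<phi> where \<phi>: "\<phi> \<in> ring_iso ?H ?S"
    and lin: "\<And>r c. r \<in> carrier R \<Longrightarrow> c \<in> carrier ?H \<Longrightarrow> \<phi> (r \<odot>\<^bsub>?H\<^esub> c) = (I +>\<^bsub>R\<^esub> r) \<otimes>\<^bsub>?S\<^esub> \<phi> c"
    using H by (auto simp: H0_is_quotient_def)
  define cl where "cl x = ?B +>\<^bsub>?M\<^esub> x" for x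
  \<comment> \<open>In degree -1 the algebra vanishes, so every element of degree 0 is a
    cycle.\<close>
  have cyc: "x \<in> cycles ?X 0" if x: "x \<in> carrier ?M" for x
    using neg[of "- 1"] lin_closed[OF cpx_lin[OF X] x] x by (simp add: cycles_iff)
  have cl_carrier: "cl x \<in> carrier ?H" if x: "x \<in> carrier ?M" for x
    using cyc[OF x] by (auto simp: cl_def H0_algebra_def Let_def homology_carrier)
  \<comment> \<open>Scalar multiplication on homology is a union over representatives; these differ
    by boundaries, which are closed under scalars.\<close>
  have cl_smult: "r \<odot>\<^bsub>?H\<^esub> cl x = cl (r \<odot>\<^bsub>?M\<^esub> x)" if r: "r \<in> carrier R" and x: "x \<in> carrier ?M" for r x
  proof -
    have "cl (r \<odot>\<^bsub>?M\<^esub> x') = cl (r \<odot>\<^bsub>?M\<^esub> x)" if x': "x' \<in> cl x" for x'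
    proof -
      obtain b where b: "b \<in> ?B" "x' = b \<oplus>\<^bsub>?M\<^esub> x" using x' by (auto simp: cl_def mem_rcoset)
      have bc: "b \<in> carrier ?M" using b(1) B.a_subset by blast
      have "r \<odot>\<^bsub>?M\<^esub> x' = r \<odot>\<^bsub>?M\<^esub> b \<oplus>\<^bsub>?M\<^esub> r \<odot>\<^bsub>?M\<^esub> x" using b bc r x by (simp add: M.smult_r_distr)
      then show ?thesis
        unfolding cl_def
        using rcoset_eq_iff[OF M.M.abelian_group_axioms B.is_additive_subgroup, of "r \<odot>\<^bsub>?M\<^esub> x'" "r \<odot>\<^bsub>?M\<^esub>
            x"]
          boundaries_smult[OF X r b(1)] b bc r x by auto
    qed
    then have "(\<Union>x'\<in>cl x. cl (r \<odot>\<^bsub>?M\<^esub> x')) = (\<Union>x'\<in>cl x. cl (r \<odot>\<^bsub>?M\<^esub> x))"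
      by (intro SUP_cong refl)
    moreover have "x \<in> cl x" using x by (auto simp: cl_def mem_rcoset intro!: bexI[OF _
        B.zero_closed])
    then have "cl x \<noteq> {}" by blast
    ultimately show ?thesis
      by (simp add: cl_def H0_algebra_def Let_def homology_def quot_module_def a_r_coset_def
          r_coset_def)
  qed
  have zero: "\<phi> (cl (r \<odot>\<^bsub>?M\<^esub> x)) = \<zero>\<^bsub>?S\<^esub>" if r: "r \<in> I" and x: "x \<in> carrier ?M" for r x
  proof -
    have "\<phi> (cl x) \<in> carrier ?S" using \<phi> cl_carrier[OF x] by (auto simp: ring_iso_def ring_hom_def)
    moreover have "I +>\<^bsub>R\<^esub> r = \<zero>\<^bsub>?S\<^esub>"
      using R.a_coset_join2[OF _ I.a_subgroup r] r by (simp add: FactRing_def)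
    ultimately show ?thesis using lin[OF _ cl_carrier[OF x], of r] cl_smult[OF _ x, of r] r by simp
  qed
  have zero0: "\<phi> (cl \<zero>\<^bsub>?M\<^esub>) = \<zero>\<^bsub>?S\<^esub>" using zero[OF I.zero_closed M.M.zero_closed] by simp
  have inj: "x \<in> ?B" if x: "x \<in> carrier ?M" and e: "\<phi> (cl x) = \<zero>\<^bsub>?S\<^esub>" for x
  proof -
    have "inj_on \<phi> (carrier ?H)" using \<phi> by (auto simp: ring_iso_def bij_betw_def)
    then have "cl x = cl \<zero>\<^bsub>?M\<^esub>" using e zero0 cl_carrier[OF x] cl_carrier[OF M.M.zero_closed] by
        (metis inj_onD)
    then show ?thesis
      using rcoset_eq_iff[OF M.M.abelian_group_axioms B.is_additive_subgroup x M.M.zero_closed]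
          B.a_subset
      unfolding cl_def by (metis M.M.r_zero subsetD)
  qed
  show "r \<odot>\<^bsub>?M\<^esub> x \<in> ?B" if r: "r \<in> I" and x: "x \<in> carrier ?M" for r x
    by (rule inj[OF _ zero[OF r x]]) (use r x in simp)
  show "dgone A \<notin> ?B" if "I \<noteq> carrier R"
  proof
    assume b: "dgone A \<in> ?B"
    have "cl (dgone A) = cl \<zero>\<^bsub>?M\<^esub>"
      unfolding cl_def
      using rcoset_eq_iff[OF M.M.abelian_group_axioms B.is_additive_subgroup one M.M.zero_closed] b
          one
      by (metis M.M.r_zero)
    then have "\<phi> \<one>\<^bsub>?H\<^esub> = \<zero>\<^bsub>?S\<^esub>" using zero0 by (simp add: cl_def H0_algebra_def Let_def)
    then have "I +>\<^bsub>R\<^esub> \<one>\<^bsub>R\<^esub> = I" using \<phi> by (simp add: ring_iso_def ring_hom_def FactRing_def)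
    then have "\<one>\<^bsub>R\<^esub> \<in> I" using R.a_coset_join1[OF _ R.one_closed I.a_subgroup] by simp
    then show False using I.one_imp_carrier that by blast
  qed
qed

text \<open>The unit serves as \<open>u\<close>. Multiples of degree 0 elements by \<open>I\<close>
  are boundaries, so if the unit died modulo \<open>I\<close> it would be a boundary.\<close>

lemma dga_unit:
  assumes R: "cring R" and I: "ideal I R" "I \<noteq> carrier R" and A: "dg_algebra R A" and H:
      "H0_is_quotient R A I"
  shows "\<exists>u \<in> carrier (grade (underlying A) 0). bdry (underlying A) 0 u = \<zero>\<^bsub>grade (underlying A) (-
      1)\<^esub> \<and>
    \<not> dies R I (underlying A) 0 u"
proof (intro bexI conjI notI)
  let ?X = "underlying A"
  let ?B = "boundaries ?X 0" and ?M = "grade ?X 0"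
  have X: "chain_complex R ?X" and neg: "\<And>i. i < 0 \<Longrightarrow> carrier (grade ?X i) = {\<zero>\<^bsub>grade ?X i\<^esub>}"
    and one: "dgone A \<in> carrier ?M"
    using A by (simp_all add: dg_algebra_def Let_def)
  show "dgone A \<in> carrier ?M" by (rule one)
  show "bdry ?X 0 (dgone A) = \<zero>\<^bsub>grade ?X (- 1)\<^esub>"
    using neg[of "- 1"] lin_closed[OF cpx_lin[OF X] one] by simp
  interpret B: additive_subgroup ?B ?M by (rule boundaries_additive_subgroup[OF X])
  assume "dies R I ?X 0 (dgone A)"
  then obtain y e where y: "y \<in> carrier (grade ?X (0 + 1))" and e: "e \<in> ideal_smult R I ?M"
    and eq: "dgone A = bdry ?X (0 + 1) y \<oplus>\<^bsub>?M\<^esub> e"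
    unfolding dies_def by blast
  have "e \<in> ?B" using e
    by induction (use dga_smult_boundary(1)[OF R I(1) A H] in auto)
  moreover have "bdry ?X (0 + 1) y \<in> ?B" using y by (auto simp: boundaries_def)
  ultimately have "dgone A \<in> ?B" unfolding eq by simp
  then show False using dga_smult_boundary(2)[OF R I(1) A H I(2)] by blast
qed

text \<open>The multiple of the unit by \<open>y\<close> is the boundary of some \<open>a\<close> of
  degree 1, and left multiplication by \<open>a\<close> is the null-homotopy: by the Leibniz rule,
  \<partial>(a x) = y x - a \<partial>x.\<close>

lemma dga_null_homotopic:
  assumes R: "cring R" and I: "ideal I R" and A: "dg_algebra R A" and H: "H0_is_quotient R A I" and
      y: "y \<in> I"
  shows "null_homotopic R (underlying A) y"
proof -
  let ?X = "underlying A"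
  let ?G = "grade ?X"
  interpret ideal I R by fact
  have yR: "y \<in> carrier R" using y by simp
  note D = A[unfolded dg_algebra_def Let_def]
  have X: "chain_complex R ?X" and one: "dgone A \<in> carrier (?G 0)"
    using D by blast+
  \<comment> \<open>Extracts linearity in the right and in the left factor, and the Leibniz
    rule.\<close>
  note lr = D[THEN conjunct2, THEN conjunct2, THEN conjunct1, rule_format]
    and ll = D[THEN conjunct2, THEN conjunct2, THEN conjunct2, THEN conjunct1, rule_format]
    and leib = D[THEN conjunct2, THEN conjunct2, THEN conjunct2, THEN conjunct2, THEN conjunct2,
        THEN conjunct2, THEN conjunct2,
      THEN conjunct1, rule_format]
  have unit: "dgmult A 0 i (dgone A) a = a" if "a \<in> carrier (?G i)" for i a
    using D[THEN conjunct2, THEN conjunct2, THEN conjunct2, THEN conjunct2, THEN conjunct2, THEN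
        conjunct2, THEN conjunct1,
        rule_format, OF that] by blast
  obtain a where a: "a \<in> carrier (?G 1)" "bdry ?X 1 a = y \<odot>\<^bsub>?G 0\<^esub> dgone A"
    using dga_smult_boundary(1)[OF R I A H y one] by (auto simp: boundaries_def)
  show ?thesis
    unfolding null_homotopic_def
  proof (intro exI conjI allI ballI)
    show lin: "lin_map R (?G i) (?G (i + 1)) (\<lambda>x. dgmult A 1 i a x)" for i
      using lr[OF a(1), of i] by (simp add: add.commute)
    fix i x assume x: "x \<in> carrier (?G i)"
    interpret M: module R "?G i" by (rule cpx_module[OF X])
    have "dgmult A 0 i (y \<odot>\<^bsub>?G 0\<^esub> dgone A) x = y \<odot>\<^bsub>?G i\<^esub> x"
      using lin_smult[OF ll[OF x, of 0] yR one] unit[OF x] by simp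
    then have b: "bdry ?X (i + 1) (dgmult A 1 i a x) =
        y \<odot>\<^bsub>?G i\<^esub> x \<oplus>\<^bsub>?G i\<^esub> \<ominus>\<^bsub>?G i\<^esub> dgmult A 1 (i - 1) a (bdry ?X i x)"
      using leib[OF a(1) x] a(2) by (simp add: alt_sign_def add.commute)
    have "dgmult A 1 (i - 1) a (bdry ?X i x) \<in> carrier (?G i)"
      using lin_closed[OF lin lin_closed[OF cpx_lin[OF X] x]] by simp
    then show "y \<odot>\<^bsub>?G i\<^esub> x = bdry ?X (i + 1) (dgmult A 1 i a x) \<oplus>\<^bsub>?G i\<^esub> dgmult A 1 (i - 1) a (bdry ?X i
        x)"
      unfolding b using yR x by (simp add: M.M.a_assoc M.M.l_neg)
  qed
qed

section \<open>Koszul complexes\<close>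

definition ring_sign :: "('r, 'x) ring_scheme \<Rightarrow> nat \<Rightarrow> 'r" where
  "ring_sign R k = (if even k then \<one>\<^bsub>R\<^esub> else \<ominus>\<^bsub>R\<^esub> \<one>\<^bsub>R\<^esub>)"

text \<open>The number of transpositions that move e_s past the smaller members of T, hence the
  exponent of its sign.\<close>

definition rank_in :: "nat \<Rightarrow> nat set \<Rightarrow> nat" where
  "rank_in s T = card {t \<in> T. t < s}"

lemma rank_in_remove_self: "rank_in s (T - {s}) = rank_in s T"
  unfolding rank_in_def by (rule arg_cong[where f = card]) auto

lemma rank_in_insert_self: "rank_in s (insert s T) = rank_in s T"
  unfolding rank_in_def by (rule arg_cong[where f = card]) auto

lemma rank_in_less:
  assumes "s < t" shows "rank_in s (insert t T) = rank_in s T" "rank_in s (T - {t}) = rank_in s T"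
  unfolding rank_in_def by (rule arg_cong[where f = card]; use assms in auto)+

lemma rank_in_greater:
  assumes "finite T" "t < s"
  shows "t \<notin> T \<Longrightarrow> rank_in s (insert t T) = Suc (rank_in s T)"
    and "t \<in> T \<Longrightarrow> rank_in s T = Suc (rank_in s (T - {t}))"
proof -
  show "rank_in s (insert t T) = Suc (rank_in s T)" if "t \<notin> T" for T
    unfolding rank_in_def
  proof (cases "finite {t \<in> T. t < s}")
    case True
    have "{u \<in> insert t T. u < s} = insert t {u \<in> T. u < s}" using assms(2) by auto
    then show "card {u \<in> insert t T. u < s} = Suc (card {t \<in> T. t < s})" using True that by simp
  next
    case False
    moreover have "finite {t \<in> T. t < s}" by (rule finite_subset[of _ "{..<s}"]) auto
    ultimately show "card {u \<in> insert t T. u < s} = Suc (card {t \<in> T. t < s})" by blast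
  qed
  from this[of "T - {t}"] show "t \<in> T \<Longrightarrow> rank_in s T = Suc (rank_in s (T - {t}))"
    by (simp add: insert_absorb)
qed

text \<open>Exterior multiplication by e_s from the left, in coordinates.\<close>

definition wedge_left :: "('r, 'x) ring_scheme \<Rightarrow> nat \<Rightarrow> (nat set \<Rightarrow> 'r) \<Rightarrow> nat set \<Rightarrow> 'r" where
  "wedge_left R s c T = (if s \<in> T then ring_sign R (rank_in s T) \<otimes>\<^bsub>R\<^esub> c (T - {s}) else \<zero>\<^bsub>R\<^esub>)"

context cring
begin

lemma ring_sign_closed [simp]: "ring_sign R k \<in> carrier R"
  by (simp add: ring_sign_def)

lemma ring_sign_Suc: "ring_sign R (Suc k) = \<ominus> ring_sign R k"
  by (simp add: ring_sign_def)

lemma ring_sign_square: "ring_sign R k \<otimes> ring_sign R k = \<one>"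
  by (simp add: ring_sign_def l_minus r_minus)

lemma koszul_coordinate_ext:
  assumes "c \<in> carrier (grade (koszul R xs) i)" "d \<in> carrier (grade (koszul R xs) i)"
    and "\<And>T. T \<subseteq> {..<length xs} \<Longrightarrow> int (card T) = i \<Longrightarrow> c T = d T"
  shows "c = d"
proof
  fix T
  show "c T = d T"
    using assms by (cases "T \<subseteq> {..<length xs} \<and> int (card T) = i") (auto simp: koszul_def
        free_module_def)
qed

lemma koszul_closed: "c \<in> carrier (grade (koszul R xs) i) \<Longrightarrow> c T \<in> carrier R"
  by (auto simp: koszul_def intro: free_module_coordinate[OF is_cring])

text \<open>Separates sign, ring element and coefficient, so that commutativity can reorder them.
  The condition on \<open>c\<close> is pointwise, as it is applied to \<open>wedge_left\<close>
  too.\<close>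

lemma koszul_bdry:
  assumes xs: "set xs \<subseteq> carrier R" and c: "\<And>T. c T \<in> carrier R"
  shows "bdry (koszul R xs) i c T =
    (\<Oplus>s\<in>{..<length xs} - T. ring_sign R (rank_in s T) \<otimes> (xs ! s \<otimes> c (insert s T)))"
  unfolding koszul_def cpx.simps
proof (rule finsum_cong'[OF refl])
  have "xs ! s \<in> carrier R" if "s < length xs" for s using xs that by auto
  then show "(\<lambda>s. ring_sign R (rank_in s T) \<otimes> (xs ! s \<otimes> c (insert s T))) \<in> {..<length xs} - T \<rightarrow>
      carrier R"
    using c by simp
  fix s assume "s \<in> {..<length xs} - T"
  then have "xs ! s \<in> carrier R" using xs by auto
  then show "(if even (card {t \<in> T. t < s}) then xs ! s else \<ominus> (xs ! s)) \<otimes> c (insert s T) =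
      ring_sign R (rank_in s T) \<otimes> (xs ! s \<otimes> c (insert s T))"
    using c by (simp add: ring_sign_def rank_in_def l_minus)
qed

text \<open>The homotopy is e_s \<and> -, by the Leibniz rule \<partial>(e_s \<and> c) = x_s c - e_s
  \<and> \<partial>c. It is verified in the coordinate T, separately for s outside and inside
  T.\<close>

lemma koszul_null_homotopic:
  assumes K: "chain_complex R (koszul R xs)" and xs: "set xs \<subseteq> carrier R" and s: "s < length xs"
  shows "null_homotopic R (koszul R xs) (xs ! s)"
  unfolding null_homotopic_def
proof (intro exI conjI allI ballI)
  let ?K = "koszul R xs" and ?n = "{..<length xs}"
  have x: "xs ! t \<in> carrier R" if "t < length xs" for t using xs that by auto
  have wc: "wedge_left R s c T \<in> carrier R" if "\<And>T. c T \<in> carrier R" for c T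
    using that by (simp add: wedge_left_def)
  show lin: "lin_map R (grade ?K i) (grade ?K (i + 1)) (wedge_left R s)" for i
  proof (rule lin_mapI)
    fix c assume c: "c \<in> carrier (grade ?K i)"
    have "wedge_left R s c T = \<zero>" if T: "\<not> (T \<subseteq> ?n \<and> int (card T) = i + 1)" for T
    proof (cases "s \<in> T")
      case True
      have "\<not> (T - {s} \<subseteq> ?n \<and> int (card (T - {s})) = i)"
      proof
        assume *: "T - {s} \<subseteq> ?n \<and> int (card (T - {s})) = i"
        then have "finite T" by (meson finite_Diff2 finite_insert finite.emptyI finite_lessThan
            finite_subset)
        then have "int (card T) = i + 1" using * True by (simp add: card_Suc_Diff1[symmetric] del:
            card_Diff_insert)
        then show False using T * s by auto
      qed
      then have "c (T - {s}) = \<zero>" using c by (auto simp: koszul_def free_module_def)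
      then show ?thesis by (simp add: wedge_left_def)
    qed (simp add: wedge_left_def)
    then show "wedge_left R s c \<in> carrier (grade ?K (i + 1))"
      using wc[of c] koszul_closed[OF c] by (auto simp: koszul_def free_module_def)
  next
    fix c d assume c: "c \<in> carrier (grade ?K i)" "d \<in> carrier (grade ?K i)"
    show "wedge_left R s (c \<oplus>\<^bsub>grade ?K i\<^esub> d) = wedge_left R s c \<oplus>\<^bsub>grade ?K (i + 1)\<^esub> wedge_left R s d"
      using koszul_closed[OF c(1)] koszul_closed[OF c(2)]
      by (simp add: koszul_def free_module_def wedge_left_def fun_eq_iff r_distr)
  next
    fix r c assume r: "r \<in> carrier R" and c: "c \<in> carrier (grade ?K i)"
    show "wedge_left R s (r \<odot>\<^bsub>grade ?K i\<^esub> c) = r \<odot>\<^bsub>grade ?K (i + 1)\<^esub> wedge_left R s c"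
      using koszul_closed[OF c] r
      by (simp add: koszul_def free_module_def wedge_left_def fun_eq_iff m_lcomm)
  qed
  fix i c assume c: "c \<in> carrier (grade ?K i)"
  interpret M: module R "grade ?K i" by (rule cpx_module[OF K])
  note cc = koszul_closed[OF c]
  have bw: "bdry ?K (i + 1) (wedge_left R s c) \<in> carrier (grade ?K i)"
    by (rule lin_closed[OF cpx_lin1[OF K] lin_closed[OF lin c]])
  have wb: "wedge_left R s (bdry ?K i c) \<in> carrier (grade ?K i)"
    using lin_closed[OF lin lin_closed[OF cpx_lin[OF K] c]] by simp
  show "xs ! s \<odot>\<^bsub>grade ?K i\<^esub> c =
      bdry ?K (i + 1) (wedge_left R s c) \<oplus>\<^bsub>grade ?K i\<^esub> wedge_left R s (bdry ?K i c)"
  proof (rule koszul_coordinate_ext)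
    show "xs ! s \<odot>\<^bsub>grade ?K i\<^esub> c \<in> carrier (grade ?K i)" by (rule M.smult_closed[OF x[OF s] c])
    show "bdry ?K (i + 1) (wedge_left R s c) \<oplus>\<^bsub>grade ?K i\<^esub> wedge_left R s (bdry ?K i c) \<in> carrier
        (grade ?K i)"
      by (rule M.M.a_closed[OF bw wb])
    fix T assume T: "T \<subseteq> ?n"
    then have fT: "finite T" by (rule finite_subset) simp
    have w: "(\<lambda>t. ring_sign R (rank_in t T) \<otimes> (xs ! t \<otimes> wedge_left R s c (insert t T))) \<in> ?n - T \<rightarrow>
        carrier R"
      using wc[OF cc] x by auto
    have "xs ! s \<otimes> c T = bdry ?K (i + 1) (wedge_left R s c) T \<oplus> wedge_left R s (bdry ?K i c) T"
    proof (cases "s \<in> T")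
      \<comment> \<open>If s is outside T, only t = s makes insert t T contain s, and its sign
        occurs twice. The other term vanishes at T.\<close>
      case False
      have "ring_sign R (rank_in t T) \<otimes> (xs ! t \<otimes> wedge_left R s c (insert t T)) =
          (if s = t then xs ! t \<otimes> c T else \<zero>)" if t: "t \<in> ?n - T" for t
      proof (cases "s = t")
        case True
        have "ring_sign R (rank_in s T) \<otimes> (xs ! s \<otimes> (ring_sign R (rank_in s T) \<otimes> c T)) =
            (ring_sign R (rank_in s T) \<otimes> ring_sign R (rank_in s T)) \<otimes> (xs ! s \<otimes> c T)"
          using x[OF s] cc by (simp add: m_ac)
        also have "\<dots> = xs ! s \<otimes> c T" using x[OF s] cc by (simp add: ring_sign_square)
        finally show ?thesis using True False by (simp add: wedge_left_def rank_in_insert_self)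
      next
        case neq: False
        then show ?thesis using False x t by (simp add: wedge_left_def)
      qed
      then have "bdry ?K (i + 1) (wedge_left R s c) T = (\<Oplus>t\<in>?n - T. if s = t then xs ! t \<otimes> c T else
          \<zero>)"
        unfolding koszul_bdry[OF xs wc[OF cc]]
        by (intro finsum_cong'[OF refl]) (use x cc in auto)
      also have "\<dots> = xs ! s \<otimes> c T" by (rule finsum_singleton) (use s False x cc in auto)
      finally show ?thesis using False x[OF s] cc by (simp add: wedge_left_def)
    next
      \<comment> \<open>If s is in T, the summand t = s of the boundary gives x_s c T, and the
        remaining summands must cancel against those of the other term.\<close>
      case True
      let ?T = "T - {s}" and ?f = "\<lambda>t. ring_sign R (rank_in t (T - {s})) \<otimes> (xs ! t \<otimes> c (insert t (T
          - {s})))"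
      have f: "?f \<in> ?n - T \<rightarrow> carrier R" using x cc by auto
      have "bdry ?K i c ?T = (\<Oplus>t\<in>insert s (?n - T). ?f t)"
      proof -
        have "?n - ?T = insert s (?n - T)" using True s by auto
        then show ?thesis unfolding koszul_bdry[OF xs cc] by simp
      qed
      also have "\<dots> = ?f s \<oplus> (\<Oplus>t\<in>?n - T. ?f t)"
        by (rule finsum_insert) (use True f x[OF s] cc in auto)
      finally have "wedge_left R s (bdry ?K i c) T =
          ring_sign R (rank_in s T) \<otimes> ?f s \<oplus> ring_sign R (rank_in s T) \<otimes> (\<Oplus>t\<in>?n - T. ?f t)"
        using True f x[OF s] cc by (simp add: wedge_left_def r_distr)
      also have "ring_sign R (rank_in s T) \<otimes> ?f s =
          (ring_sign R (rank_in s T) \<otimes> ring_sign R (rank_in s T)) \<otimes> (xs ! s \<otimes> c T)"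
        using x[OF s] cc True by (simp add: rank_in_remove_self insert_absorb m_ac)
      also have "\<dots> = xs ! s \<otimes> c T" using x[OF s] cc by (simp add: ring_sign_square)
      also have "ring_sign R (rank_in s T) \<otimes> (\<Oplus>t\<in>?n - T. ?f t) = (\<Oplus>t\<in>?n - T. ring_sign R (rank_in s
          T) \<otimes> ?f t)"
        by (rule finsum_rdistr) (use f in auto)
      finally have wedge: "wedge_left R s (bdry ?K i c) T =
          xs ! s \<otimes> c T \<oplus> (\<Oplus>t\<in>?n - T. ring_sign R (rank_in s T) \<otimes> ?f t)" .
      have sum0: "(\<Oplus>t\<in>?n - T. ring_sign R (rank_in t T) \<otimes> (xs ! t \<otimes> wedge_left R s c (insert t T)))
          \<oplus>
          (\<Oplus>t\<in>?n - T. ring_sign R (rank_in s T) \<otimes> ?f t) = (\<Oplus>t\<in>?n - T. \<zero>)"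
      proof -
        have "ring_sign R (rank_in t T) \<otimes> (xs ! t \<otimes> wedge_left R s c (insert t T)) \<oplus>
            ring_sign R (rank_in s T) \<otimes> ?f t = \<zero>" if t: "t \<in> ?n - T" for t
        proof -
          have ts: "t \<noteq> s" using t True by auto
          \<comment> \<open>Exchanging e_s and e_t costs one sign: of the two positions, only that
            of the larger index changes when the smaller one is inserted or removed.\<close>
          have sgn: "ring_sign R (rank_in t T) \<otimes> ring_sign R (rank_in s (insert t T)) =
              \<ominus> (ring_sign R (rank_in s T) \<otimes> ring_sign R (rank_in t ?T))"
          proof (cases "s < t")
            case True
            then show ?thesis
              using rank_in_less(1)[OF True] rank_in_greater(2)[OF fT True \<open>s \<in> T\<close>]
              by (simp add: ring_sign_Suc l_minus r_minus m_comm)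
          next
            case False
            then have "t < s" using ts by simp
            then show ?thesis
              using rank_in_less(2)[OF \<open>t < s\<close>] rank_in_greater(1)[OF fT \<open>t < s\<close>] t
              by (simp add: ring_sign_Suc r_minus m_comm)
          qed
          have xt: "xs ! t \<in> carrier R" using x t by simp
          have ins: "insert t T - {s} = insert t ?T" using ts by auto
          have "ring_sign R (rank_in t T) \<otimes> (xs ! t \<otimes> wedge_left R s c (insert t T)) =
              (ring_sign R (rank_in t T) \<otimes> ring_sign R (rank_in s (insert t T))) \<otimes> (xs ! t \<otimes> c
              (insert t ?T))"
            using True xt cc ins by (simp add: wedge_left_def m_ac)
          also have "\<dots> = \<ominus> (ring_sign R (rank_in s T) \<otimes> ?f t)"
            unfolding sgn using xt cc by (simp add: l_minus m_assoc)
          finally show ?thesis using xt cc by (simp add: l_neg)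
        qed
        then have "(\<Oplus>t\<in>?n - T. ring_sign R (rank_in t T) \<otimes> (xs ! t \<otimes> wedge_left R s c (insert t T))
            \<oplus>
            ring_sign R (rank_in s T) \<otimes> ?f t) = (\<Oplus>t\<in>?n - T. \<zero>)"
          by (intro finsum_cong'[OF refl]) auto
        moreover have "(\<lambda>t. ring_sign R (rank_in s T) \<otimes> ?f t) \<in> ?n - T \<rightarrow> carrier R" using f by auto
        ultimately show ?thesis using finsum_addf[OF w] by simp
      qed
      have fc: "(\<Oplus>t\<in>?n - T. ring_sign R (rank_in s T) \<otimes> ?f t) \<in> carrier R"
        by (rule finsum_closed) (use f in auto)
      show ?thesis
        unfolding wedge koszul_bdry[OF xs wc[OF cc]]
        using sum0 finsum_closed[OF w] fc x[OF s] cc[of T] by (simp add: a_lcomm)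
    qed
    then show "(xs ! s \<odot>\<^bsub>grade ?K i\<^esub> c) T =
        (bdry ?K (i + 1) (wedge_left R s c) \<oplus>\<^bsub>grade ?K i\<^esub> wedge_left R s (bdry ?K i c)) T"
      by (simp add: koszul_def free_module_def)
  qed
qed

text \<open>The basis vector of the empty set serves as \<open>u\<close>. Boundaries into degree 0
  have their coefficient in \<open>I\<close>, because the entries of \<open>xs\<close> are in
  \<open>I\<close>; were \<open>u\<close> to die, \<open>I\<close> would contain 1.\<close>

lemma koszul_unit:
  assumes K: "chain_complex R (koszul R xs)" and xs: "set xs \<subseteq> I" and I: "ideal I R" "I \<noteq> carrier R"
  shows "\<exists>u \<in> carrier (grade (koszul R xs) 0). bdry (koszul R xs) 0 u = \<zero>\<^bsub>grade (koszul R xs) (- 1)\<^esub> \<and>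
    \<not> dies R I (koszul R xs) 0 u"
proof (intro bexI conjI notI)
  let ?K = "koszul R xs" and ?u = "\<lambda>S :: nat set. if S = {} then \<one> else \<zero>"
  interpret I: ideal I R by fact
  have xsR: "set xs \<subseteq> carrier R" using xs I.a_subset by blast
  show u: "?u \<in> carrier (grade ?K 0)" by (auto simp: koszul_def free_module_def)
  have empty: "{S. S \<subseteq> {..<length xs} \<and> int (card S) = - 1} = {}" by auto
  have "carrier (grade ?K (- 1)) = {\<zero>\<^bsub>grade ?K (- 1)\<^esub>}"
    by (auto simp: koszul_def empty free_module_def)
  then show "bdry ?K 0 ?u = \<zero>\<^bsub>grade ?K (- 1)\<^esub>" using lin_closed[OF cpx_lin[OF K] u] by simp
  assume "dies R I ?K 0 ?u"
  then obtain y e where y: "y \<in> carrier (grade ?K (0 + 1))" and e: "e \<in> ideal_smult R I (grade ?K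
      0)"
    and eq: "?u = bdry ?K (0 + 1) y \<oplus>\<^bsub>grade ?K 0\<^esub> e"
    unfolding dies_def by blast
  note yc = koszul_closed[OF y]
  have fin: "finite {S. S \<subseteq> {..<length xs} \<and> int (card S) = 0}" by simp
  have "e \<in> carrier (grade ?K 0)" by (rule ideal_smult_closed[OF cpx_module[OF K] I.a_subset e])
  then have eI: "e {} \<in> I"
    using free_module_ideal_smult_iff[OF is_cring I(1) fin] e by (auto simp: koszul_def)
  have "(\<Oplus>s\<in>A. ring_sign R (rank_in s {}) \<otimes> (xs ! s \<otimes> y (insert s {}))) \<in> I"
    if "finite A" "A \<subseteq> {..<length xs}" for A
    using that
  proof induction
    case (insert a A)
    then have "xs ! a \<in> I" using xs by auto
    then have "ring_sign R (rank_in a {}) \<otimes> (xs ! a \<otimes> y (insert a {})) \<in> I"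
      using yc by (intro I.I_l_closed I.I_r_closed) auto
    moreover have "xs ! s \<in> carrier R" if "s \<in> A" for s
      using xsR insert.prems that by (meson insert_subset lessThan_iff nth_mem subsetD)
    then have "(\<lambda>s. ring_sign R (rank_in s {}) \<otimes> (xs ! s \<otimes> y (insert s {}))) \<in> A \<rightarrow> carrier R"
      using yc by simp
    ultimately show ?case using insert by simp
  qed simp
  from this[of "{..<length xs} - {}"] have "bdry ?K (0 + 1) y {} \<in> I"
    unfolding koszul_bdry[OF xsR yc] by simp
  moreover have "\<one> = bdry ?K (0 + 1) y {} \<oplus> e {}"
    using fun_cong[OF eq, of "{}"] by (simp add: koszul_def free_module_def)
  ultimately have "\<one> \<in> I" using eI by simp
  then show False using I.one_imp_carrier I(2) by blast
qed

end

theorem proposition3p5: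
  fixes R :: "('r, 'x) ring_scheme" and \<mm> I :: "'r set"
  assumes "noetherian_local_ring R \<mm>"
    and "ideal I R" and "I \<noteq> carrier R"
  shows "(\<forall>A :: ('r, 'a) dga.
            dg_algebra R A \<longrightarrow> H0_is_quotient R A I \<longrightarrow> minimal_cpx R \<mm> (underlying A) \<longrightarrow>
            level TYPE('u) R (underlying A) \<ge> free_rank (R Quot I) (conormal R I) + 1) \<and>
         (\<forall>xs. set xs \<subseteq> carrier R \<longrightarrow> I = Idl\<^bsub>R\<^esub> (set xs) \<longrightarrow>
            level TYPE('u) R (koszul R xs) \<ge> free_rank (R Quot I) (conormal R I) + 1)"
proof (intro conjI allI impI)
  have R: "cring R" using assms(1) by (simp add: noetherian_local_ring_def)
  show "level TYPE('u) R (underlying A) \<ge> free_rank (R Quot I) (conormal R I) + 1"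
    if "dg_algebra R A" "H0_is_quotient R A I" for A :: "('r, 'a) dga"
    by (rule level_lower_bound[OF R assms(2)])
      (rule dga_unit[OF R assms(2,3) that], rule dga_null_homotopic[OF R assms(2) that])
  fix xs assume xs: "set xs \<subseteq> carrier R" "I = Idl\<^bsub>R\<^esub> (set xs)"
  interpret cring R by (rule R)
  have xsI: "set xs \<subseteq> I" using genideal_self[OF xs(1)] xs(2) by simp
  show "level TYPE('u) R (koszul R xs) \<ge> free_rank (R Quot I) (conormal R I) + 1"
  proof (rule level_lower_bound[OF R assms(2)])
    show "\<exists>u \<in> carrier (grade (koszul R xs) 0). bdry (koszul R xs) 0 u = \<zero>\<^bsub>grade (koszul R xs) (- 1)\<^esub>
        \<and>
      \<not> dies R I (koszul R xs) 0 u" if "chain_complex R (koszul R xs)"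
      by (rule koszul_unit[OF that xsI assms(2,3)])
    fix y assume K: "chain_complex R (koszul R xs)" and y: "y \<in> I"
    \<comment> \<open>Null-homotopic multipliers form an ideal, so it suffices to treat the
      generators in \<open>xs\<close>.\<close>
    have "Idl\<^bsub>R\<^esub> (set xs) \<subseteq> {y \<in> carrier R. null_homotopic R (koszul R xs) y}"
      by (rule genideal_minimal[OF null_homotopic_ideal[OF R K]])
        (use xs(1) koszul_null_homotopic[OF K xs(1)] in \<open>auto simp: in_set_conv_nth\<close>)
    then show "null_homotopic R (koszul R xs) y" using y xs(2) by blast
  qed
qed

end
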